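(* Let $n\ge 1$, let $\lambda^*$ be a partition of the integer $n$, and let $\Pi_n$ be a PES (partially exchangeable and stationary) random partition of $[n]$ with constant ranked shape, i.e. $s^\downarrow(\Pi_n)=\lambda^*$ almost surely. Then $\Pi_n$ is exchangeable, and its distribution is an extreme point of the convex polytope of all distributions of PES partitions of $[n]$.
   Context: $[n]=\{1,\dots,n\}$, and $\mathcal P_n$ is the finite set of all set partitions of $[n]$. A random partition of $[n]$ is a random variable $\Pi_n$ with values in $\mathcal P_n$. Blocks of a partition are listed in increasing order of their least elements; the shape $s(\pi_n)$ is the composition of $n$ given by the block sizes in this order, and the ranked shape $s^\downarrow(\pi_n)$ is the partition of the integer $n$ given by the block sizes in nonincreasing order. For $1\le j\le n$ the operator $D_j:\mathcal P_n\to\mathcal P_{n-1}$ deletes the element $j$ from its block (removing the block if it becomes empty) and then relabels the remaining elements by $[n-1]$ via the increasing bijection. $\Pi_n$ is partially exchangeable if $\mathbb P[\Pi_n=\pi_n]$ depends only on $s(\pi_n)$; stationary if $D_1\Pi_n\stackrel{d}{=}D_n\Pi_n$; PES if it is both partially exchangeable and stationary; exchangeable if $\mathbb P[\Pi_n=\pi_n]$ depends only on $s^\downarrow(\pi_n)$. *)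

theory Defs
  imports "HOL-Probability.Probability" "HOL-Analysis.Finite_Function_Topology"
begin

definition set_partitions :: "nat \<Rightarrow> nat set set set" where
  "set_partitions n = {\<pi>. partition_on {1..n} \<pi>}"

lemma finite_set_partitions [simp]: "finite (set_partitions n)"
  unfolding set_partitions_def by (rule finitely_many_partition_on) simp

definition integer_partition :: "nat \<Rightarrow> nat list \<Rightarrow> bool" where
  "integer_partition n ks \<longleftrightarrow> sorted_wrt (\<ge>) ks \<and> 0 \<notin> set ks \<and> sum_list ks = n"

definition shape :: "nat set set \<Rightarrow> nat list" where
  "shape \<pi> = map card (sorted_key_list_of_set Min \<pi>)"

text \<open>The library specifies \<^const>\<open>sorted_key_list_of_set\<close> only for keys that are injective
  on the set; the next facts confirm that this applies to the blocks of a partition, with the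
  expected result.\<close>

lemma inj_on_Min_blocks:
  assumes "\<pi> \<in> set_partitions n"
  shows "inj_on Min \<pi>"
proof (rule inj_onI, rule ccontr)
  fix A B assume AB: "A \<in> \<pi>" "B \<in> \<pi>" "Min A = Min B" "A \<noteq> B"
  have p: "partition_on {1..n} \<pi>" using assms by (simp add: set_partitions_def)
  have sub: "C \<subseteq> {1..n}" "C \<noteq> {}" if "C \<in> \<pi>" for C
    using p that unfolding partition_on_def by auto
  have "Min A \<in> A" "Min B \<in> B"
    using sub AB finite_subset[OF _ finite_atLeastAtMost] by (meson Min_in)+
  moreover have "A \<inter> B = {}"
    using AB p unfolding partition_on_def disjoint_def by blast
  ultimately show False using AB by auto
qed

lemma (in linorder) sorted_key_list_of_set_eqI:
  assumes "inj_on f (set xs)" "sorted (map f xs)" "distinct xs"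
  shows "sorted_key_list_of_set f (set xs) = xs"
proof -
  interpret folding_insort_key "(\<le>)" "(<)" "set xs" f
    by unfold_locales (rule assms(1))
  show ?thesis
    using assms by (intro idem_if_sorted_distinct) auto
qed

lemma shape_eqI:
  assumes "set Bs \<in> set_partitions n" "sorted (map Min Bs)" "distinct Bs"
  shows "shape (set Bs) = map card Bs"
  using sorted_key_list_of_set_eqI[OF inj_on_Min_blocks] assms by (simp add: shape_def)

definition ranked_shape :: "nat set set \<Rightarrow> nat list" where
  "ranked_shape \<pi> = rev (sort (shape \<pi>))"

definition delete_element :: "nat \<Rightarrow> nat set set \<Rightarrow> nat set set" where
  "delete_element j \<pi> = (\<lambda>B. (\<lambda>i. if i < j then i else i - 1) ` (B - {j})) ` \<pi> - {{}}"

lemma delete_element_in_set_partitions: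
  assumes "\<pi> \<in> set_partitions n" "1 \<le> j" "j \<le> n"
  shows "delete_element j \<pi> \<in> set_partitions (n - 1)"
proof -
  let ?f = "\<lambda>i::nat. if i < j then i else i - 1"
  have p: "partition_on {1..n} \<pi>" using assms by (simp add: set_partitions_def)
  have inj: "inj_on ?f (- {j})"
    using assms(2) by (auto simp: inj_on_def split: if_splits)
  have img: "?f ` ({1..n} - {j}) = {1..n - 1}"
  proof
    show "?f ` ({1..n} - {j}) \<subseteq> {1..n - 1}" using assms(2,3) by auto
    show "{1..n - 1} \<subseteq> ?f ` ({1..n} - {j})"
    proof
      fix i assume i: "i \<in> {1..n - 1}"
      show "i \<in> ?f ` ({1..n} - {j})"
      proof (cases "i < j")
        case True
        show ?thesis by (rule image_eqI[of _ _ i]) (use True i in auto)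
      next
        case False
        show ?thesis by (rule image_eqI[of _ _ "Suc i"]) (use False i in auto)
      qed
    qed
  qed
  have "\<Union> (delete_element j \<pi>) = ?f ` (\<Union>\<pi> - {j})"
    unfolding delete_element_def by blast
  also have "\<dots> = {1..n - 1}" using p img by (simp add: partition_on_def)
  finally have un: "\<Union> (delete_element j \<pi>) = {1..n - 1}" .
  have "disjoint (delete_element j \<pi>)"
  proof (rule disjointI)
    fix A B assume AB: "A \<in> delete_element j \<pi>" "B \<in> delete_element j \<pi>" "A \<noteq> B"
    then obtain A' B' where *: "A' \<in> \<pi>" "B' \<in> \<pi>" "A = ?f ` (A' - {j})" "B = ?f ` (B' - {j})"
      unfolding delete_element_def by blast
    then have "A' \<noteq> B'" using AB by auto
    then have "A' \<inter> B' = {}" using p * unfolding partition_on_def disjoint_def by blast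
    moreover have "A \<inter> B = ?f ` ((A' - {j}) \<inter> (B' - {j}))"
      unfolding * by (rule inj_on_image_Int[OF inj, symmetric]) auto
    ultimately show "A \<inter> B = {}" by auto
  qed
  with un show ?thesis
    unfolding set_partitions_def partition_on_def by (simp add: delete_element_def)
qed

definition random_partition :: "nat \<Rightarrow> 'w measure \<Rightarrow> ('w \<Rightarrow> nat set set) \<Rightarrow> bool" where
  "random_partition n M X \<longleftrightarrow> prob_space M \<and> X \<in> measurable M (count_space (set_partitions n))"

definition exchangeable :: "nat \<Rightarrow> 'w measure \<Rightarrow> ('w \<Rightarrow> nat set set) \<Rightarrow> bool" where
  "exchangeable n M X \<longleftrightarrow>
     (\<forall>\<pi> \<in> set_partitions n. \<forall>\<rho> \<in> set_partitions n. ranked_shape \<pi> = ranked_shape \<rho> \<longrightarrow>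
        \<P>(\<omega> in M. X \<omega> = \<pi>) = \<P>(\<omega> in M. X \<omega> = \<rho>))"

definition partially_exchangeable :: "nat \<Rightarrow> 'w measure \<Rightarrow> ('w \<Rightarrow> nat set set) \<Rightarrow> bool" where
  "partially_exchangeable n M X \<longleftrightarrow>
     (\<forall>\<pi> \<in> set_partitions n. \<forall>\<rho> \<in> set_partitions n. shape \<pi> = shape \<rho> \<longrightarrow>
        \<P>(\<omega> in M. X \<omega> = \<pi>) = \<P>(\<omega> in M. X \<omega> = \<rho>))"

definition stationary :: "nat \<Rightarrow> 'w measure \<Rightarrow> ('w \<Rightarrow> nat set set) \<Rightarrow> bool" where
  "stationary n M X \<longleftrightarrow>
     distr M (count_space (set_partitions (n - 1))) (\<lambda>\<omega>. delete_element 1 (X \<omega>)) =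
     distr M (count_space (set_partitions (n - 1))) (\<lambda>\<omega>. delete_element n (X \<omega>))"

definition PES :: "nat \<Rightarrow> 'w measure \<Rightarrow> ('w \<Rightarrow> nat set set) \<Rightarrow> bool" where
  "PES n M X \<longleftrightarrow> random_partition n M X \<and> partially_exchangeable n M X \<and> stationary n M X"

text \<open>The distribution of a random partition is its probability mass function, a vector in the
  real vector space with the partitions as basis. (Function types are not an instance of
  \<^class>\<open>real_vector\<close>, finitely supported functions are.)\<close>

definition distribution ::
    "nat \<Rightarrow> 'w measure \<Rightarrow> ('w \<Rightarrow> nat set set) \<Rightarrow> (nat set set \<Rightarrow>\<^sub>0 real)" where
  "distribution n M X =
     (\<Sum>\<pi>\<in>set_partitions n. Poly_Mapping.single \<pi> (\<P>(\<omega> in M. X \<omega> = \<pi>)))"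

lemma lookup_distribution:
  "Poly_Mapping.lookup (distribution n M X) \<pi> =
     (if \<pi> \<in> set_partitions n then \<P>(\<omega> in M. X \<omega> = \<pi>) else 0)"
proof -
  have "Poly_Mapping.lookup (distribution n M X) \<pi> =
      (\<Sum>\<rho>\<in>set_partitions n. if \<rho> = \<pi> then \<P>(\<omega> in M. X \<omega> = \<rho>) else 0)"
    unfolding distribution_def lookup_sum
    by (rule sum.cong) (auto simp: lookup_single when_def)
  then show ?thesis by simp
qed

text \<open>The sample space has to be given a fixed type here. By the lemma below this loses nothing:
  every distribution is realised by the identity on the set of partitions.\<close>

definition PES_distributions :: "nat \<Rightarrow> (nat set set \<Rightarrow>\<^sub>0 real) set" where
  "PES_distributions n = {distribution n M X | (M :: nat set set measure) X. PES n M X}"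

lemma distribution_in_PES_distributions:
  fixes M :: "'w measure"
  assumes "PES n M X" "n \<ge> 1"
  shows "distribution n M X \<in> PES_distributions n"
proof -
  interpret prob_space M using assms(1) by (simp add: PES_def random_partition_def)
  have X: "X \<in> measurable M (count_space (set_partitions n))"
    using assms(1) by (simp add: PES_def random_partition_def)
  let ?Q = "distr M (count_space (set_partitions n)) X"
  have pr: "\<P>(\<omega> in ?Q. \<omega> = \<pi>) = \<P>(\<omega> in M. X \<omega> = \<pi>)" if "\<pi> \<in> set_partitions n" for \<pi>
  proof -
    have "{\<omega> \<in> space ?Q. \<omega> = \<pi>} = {\<pi>}" using that by auto
    moreover have "X -` {\<pi>} \<inter> space M = {\<omega> \<in> space M. X \<omega> = \<pi>}" by auto
    ultimately show ?thesis using that by (simp add: measure_distr[OF X])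
  qed
  have D: "distr ?Q (count_space (set_partitions (n - 1))) (\<lambda>\<omega>. delete_element j \<omega>) =
      distr M (count_space (set_partitions (n - 1))) (\<lambda>\<omega>. delete_element j (X \<omega>))"
    if "1 \<le> j" "j \<le> n" for j
    using delete_element_in_set_partitions[OF _ that]
    by (subst distr_distr[OF _ X]) (auto simp: comp_def)
  have "random_partition n ?Q (\<lambda>\<pi>. \<pi>)"
    unfolding random_partition_def using prob_space_distr[OF X] by simp
  moreover have "partially_exchangeable n ?Q (\<lambda>\<pi>. \<pi>)"
    unfolding partially_exchangeable_def
  proof (intro ballI impI)
    fix \<pi> \<rho>
    assume *: "\<pi> \<in> set_partitions n" "\<rho> \<in> set_partitions n" "shape \<pi> = shape \<rho>"
    then have "\<P>(\<omega> in M. X \<omega> = \<pi>) = \<P>(\<omega> in M. X \<omega> = \<rho>)"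
      using assms(1) unfolding PES_def partially_exchangeable_def by blast
    then show "\<P>(\<omega> in ?Q. \<omega> = \<pi>) = \<P>(\<omega> in ?Q. \<omega> = \<rho>)"
      by (simp only: pr[OF *(1)] pr[OF *(2)])
  qed
  moreover have "stationary n ?Q (\<lambda>\<pi>. \<pi>)"
    using assms(1) unfolding PES_def stationary_def D[OF order_refl assms(2)] D[OF assms(2) order_refl]
    by blast
  ultimately have "PES n ?Q (\<lambda>\<pi>. \<pi>)"
    unfolding PES_def by blast
  moreover have "distribution n ?Q (\<lambda>\<pi>. \<pi>) = distribution n M X"
    unfolding distribution_def by (intro sum.cong refl arg_cong[where f = "Poly_Mapping.single _"] pr)
  ultimately show ?thesis
    unfolding PES_distributions_def mem_Collect_eq by (intro exI[of _ ?Q] exI[of _ "\<lambda>\<pi>. \<pi>"]) simp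
qed

end

theory Submission
  imports Defs
begin

text \<open>Write \<open>P w\<close> for the probability of a partition of shape \<open>w\<close>. Stationarity relates inserting a
  new first element to inserting a new last one, and since \<open>P\<close> lives on the rearrangements of one
  multiset the relation splits: \<open>P (1 # c) = P (c @ [1])\<close>, and for every \<open>l \<ge> 2\<close> the sum over the
  blocks of size \<open>l - 1\<close> of \<open>c\<close> is the same whether the block, enlarged to \<open>l\<close>, is moved to the front
  or kept in place.

  Dissolve some of the blocks into freely chosen elements (written as ones, just like the
  singletons), so that only the other blocks, the marks, are visible, and then sample these elements
  from \<open>n\<close> ones, with \<open>n\<close> tending to infinity. As long as no relation involves two marks of sizes
  \<open>l - 1\<close> and \<open>l\<close>, a state with the mark \<open>l\<close> in front is the average of the states where this mark
  sits at the minimum of \<open>l - 1\<close> uniform ones, up to \<open>O(1/n)\<close>. The law of the minimum of \<open>l\<close> uniform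
  ones is dominated by at most twice the law of the minimum of \<open>l - 1\<close> of them, and averaging over
  the former dissolves the mark. Hence the maximum and the minimum over all states agree, up to
  \<open>O(1/n)\<close>, with the value obtained with one mark less. Replacing a mark \<open>l - 1\<close> by \<open>l\<close> and
  removing a mark both decrease a suitable weight, so the remaining terms of the relations are
  harmless by induction. With no block of size at least 2 dissolved, \<open>P\<close> is constant.\<close>

section \<open>Words as labelled finite sets of keys\<close>

text \<open>A relation moves a block to the front only on average over all blocks of size
  \<open>l - 1\<close>, so it fixes no single value of \<open>P\<close>. If these blocks are hidden
  among ones, the average runs over random sets of ones, and a maximum principle becomes available.
  A dissolved state adds up the values of \<open>P\<close> over all ways of forming the hidden
  blocks. Since the number of summands depends on the hidden sizes, the claim to be proved is not
  constancy but proportionality to the multinomial factor \<open>\<kappa>\<close>.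

  The maximum principle controls sums over samples, not single values. Exactness is regained by
  replacing each of \<open>N\<close> ones by \<open>s\<close> ones: at least \<open>s ^ N\<close>
  samples then repeat the wanted value, while their total has order \<open>s ^ (N - 1)\<close>.

  Real keys make deletion free of renumbering and leave room next to every key.

  For extremality, two PES laws that mix to the given one inherit its support, so their ranked shape
  is constant too and uniqueness identifies them.\<close>

definition word :: "(real \<Rightarrow> nat) \<Rightarrow> real set \<Rightarrow> nat list" where
  "word f D = map f (sorted_list_of_set D)"

definition ones :: "(real \<Rightarrow> nat) \<Rightarrow> real set \<Rightarrow> real set" where
  "ones f D = {d \<in> D. f d = 1}"

definition subs :: "'a set \<Rightarrow> nat \<Rightarrow> 'a set set" where
  "subs A k = {R. R \<subseteq> A \<and> card R = k}"

type_synonym word_fun = "(real \<Rightarrow> nat) \<Rightarrow> real set \<Rightarrow> real"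

text \<open>A dissolved block is placed at \<open>Min R\<close> because a shape lists the blocks by
  their least elements.\<close>

definition gather :: "nat \<Rightarrow> word_fun \<Rightarrow> word_fun" where
  "gather l h f D = (\<Sum>R\<in>subs (ones f D) l. h (f(Min R := l)) (D - (R - {Min R})))"

text \<open>The counterpart of \<open>fixed_defect\<close> for a block of size \<open>l - 1\<close>
  that is hidden among the ones.\<close>

definition front_defect :: "real \<Rightarrow> nat \<Rightarrow> word_fun \<Rightarrow> word_fun" where
  "front_defect a l h f D = (\<Sum>R\<in>subs (ones f D) (l - 1).
     h (f(a := l)) (insert a (D - R)) - h (f(Min R := l)) (D - (R - {Min R})))"

definition fixed_defect :: "real \<Rightarrow> nat \<Rightarrow> word_fun \<Rightarrow> word_fun" where
  "fixed_defect a l h f D = (\<Sum>i | i \<in> D \<and> f i = l - 1.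
     h (f(a := l)) (insert a (D - {i})) - h (f(i := l)) D)"

definition rot_defect :: "real \<Rightarrow> real \<Rightarrow> word_fun \<Rightarrow> word_fun" where
  "rot_defect a b h f D = h (f(a := 1)) (insert a D) - h (f(b := 1)) (insert b D)"

primrec blur :: "word_fun \<Rightarrow> nat list \<Rightarrow> word_fun" where
  "blur h [] = h"
| "blur h (l # G) = gather l (blur h G)"

text \<open>Dependence on the word alone, phrased with increasing maps so that keys can be moved
  without computing sorted lists.\<close>

definition order_invariant :: "word_fun \<Rightarrow> bool" where
  "order_invariant h \<longleftrightarrow> (\<forall>f f' D g. finite D \<longrightarrow> strict_mono_on D g \<longrightarrow>
     (\<forall>d\<in>D. f' (g d) = f d) \<longrightarrow> h f' (g ` D) = h f D)"

lemma order_invariantD: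
  assumes "order_invariant h" "finite D" "strict_mono_on D g" "\<And>d. d \<in> D \<Longrightarrow> f' (g d) = f d"
  shows "h f' (g ` D) = h f D"
  using assms unfolding order_invariant_def by blast

lemma order_invariant_cong:
  assumes "order_invariant h" "finite D" "\<And>d. d \<in> D \<Longrightarrow> f' d = f d"
  shows "h f' D = h f D"
  using order_invariantD[OF assms(1,2), of "\<lambda>x. x" f' f] assms(3) by (auto simp: strict_mono_on_def)

lemma finite_ones [simp]: "finite D \<Longrightarrow> finite (ones f D)"
  by (simp add: ones_def)

lemma ones_subset: "ones f D \<subseteq> D"
  by (auto simp: ones_def)

lemma finite_subs [simp]: "finite A \<Longrightarrow> finite (subs A k)"
  by (simp add: subs_def)

lemma card_subs: "finite A \<Longrightarrow> card (subs A k) = card A choose k"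
  unfolding subs_def by (rule n_subsets)

lemma subsD:
  assumes "R \<in> subs A k" "finite A"
  shows "R \<subseteq> A" "card R = k" "finite R" "k \<ge> 1 \<Longrightarrow> R \<noteq> {}" "k \<ge> 1 \<Longrightarrow> Min R \<in> R" "k \<ge> 1 \<Longrightarrow> Min R \<in> A"
proof -
  show 1: "R \<subseteq> A" "card R = k" using assms by (auto simp: subs_def)
  show 2: "finite R" using 1 assms(2) finite_subset by blast
  show 3: "R \<noteq> {}" if "k \<ge> 1" using 1 that by auto
  show "Min R \<in> R" if "k \<ge> 1" using Min_in[OF 2 3[OF that]] .
  then show "Min R \<in> A" if "k \<ge> 1" using 1 that by auto
qed

lemma ones_gathered:
  assumes "finite D" "R \<in> subs (ones f D) k" "k \<ge> 1" "l \<noteq> 1"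
  shows "ones (f(Min R := l)) (D - (R - {Min R})) = ones f D - R"
proof -
  have R: "finite (ones f D)" using assms(1) by simp
  show ?thesis
    using subsD(1)[OF assms(2) R] subsD(5)[OF assms(2) R assms(3)] assms(4) by (auto simp: ones_def)
qed

lemma ones_front:
  assumes "l \<noteq> 1" "a \<notin> D"
  shows "ones (f(a := l)) (insert a (D - R)) = ones f D - R"
  using assms by (auto simp: ones_def)

lemma sum_subs_disjoint_swap:
  assumes "finite A"
  shows "(\<Sum>R\<in>subs A k. \<Sum>S\<in>subs (A - R) m. F R S) = (\<Sum>S\<in>subs A m. \<Sum>R\<in>subs (A - S) k. F R S)"
proof -
  have 1: "subs (A - R) m = {S \<in> subs A m. R \<inter> S = {}}" for R m
    by (auto simp: subs_def)
  have 2: "subs (A - R) m = {S \<in> subs A m. S \<inter> R = {}}" for R m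
    by (auto simp: subs_def)
  show ?thesis
    unfolding 1[of _ m] 2[of _ k] using assms
    by (intro sum.swap_restrict) auto
qed

lemma gather_cong:
  assumes "\<And>f D. finite D \<Longrightarrow> h f D = h' f D" "finite D"
  shows "gather l h f D = gather l h' f D"
  unfolding gather_def using assms by (intro sum.cong) auto

text \<open>Both orders sum over pairs of disjoint subsets of the ones. Sizes of at least 2
  guarantee that a newly formed mark is not a one and cannot be absorbed by the other sum.\<close>

lemma gather_commute:
  assumes "finite D" "l \<ge> 2" "m \<ge> 2"
  shows "gather l (gather m h) f D = gather m (gather l h) f D"
proof -
  have 1: "gather l (gather m h) f D =
    (\<Sum>R\<in>subs (ones f D) l. \<Sum>S\<in>subs (ones f D - R) m.
       h (f(Min R := l, Min S := m)) (D - (R - {Min R}) - (S - {Min S})))"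
    if "l \<ge> 2" "m \<ge> 2" for l m
    unfolding gather_def using that assms(1)
    by (intro sum.cong refl) (simp add: ones_gathered)
  show ?thesis
    unfolding 1[OF assms(2,3)] 1[OF assms(3,2)]
    apply (subst sum_subs_disjoint_swap)
    using assms(1) apply simp
  proof (intro sum.cong refl)
    fix S R assume S: "S \<in> subs (ones f D) m" and R: "R \<in> subs (ones f D - S) l"
    have "Min S \<in> S" "Min R \<in> R" "R \<inter> S = {}"
      using subsD[OF S] subsD[OF R] assms by auto
    then have "Min R \<noteq> Min S" by auto
    then show "h (f(Min R := l, Min S := m)) (D - (R - {Min R}) - (S - {Min S})) =
        h (f(Min S := m, Min R := l)) (D - (S - {Min S}) - (R - {Min R}))"
      by (simp add: fun_upd_twist Diff_Diff_Int Diff_eq Int_ac)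
  qed
qed

lemma blur_move:
  assumes "finite D" "l \<ge> 2" "\<And>x. x \<in> set G \<Longrightarrow> x \<ge> 2"
  shows "blur h (G @ l # G') f D = blur h (l # G @ G') f D"
  using assms
proof (induction G arbitrary: f D)
  case (Cons m G)
  have "blur h ((m # G) @ l # G') f D = gather m (blur h (l # G @ G')) f D"
    using Cons by (auto intro!: gather_cong)
  also have "\<dots> = blur h (l # (m # G) @ G') f D"
    using Cons by (simp add: gather_commute)
  finally show ?case .
qed simp

lemma blur_perm:
  assumes "finite D" "mset G = mset G'" "\<And>x. x \<in> set G \<Longrightarrow> x \<ge> 2"
  shows "blur h G f D = blur h G' f D"
  using assms
proof (induction G arbitrary: G' f D)
  case (Cons l G)
  have "l \<in> set G'" using Cons.prems(2) by (metis list.set_intros(1) mset_eq_setD)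
  then obtain G1 G2 where G': "G' = G1 @ l # G2" by (metis split_list)
  have set: "set G' = set (l # G)" using Cons.prems(2) by (metis mset_eq_setD)
  have "blur h G' f D = blur h (l # G1 @ G2) f D"
    unfolding G' using Cons.prems set G' by (intro blur_move) auto
  also have "\<dots> = blur h (l # G) f D"
    using Cons.prems G' Cons.IH[of _ "G1 @ G2"] by (auto intro!: gather_cong)
  finally show ?case by simp
qed simp

lemma image_diff_strict_mono:
  fixes g :: "'a::linorder \<Rightarrow> 'b::linorder"
  assumes "strict_mono_on D g" "R \<subseteq> D" "X \<subseteq> D"
  shows "g ` X - g ` R = g ` (X - R)"
  using inj_on_image_set_diff[OF strict_mono_on_imp_inj_on[OF assms(1)], of X R] assms by auto

lemma Min_image_strict_mono:
  fixes g :: "'a::linorder \<Rightarrow> 'b::linorder"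
  assumes "strict_mono_on D g" "R \<subseteq> D" "finite R" "R \<noteq> {}"
  shows "Min (g ` R) = g (Min R)"
proof (rule Min_eqI)
  have le: "g x \<le> g y" if "x \<in> R" "y \<in> R" "x \<le> y" for x y
  proof (cases "x = y")
    case False
    then have "g x < g y"
      using that assms(2) by (intro strict_mono_onD[OF assms(1)]) auto
    then show ?thesis by simp
  qed simp
  have m: "Min R \<in> R" using assms(3,4) by simp
  show "g (Min R) \<le> y" if y: "y \<in> g ` R" for y
  proof -
    obtain x where "x \<in> R" "y = g x" using y by blast
    then show ?thesis using le[OF m, of x] assms(3) by simp
  qed
qed (use assms in auto)

lemma subs_image:
  assumes "inj_on g A"
  shows "subs (g ` A) k = (`) g ` subs A k"
proof (intro equalityI subsetI)
  fix R assume "R \<in> subs (g ` A) k"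
  then have R: "R \<subseteq> g ` A" "card R = k" by (auto simp: subs_def)
  then obtain S where S: "S \<subseteq> A" "R = g ` S" by (metis subset_imageE)
  then have "card S = k" using R assms by (metis card_image inj_on_subset)
  then show "R \<in> (`) g ` subs A k" using S by (auto simp: subs_def)
next
  fix R assume "R \<in> (`) g ` subs A k"
  then obtain S where S: "S \<subseteq> A" "card S = k" "R = g ` S" by (auto simp: subs_def)
  then show "R \<in> subs (g ` A) k" using assms by (auto simp: subs_def card_image inj_on_subset)
qed

lemma sum_subs_image:
  assumes "inj_on g A"
  shows "(\<Sum>R\<in>subs (g ` A) k. F R) = (\<Sum>R\<in>subs A k. F (g ` R))"
proof -
  have "inj_on ((`) g) (subs A k)"
    by (rule inj_onI) (use assms in \<open>auto simp: subs_def inj_on_image_eq_iff\<close>)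
  then show ?thesis unfolding subs_image[OF assms] by (simp add: sum.reindex)
qed

lemma order_invariant_gather:
  assumes "order_invariant h" "l \<ge> 1"
  shows "order_invariant (gather l h)"
  unfolding order_invariant_def
proof (intro allI impI)
  fix f f' :: "real \<Rightarrow> nat" and D :: "real set" and g :: "real \<Rightarrow> real"
  assume D: "finite D" and g: "strict_mono_on D g" and f': "\<forall>d\<in>D. f' (g d) = f d"
  have inj: "inj_on g D" using g by (rule strict_mono_on_imp_inj_on)
  have O: "ones f' (g ` D) = g ` ones f D" using f' by (auto simp: ones_def)
  have inj': "inj_on g (ones f D)" using inj ones_subset by (rule inj_on_subset)
  show "gather l h f' (g ` D) = gather l h f D"
    unfolding gather_def O sum_subs_image[OF inj']
  proof (intro sum.cong refl)
    fix R assume R: "R \<in> subs (ones f D) l"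
    have RD: "R \<subseteq> D" using subsD(1)[OF R] D ones_subset by (auto simp: ones_def)
    have R': "finite R" "R \<noteq> {}" "Min R \<in> R" using subsD[OF R] D assms(2) by auto
    have m: "Min (g ` R) = g (Min R)" using Min_image_strict_mono[OF g RD] R' by auto
    have "g ` R - {g (Min R)} = g ` (R - {Min R})"
      using image_diff_strict_mono[OF g _ RD, of "{Min R}"] subsetD[OF RD R'(3)]
      by simp
    then have "g ` D - (g ` R - {g (Min R)}) = g ` (D - (R - {Min R}))"
      using image_diff_strict_mono[OF g, of "R - {Min R}" D] RD by auto
    moreover have "h (f'(g (Min R) := l)) (g ` (D - (R - {Min R}))) = h (f(Min R := l)) (D - (R - {Min R}))"
    proof (rule order_invariantD[OF assms(1)])
      show "strict_mono_on (D - (R - {Min R})) g" by (rule monotone_on_subset[OF g]) auto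
      fix d assume "d \<in> D - (R - {Min R})"
      then have d: "d \<in> D" by simp
      have "Min R \<in> D" using RD R'(3) by blast
      then have "g d = g (Min R) \<longleftrightarrow> d = Min R" using inj d by (simp add: inj_on_eq_iff)
      then show "(f'(g (Min R) := l)) (g d) = (f(Min R := l)) d" using f' d by simp
    qed (use D in simp)
    ultimately show "h (f'(Min (g ` R) := l)) (g ` D - (g ` R - {Min (g ` R)})) =
        h (f(Min R := l)) (D - (R - {Min R}))" by (simp add: m)
  qed
qed

lemma order_invariant_blur:
  assumes "order_invariant h" "\<And>x. x \<in> set G \<Longrightarrow> x \<ge> 2"
  shows "order_invariant (blur h G)"
  using assms(2)
proof (induction G)
  case (Cons l G)
  have "l \<ge> 2" using Cons.prems by simp
  moreover have "order_invariant (blur h G)" using Cons by simp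
  ultimately show ?case by (simp add: order_invariant_gather)
qed (simp add: assms(1))

lemma sorted_list_of_set_image_strict_mono:
  fixes g :: "'a::linorder \<Rightarrow> 'b::linorder"
  assumes "finite D" "strict_mono_on D g"
  shows "sorted_list_of_set (g ` D) = map g (sorted_list_of_set D)"
proof -
  have "sorted_wrt (<) (map g (sorted_list_of_set D))"
    unfolding sorted_wrt_map
    by (rule sorted_wrt_mono_rel[OF _ strict_sorted_list_of_set])
      (use assms in \<open>auto dest: strict_mono_onD\<close>)
  then show ?thesis using assms(1) by (metis list.set_map set_sorted_list_of_set sorted_list_of_set.idem_if_sorted_distinct strict_sorted_iff)
qed

lemma order_invariant_word: "order_invariant (\<lambda>f D. P (word f D))"
  unfolding order_invariant_def word_def
  by (auto simp: sorted_list_of_set_image_strict_mono intro!: arg_cong[where f=P])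

section \<open>How the defects behave under dissolving blocks\<close>

lemma front_defect_gather:
  assumes "finite D" "a \<notin> D" "l \<ge> 2" "j \<ge> 2"
  shows "(\<Sum>R\<in>subs (ones f D) j. front_defect a l h (f(Min R := j)) (D - (R - {Min R}))) =
    front_defect a l (gather j h) f D"
proof -
  let ?O = "ones f D"
  have O: "finite ?O" using assms(1) by simp
  have "(\<Sum>R\<in>subs ?O j. front_defect a l h (f(Min R := j)) (D - (R - {Min R}))) =
    (\<Sum>R\<in>subs ?O j. \<Sum>S\<in>subs (?O - R) (l - 1).
      h (f(Min R := j, a := l)) (insert a (D - (R - {Min R}) - S)) -
      h (f(Min R := j, Min S := l)) (D - (R - {Min R}) - (S - {Min S})))"
    unfolding front_defect_def using assms by (intro sum.cong refl) (simp add: ones_gathered)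
  also have "\<dots> = (\<Sum>S\<in>subs ?O (l - 1). \<Sum>R\<in>subs (?O - S) j.
      h (f(Min R := j, a := l)) (insert a (D - (R - {Min R}) - S)) -
      h (f(Min R := j, Min S := l)) (D - (R - {Min R}) - (S - {Min S})))"
    by (rule sum_subs_disjoint_swap[OF O])
  also have "\<dots> = front_defect a l (gather j h) f D"
    unfolding front_defect_def gather_def sum_subtractf
  proof (intro arg_cong2[where f = "(-)"] sum.cong refl)
    fix S assume S: "S \<in> subs ?O (l - 1)"
    show "subs (?O - S) j = subs (ones (f(a := l)) (insert a (D - S))) j"
      using assms by (simp add: ones_front)
    fix R assume "R \<in> subs (ones (f(a := l)) (insert a (D - S))) j"
    then have R: "R \<in> subs (?O - S) j" using assms by (simp add: ones_front)
    have RD: "R \<subseteq> D" and m: "Min R \<in> R" and SD: "S \<subseteq> D" and RS: "R \<inter> S = {}"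
      using subsD[OF R] subsD[OF S] assms O ones_subset[of f D] by auto
    have "a \<noteq> Min R" using m RD assms by auto
    moreover have "insert a (D - (R - {Min R}) - S) = insert a (D - S) - (R - {Min R})"
      using RD SD assms by auto
    ultimately show "h (f(Min R := j, a := l)) (insert a (D - (R - {Min R}) - S)) =
        h (f(a := l, Min R := j)) (insert a (D - S) - (R - {Min R}))"
      by (simp add: fun_upd_twist)
  next
    fix S assume S: "S \<in> subs ?O (l - 1)"
    have oS: "ones (f(Min S := l)) (D - (S - {Min S})) = ?O - S"
      using assms S by (intro ones_gathered[of _ _ _ "l - 1"]) auto
    then show "subs (?O - S) j = subs (ones (f(Min S := l)) (D - (S - {Min S}))) j" by simp
    fix R assume "R \<in> subs (ones (f(Min S := l)) (D - (S - {Min S}))) j"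
    then have R: "R \<in> subs (?O - S) j" using oS by simp
    have "Min R \<in> R" "Min S \<in> S" "R \<inter> S = {}"
      using subsD[OF R] subsD[OF S] assms O by auto
    then have "Min R \<noteq> Min S" by auto
    then show "h (f(Min R := j, Min S := l)) (D - (R - {Min R}) - (S - {Min S})) =
        h (f(Min S := l, Min R := j)) (D - (S - {Min S}) - (R - {Min R}))"
      by (simp add: fun_upd_twist Diff_eq Int_ac)
  qed
  finally show ?thesis .
qed

lemma front_defect_cong:
  assumes "\<And>f D. finite D \<Longrightarrow> h f D = h' f D" "finite D"
  shows "front_defect a l h f D = front_defect a l h' f D"
  unfolding front_defect_def using assms by (intro sum.cong) auto

text \<open>A block formed with size \<open>j = l - 1\<close> is itself among the blocks that the
  defect enlarges. Its contribution, at the index \<open>Min R\<close>, is a sum over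
  \<open>(l - 1)\<close>-subsets of ones and yields the \<open>front_defect\<close>. All other
  indices are old marks, which \<open>gather\<close> does not touch because
  \<open>l - 1 \<ge> 2\<close>, so there the two sums may be interchanged.\<close>

lemma fixed_defect_gather:
  assumes h: "order_invariant h" and D: "finite D" and "a \<notin> D" and l: "l \<ge> 3" and j: "j \<ge> 2"
  shows "(\<Sum>R\<in>subs (ones f D) j. fixed_defect a l h (f(Min R := j)) (D - (R - {Min R}))) =
    fixed_defect a l (gather j h) f D + (if j = l - 1 then front_defect a l h f D else 0)"
proof -
  let ?O = "ones f D" and ?I = "{i \<in> D. f i = l - 1}"
  let ?A = "\<lambda>R i. h (f(Min R := j, a := l)) (insert a (D - (R - {Min R}) - {i})) -
      h (f(Min R := j, i := l)) (D - (R - {Min R}))"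
  have O: "finite ?O" using D by simp
  have "fixed_defect a l h (f(Min R := j)) (D - (R - {Min R})) = (\<Sum>i\<in>?I. ?A R i) +
      (if j = l - 1 then h (f(a := l)) (insert a (D - R)) - h (f(Min R := l)) (D - (R - {Min R})) else 0)"
    if R: "R \<in> subs ?O j" for R
  proof -
    have RO: "R \<subseteq> ?O" and m: "Min R \<in> R" "Min R \<in> ?O" and RD: "R \<subseteq> D" and fR: "finite R"
      using subsD[OF R O] j ones_subset[of f D] by auto
    have eq: "{i. i \<in> D - (R - {Min R}) \<and> (f(Min R := j)) i = l - 1} =
        ?I \<union> (if j = l - 1 then {Min R} else {})"
      using RO m l by (auto simp: ones_def)
    have disj: "Min R \<notin> ?I" using m l by (auto simp: ones_def)
    have last: "?A R (Min R) = h (f(a := l)) (insert a (D - R)) - h (f(Min R := l)) (D - (R - {Min R}))"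
    proof -
      have "D - (R - {Min R}) - {Min R} = D - R" using m by auto
      moreover have "h (f(Min R := j, a := l)) (insert a (D - R)) = h (f(a := l)) (insert a (D - R))"
        using D m RD \<open>a \<notin> D\<close> by (intro order_invariant_cong[OF h]) auto
      ultimately show ?thesis by simp
    qed
    show ?thesis
    proof (cases "j = l - 1")
      case True
      have "fixed_defect a l h (f(Min R := j)) (D - (R - {Min R})) = (\<Sum>i\<in>insert (Min R) ?I. ?A R i)"
        unfolding fixed_defect_def eq using True by simp
      also have "\<dots> = (\<Sum>i\<in>?I. ?A R i) + ?A R (Min R)"
        using disj D by (subst sum.insert) auto
      finally show ?thesis using last True by simp
    next
      case False
      then show ?thesis unfolding fixed_defect_def eq by simp
    qed
  qed
  then have "(\<Sum>R\<in>subs ?O j. fixed_defect a l h (f(Min R := j)) (D - (R - {Min R}))) =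
      (\<Sum>R\<in>subs ?O j. \<Sum>i\<in>?I. ?A R i) + (if j = l - 1 then front_defect a l h f D else 0)"
    by (simp add: sum.distrib front_defect_def)
  also have "(\<Sum>R\<in>subs ?O j. \<Sum>i\<in>?I. ?A R i) = (\<Sum>i\<in>?I. \<Sum>R\<in>subs ?O j. ?A R i)"
    by (rule sum.swap)
  also have "\<dots> = fixed_defect a l (gather j h) f D"
    unfolding fixed_defect_def gather_def sum_subtractf
  proof (intro arg_cong2[where f = "(-)"] sum.cong refl)
    fix i assume i: "i \<in> {i. i \<in> D \<and> f i = l - 1}"
    have o: "ones (f(a := l)) (insert a (D - {i})) = ?O"
      using i l \<open>a \<notin> D\<close> by (auto simp: ones_def)
    then show "subs ?O j = subs (ones (f(a := l)) (insert a (D - {i}))) j" by simp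
    fix R assume "R \<in> subs (ones (f(a := l)) (insert a (D - {i}))) j"
    then have R: "R \<in> subs ?O j" using o by simp
    have RD: "R \<subseteq> D" "R \<subseteq> ?O" and m: "Min R \<in> R"
      using subsD[OF R O] j ones_subset[of f D] by auto
    have "a \<noteq> Min R" using m RD \<open>a \<notin> D\<close> by auto
    moreover have "insert a (D - (R - {Min R}) - {i}) = insert a (D - {i}) - (R - {Min R})"
      using RD \<open>a \<notin> D\<close> by auto
    ultimately show "h (f(Min R := j, a := l)) (insert a (D - (R - {Min R}) - {i})) =
        h (f(a := l, Min R := j)) (insert a (D - {i}) - (R - {Min R}))"
      by (simp add: fun_upd_twist)
  next
    fix i assume i: "i \<in> {i. i \<in> D \<and> f i = l - 1}"
    have o: "ones (f(i := l)) D = ?O" using i l by (auto simp: ones_def)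
    then show "subs ?O j = subs (ones (f(i := l)) D) j" by simp
    fix R assume "R \<in> subs (ones (f(i := l)) D) j"
    then have R: "R \<in> subs ?O j" using o by simp
    have "Min R \<noteq> i" using subsD[OF R O] j i l by (auto simp: ones_def)
    then show "h (f(Min R := j, i := l)) (D - (R - {Min R})) = h (f(i := l, Min R := j)) (D - (R - {Min R}))"
      by (simp add: fun_upd_twist)
  qed
  finally show ?thesis .
qed

text \<open>The relation for \<open>l\<close> after dissolution: every hidden block of size
  \<open>l - 1\<close> adds one correction from \<open>fixed_defect_gather\<close>, whence the
  multiplicity.\<close>

lemma fixed_defect_blur:
  assumes h: "order_invariant h" and l: "l \<ge> 3"
    and base: "\<And>f D. finite D \<Longrightarrow> \<forall>d\<in>D. a < d \<Longrightarrow> fixed_defect a l h f D = 0"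
    and G: "\<And>x. x \<in> set G \<Longrightarrow> x \<ge> 2" and D: "finite D" "\<forall>d\<in>D. a < d"
  shows "fixed_defect a l (blur h G) f D +
    count (mset G) (l - 1) * front_defect a l (blur h (remove1 (l - 1) G)) f D = 0"
  using G D
proof (induction G arbitrary: f D)
  case Nil
  then show ?case using base by simp
next
  case (Cons j G)
  let ?D = "\<lambda>R. D - (R - {Min R})" and ?f = "\<lambda>R. f(Min R := j)"
  have j: "j \<ge> 2" and a: "a \<notin> D" using Cons.prems by auto
  have inv: "order_invariant (blur h G)" using order_invariant_blur[OF h] Cons.prems by simp
  have "0 = (\<Sum>R\<in>subs (ones f D) j. fixed_defect a l (blur h G) (?f R) (?D R) +
      count (mset G) (l - 1) * front_defect a l (blur h (remove1 (l - 1) G)) (?f R) (?D R))"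
    using Cons.prems by (intro sum.neutral[symmetric] ballI Cons.IH) auto
  also have "\<dots> = fixed_defect a l (blur h (j # G)) f D +
      (if j = l - 1 then front_defect a l (blur h G) f D else 0) +
      count (mset G) (l - 1) * front_defect a l (blur h (j # remove1 (l - 1) G)) f D"
    using Cons.prems a j l
    by (simp add: sum.distrib sum_distrib_left[symmetric] fixed_defect_gather[OF inv] front_defect_gather)
  also have "\<dots> = fixed_defect a l (blur h (j # G)) f D +
    count (mset (j # G)) (l - 1) * front_defect a l (blur h (remove1 (l - 1) (j # G))) f D"
  \<comment> \<open>If \<open>G\<close> contains another copy of \<open>j = l - 1\<close>, the two
    front terms hide the same multiset and their coefficients add up. If it contains none, the
    inductive term has coefficient 0.\<close>
  proof (cases "j = l - 1 \<and> j \<in> set G")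
    case True
    have "front_defect a l (blur h (j # remove1 j G)) f D = front_defect a l (blur h G) f D"
    proof (rule front_defect_cong[OF blur_perm])
      show "mset (j # remove1 j G) = mset G"
        using True insert_DiffM[of j "mset G"] by (auto simp del: One_nat_def)
      show "x \<ge> 2" if "x \<in> set (j # remove1 j G)" for x
        using that Cons.prems(1) notin_set_remove1 by fastforce
    qed (use Cons.prems in auto)
    then show ?thesis using True by (simp add: algebra_simps)
  next
    case False
    show ?thesis
    proof (cases "j = l - 1")
      case True
      then have "count (mset G) (l - Suc 0) = 0" using False by simp
      then show ?thesis unfolding One_nat_def True by (simp del: count_mset_0_iff)
    qed simp
  qed
  finally show ?case by simp
qed

lemma front_defect_blur:
  assumes "\<And>f D. finite D \<Longrightarrow> \<forall>d\<in>D. a < d \<Longrightarrow> front_defect a l h f D = 0" "l \<ge> 2"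
    and "\<And>x. x \<in> set G \<Longrightarrow> x \<ge> 2" "finite D" "\<forall>d\<in>D. a < d"
  shows "front_defect a l (blur h G) f D = 0"
  using assms(3-)
proof (induction G arbitrary: f D)
  case (Cons j G)
  have "front_defect a l (blur h (j # G)) f D =
      (\<Sum>R\<in>subs (ones f D) j. front_defect a l (blur h G) (f(Min R := j)) (D - (R - {Min R})))"
    using Cons.prems assms(2) by (subst front_defect_gather) auto
  also have "\<dots> = 0"
    using Cons.prems by (intro sum.neutral ballI Cons.IH) auto
  finally show ?case .
qed (use assms in auto)

lemma subs_insert:
  fixes a :: "'a::linorder"
  assumes "a \<notin> A" "finite A" "k \<ge> 1"
  shows "subs (insert a A) k = subs A k \<union> insert a ` subs A (k - 1)"
proof (intro equalityI subsetI)
  fix R assume R: "R \<in> subs (insert a A) k"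
  show "R \<in> subs A k \<union> insert a ` subs A (k - 1)"
  proof (cases "a \<in> R")
    case True
    have "R - {a} \<in> subs A (k - 1)" "R = insert a (R - {a})"
      using R True assms by (auto simp: subs_def)
    then show ?thesis by blast
  qed (use R in \<open>auto simp: subs_def\<close>)
next
  fix R assume "R \<in> subs A k \<union> insert a ` subs A (k - 1)"
  moreover have "card (insert a S) = k" if "S \<in> subs A (k - 1)" for S
    using that assms subsD[OF that assms(2)] by (subst card_insert_disjoint) auto
  ultimately show "R \<in> subs (insert a A) k" by (auto simp: subs_def)
qed

lemma sum_subs_insert:
  fixes a :: "'a::linorder"
  assumes "a \<notin> A" "finite A" "k \<ge> 1"
  shows "(\<Sum>R\<in>subs (insert a A) k. F R) = (\<Sum>R\<in>subs A k. F R) + (\<Sum>R\<in>subs A (k - 1). F (insert a R))"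
proof -
  have "inj_on (insert a) (subs A (k - 1))"
    using assms(1) by (intro inj_onI) (auto simp: subs_def insert_ident subset_iff)
  moreover have "subs A k \<inter> insert a ` subs A (k - 1) = {}"
    using assms(1) by (auto simp: subs_def)
  ultimately show ?thesis
    unfolding subs_insert[OF assms] using assms(2)
    by (simp add: sum.union_disjoint sum.reindex)
qed

text \<open>An \<open>l\<close>-subset containing the new one has its minimum at \<open>a\<close> if
  the new one is in front, but at the minimum of the other \<open>l - 1\<close> elements if it is at
  the back. These subsets produce the \<open>front_defect\<close>.\<close>

lemma rot_defect_gather:
  assumes h: "order_invariant h" and D: "finite D" "\<forall>d\<in>D. a < d \<and> d < b" and l: "l \<ge> 2"
  shows "rot_defect a b (gather l h) f D =
    (\<Sum>R\<in>subs (ones f D) l. rot_defect a b h (f(Min R := l)) (D - (R - {Min R}))) +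
    front_defect a l h f D"
proof -
  let ?O = "ones f D"
  have O: "finite ?O" "a \<notin> ?O" "b \<notin> ?O" and ab: "a \<notin> D" "b \<notin> D" using D by (auto simp: ones_def)
  have Oa: "ones (f(a := 1)) (insert a D) = insert a ?O" and Ob: "ones (f(b := 1)) (insert b D) = insert b ?O"
    using ab by (auto simp: ones_def)
  have Min_a: "Min (insert a R) = a" "a \<notin> R" if "R \<in> subs ?O (l - 1)" for R
  proof -
    have R: "R \<subseteq> D" "finite R" using subsD[OF that O(1)] ones_subset[of f D] by auto
    show "a \<notin> R" using R ab by auto
    show "Min (insert a R) = a"
      by (rule Min_eqI) (use R D less_imp_le in auto)
  qed
  have Min_b: "Min (insert b R) = Min R" "b \<notin> R" if "R \<in> subs ?O (l - 1)" for R
  proof -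
    have R: "R \<subseteq> D" "finite R" "Min R \<in> R" using subsD[OF that O(1)] ones_subset[of f D] l by auto
    then show "b \<notin> R" using ab by auto
    have "Min R < b" using R D by auto
    then show "Min (insert b R) = Min R"
      using R by (intro Min_eqI) (auto intro: order.trans)
  qed
  have "gather l h (f(a := 1)) (insert a D) =
      (\<Sum>R\<in>subs ?O l. h (f(Min R := l, a := 1)) (insert a (D - (R - {Min R})))) +
      (\<Sum>R\<in>subs ?O (l - 1). h (f(a := l)) (insert a (D - R)))"
    unfolding gather_def Oa
  proof (subst sum_subs_insert)
    show "a \<notin> ?O" "finite ?O" "l \<ge> 1" using O l by auto
    show "(\<Sum>R\<in>subs ?O l. h (f(a := 1, Min R := l)) (insert a D - (R - {Min R}))) +
        (\<Sum>R\<in>subs ?O (l - 1). h (f(a := 1, Min (insert a R) := l)) (insert a D - (insert a R - {Min (insert a R)}))) =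
      (\<Sum>R\<in>subs ?O l. h (f(Min R := l, a := 1)) (insert a (D - (R - {Min R})))) +
      (\<Sum>R\<in>subs ?O (l - 1). h (f(a := l)) (insert a (D - R)))"
    proof (intro arg_cong2[where f = "(+)"] sum.cong refl)
      fix R assume R: "R \<in> subs ?O l"
      have "R \<subseteq> D" "Min R \<in> R" using subsD[OF R O(1)] l ones_subset[of f D] by auto
      then have "a \<noteq> Min R" "insert a D - (R - {Min R}) = insert a (D - (R - {Min R}))"
        using ab by auto
      then show "h (f(a := 1, Min R := l)) (insert a D - (R - {Min R})) =
          h (f(Min R := l, a := 1)) (insert a (D - (R - {Min R})))"
        by (simp add: fun_upd_twist)
    next
      fix R assume R: "R \<in> subs ?O (l - 1)"
      have "insert a D - (insert a R - {a}) = insert a (D - R)" using Min_a[OF R] by auto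
      then show "h (f(a := 1, Min (insert a R) := l)) (insert a D - (insert a R - {Min (insert a R)})) =
          h (f(a := l)) (insert a (D - R))"
        using Min_a[OF R] by simp
    qed
  qed
  moreover have "gather l h (f(b := 1)) (insert b D) =
      (\<Sum>R\<in>subs ?O l. h (f(Min R := l, b := 1)) (insert b (D - (R - {Min R})))) +
      (\<Sum>R\<in>subs ?O (l - 1). h (f(Min R := l)) (D - (R - {Min R})))"
    unfolding gather_def Ob
  proof (subst sum_subs_insert)
    show "b \<notin> ?O" "finite ?O" "l \<ge> 1" using O l by auto
    show "(\<Sum>R\<in>subs ?O l. h (f(b := 1, Min R := l)) (insert b D - (R - {Min R}))) +
        (\<Sum>R\<in>subs ?O (l - 1). h (f(b := 1, Min (insert b R) := l)) (insert b D - (insert b R - {Min (insert b R)}))) =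
      (\<Sum>R\<in>subs ?O l. h (f(Min R := l, b := 1)) (insert b (D - (R - {Min R})))) +
      (\<Sum>R\<in>subs ?O (l - 1). h (f(Min R := l)) (D - (R - {Min R})))"
    proof (intro arg_cong2[where f = "(+)"] sum.cong refl)
      fix R assume R: "R \<in> subs ?O l"
      have "R \<subseteq> D" "Min R \<in> R" using subsD[OF R O(1)] l ones_subset[of f D] by auto
      then have "b \<noteq> Min R" "insert b D - (R - {Min R}) = insert b (D - (R - {Min R}))"
        using ab by auto
      then show "h (f(b := 1, Min R := l)) (insert b D - (R - {Min R})) =
          h (f(Min R := l, b := 1)) (insert b (D - (R - {Min R})))"
        by (simp add: fun_upd_twist)
    next
      fix R assume R: "R \<in> subs ?O (l - 1)"
      have RD: "R \<subseteq> D" "Min R \<in> R" using subsD[OF R O(1)] l ones_subset[of f D] by auto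
      then have "insert b D - (insert b R - {Min R}) = D - (R - {Min R})" using ab by auto
      moreover have "h (f(b := 1, Min R := l)) (D - (R - {Min R})) = h (f(Min R := l)) (D - (R - {Min R}))"
        using D ab by (intro order_invariant_cong[OF h]) auto
      ultimately show "h (f(b := 1, Min (insert b R) := l)) (insert b D - (insert b R - {Min (insert b R)})) =
          h (f(Min R := l)) (D - (R - {Min R}))"
        using Min_b[OF R] by simp
    qed
  qed
  ultimately show ?thesis
    unfolding rot_defect_def front_defect_def sum_subtractf by simp
qed

lemma sum_sum_list_swap:
  "(\<Sum>x\<in>A. \<Sum>y\<leftarrow>ys. F x y) = (\<Sum>y\<leftarrow>ys. \<Sum>x\<in>A. F x y)"
  by (induction ys) (simp_all add: sum.distrib)

text \<open>The rotated one may belong to any of the hidden blocks, which gives one front term per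
  entry of \<open>G\<close>, with that block taken out.\<close>

lemma rot_defect_blur:
  assumes h: "order_invariant h"
    and base: "\<And>f D. finite D \<Longrightarrow> \<forall>d\<in>D. a < d \<and> d < b \<Longrightarrow> rot_defect a b h f D = 0"
    and G: "\<And>x. x \<in> set G \<Longrightarrow> x \<ge> 2" and D: "finite D" "\<forall>d\<in>D. a < d \<and> d < b"
  shows "rot_defect a b (blur h G) f D = (\<Sum>l\<leftarrow>G. front_defect a l (blur h (remove1 l G)) f D)"
  using G D
proof (induction G arbitrary: f D)
  case Nil
  then show ?case using base by simp
next
  case (Cons j G)
  let ?D = "\<lambda>R. D - (R - {Min R})" and ?f = "\<lambda>R. f(Min R := j)"
  have j: "j \<ge> 2" and a: "a \<notin> D" using Cons.prems by auto
  have inv: "order_invariant (blur h G)" using order_invariant_blur[OF h] Cons.prems by simp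
  have "(\<Sum>R\<in>subs (ones f D) j. rot_defect a b (blur h G) (?f R) (?D R)) =
      (\<Sum>R\<in>subs (ones f D) j. \<Sum>l\<leftarrow>G. front_defect a l (blur h (remove1 l G)) (?f R) (?D R))"
    using Cons.prems by (intro sum.cong refl Cons.IH) auto
  also have "\<dots> = (\<Sum>l\<leftarrow>G. \<Sum>R\<in>subs (ones f D) j. front_defect a l (blur h (remove1 l G)) (?f R) (?D R))"
    by (rule sum_sum_list_swap)
  also have "\<dots> = (\<Sum>l\<leftarrow>G. front_defect a l (blur h (remove1 l (j # G))) f D)"
  proof (intro arg_cong[where f = sum_list] map_cong refl)
    fix l assume l: "l \<in> set G"
    have "(\<Sum>R\<in>subs (ones f D) j. front_defect a l (blur h (remove1 l G)) (?f R) (?D R)) =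
        front_defect a l (blur h (j # remove1 l G)) f D"
      using Cons.prems a j l by (subst front_defect_gather) auto
    also have "\<dots> = front_defect a l (blur h (remove1 l (j # G))) f D"
    proof (rule front_defect_cong[OF blur_perm])
      show "mset (j # remove1 l G) = mset (remove1 l (j # G))" using l by auto
      show "x \<ge> 2" if "x \<in> set (j # remove1 l G)" for x
        using that Cons.prems(1) notin_set_remove1 by fastforce
    qed (use Cons.prems in auto)
    finally show "(\<Sum>R\<in>subs (ones f D) j. front_defect a l (blur h (remove1 l G)) (?f R) (?D R)) =
        front_defect a l (blur h (remove1 l (j # G))) f D" .
  qed
  finally show ?case
    using rot_defect_gather[OF inv Cons.prems(2,3) j] by simp
qed

section \<open>States: prescribed marks and number of ones\<close>

definition state :: "nat multiset \<Rightarrow> nat \<Rightarrow> (real \<Rightarrow> nat) \<Rightarrow> real set \<Rightarrow> bool" where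
  "state A k f D \<longleftrightarrow> finite D \<and> card (ones f D) = k \<and> image_mset f (mset_set (D - ones f D)) = A"

lemma stateD:
  assumes "state A k f D"
  shows "finite D" "card (ones f D) = k" "image_mset f (mset_set (D - ones f D)) = A"
    "x \<in> D - ones f D \<Longrightarrow> f x \<in># A"
  using assms by (auto simp: state_def)

lemma image_mset_set_cong:
  assumes "D = D'" "\<And>x. x \<in> D' \<Longrightarrow> f x = f' x"
  shows "image_mset f (mset_set D) = image_mset f' (mset_set D')"
proof (cases "finite D'")
  case True
  then show ?thesis using assms by (intro multiset.map_cong) auto
qed (use assms in simp)

lemma state_add_mark:
  assumes "state A k f D" "a \<notin> D" "l \<noteq> 1"
  shows "state (add_mset l A) k (f(a := l)) (insert a D)"
proof -
  have o: "ones (f(a := l)) (insert a D) = ones f D" using assms by (auto simp: ones_def)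
  have "insert a D - ones f D = insert a (D - ones f D)" using assms(2) by (auto simp: ones_def)
  moreover have "image_mset (f(a := l)) (mset_set (D - ones f D)) = image_mset f (mset_set (D - ones f D))"
    using assms(2) by (intro image_mset_set_cong) auto
  ultimately show ?thesis using assms o by (simp add: state_def)
qed

text \<open>The effect of sampling on a state: only the ones in \<open>S\<close> are kept, and all
  marks survive.\<close>

lemma state_restrict:
  assumes "state A k f D" "S \<subseteq> ones f D"
  shows "state A (card S) f (S \<union> (D - ones f D))" "ones f (S \<union> (D - ones f D)) = S"
proof -
  show o: "ones f (S \<union> (D - ones f D)) = S" using assms by (auto simp: ones_def)
  have "S \<union> (D - ones f D) - S = D - ones f D" using assms(2) by auto
  moreover have "finite S" using assms stateD(1)[OF assms(1)] by (metis finite_ones finite_subset)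
  ultimately show "state A (card S) f (S \<union> (D - ones f D))"
    using assms o by (simp add: state_def)
qed

lemma state_remove:
  assumes "state A k f D" "R \<subseteq> ones f D"
  shows "state A (k - card R) f (D - R)"
proof -
  have "D - R = (ones f D - R) \<union> (D - ones f D)" using assms(2) ones_subset[of f D] by auto
  moreover have "card (ones f D - R) = k - card R"
    using assms stateD[OF assms(1)] by (subst card_Diff_subset) (auto intro: finite_subset)
  ultimately show ?thesis using state_restrict(1)[OF assms(1), of "ones f D - R"] by auto
qed

lemma state_add_one:
  assumes "state A k f D" "a \<notin> D"
  shows "state A (Suc k) (f(a := 1)) (insert a D)"
proof -
  have o: "ones (f(a := 1)) (insert a D) = insert a (ones f D)" using assms by (auto simp: ones_def)
  have "a \<notin> ones f D" using assms(2) by (auto simp: ones_def)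
  moreover have "image_mset (f(a := 1)) (mset_set (D - ones f D)) = image_mset f (mset_set (D - ones f D))"
    using assms(2) by (intro image_mset_set_cong) auto
  moreover have "insert a D - insert a (ones f D) = D - ones f D" using assms(2) by auto
  ultimately show ?thesis using assms o by (simp add: state_def)
qed

lemma state_remove_mark:
  assumes "state A k f D" "a \<in> D" "f a \<noteq> 1"
  shows "state (A - {#f a#}) k f (D - {a})" "f a \<in># A"
proof -
  have o: "ones f (D - {a}) = ones f D" using assms by (auto simp: ones_def)
  have "D - ones f D = insert a (D - {a} - ones f D)" using assms by (auto simp: ones_def)
  then have "image_mset f (mset_set (D - ones f D)) = add_mset (f a) (image_mset f (mset_set (D - {a} - ones f D)))"
    using stateD(1)[OF assms(1)] by simp
  then show "state (A - {#f a#}) k f (D - {a})" "f a \<in># A"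
    using stateD[OF assms(1)] o by (auto simp: state_def)
qed

section \<open>Random subsets of the ones and their minima\<close>

lemma card_subs_containing:
  fixes A :: "'a::linorder set"
  assumes "finite A" "a \<in> A" "k \<ge> 1"
  shows "card {R \<in> subs A k. a \<in> R} = (card A - 1) choose (k - 1)"
proof -
  have "{R \<in> subs A k. a \<in> R} = insert a ` subs (A - {a}) (k - 1)"
  proof -
    have "subs A k = subs (A - {a}) k \<union> insert a ` subs (A - {a}) (k - 1)"
      using subs_insert[of a "A - {a}" k] assms by (simp add: insert_absorb)
    then show ?thesis by (auto simp: subs_def)
  qed
  moreover have "inj_on (insert a) (subs (A - {a}) (k - 1))"
    by (intro inj_onI) (auto simp: subs_def insert_ident subset_iff)
  ultimately show ?thesis using assms by (simp add: card_image card_subs)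
qed

text \<open>A sample together with a disjoint block is a larger set with a distinguished subset.
  Sums over disjoint pairs thus become sums of relations, one for each larger set
  \<open>T\<close>.\<close>

lemma sum_subs_union:
  assumes "finite A"
  shows "(\<Sum>S\<in>subs A N. \<Sum>R\<in>subs (A - S) r. \<phi> S R) = (\<Sum>T\<in>subs A (N + r). \<Sum>R\<in>subs T r. \<phi> (T - R) R)"
proof -
  have fin: "finite T" if "T \<subseteq> A" for T using that assms finite_subset by blast
  have card: "card (S \<union> R) = card S + card R" if "S \<subseteq> A" "R \<subseteq> A - S" for S R
    using that fin[of S] fin[of R] by (intro card_Un_disjoint) auto
  have card': "card (T - R) + card R = card T" if "T \<subseteq> A" "R \<subseteq> T" for T R
    using that fin by (metis card_Diff_subset card_mono finite_subset le_add_diff_inverse2)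
  have "(\<Sum>S\<in>subs A N. \<Sum>R\<in>subs (A - S) r. \<phi> S R) =
      (\<Sum>(S, R)\<in>Sigma (subs A N) (\<lambda>S. subs (A - S) r). \<phi> S R)"
    using assms by (intro sum.Sigma) auto
  also have "\<dots> = (\<Sum>(T, R)\<in>Sigma (subs A (N + r)) (\<lambda>T. subs T r). \<phi> (T - R) R)"
  proof (rule sum.reindex_bij_witness[where j = "\<lambda>(S, R). (S \<union> R, R)" and i = "\<lambda>(T, R). (T - R, R)"])
    fix p assume "p \<in> Sigma (subs A N) (\<lambda>S. subs (A - S) r)"
    then obtain S R where p: "p = (S, R)" "S \<subseteq> A" "card S = N" "R \<subseteq> A - S" "card R = r"
      by (auto simp: subs_def)
    have "S \<union> R - R = S" using p by auto
    then show "(\<lambda>(T, R). (T - R, R)) ((\<lambda>(S, R). (S \<union> R, R)) p) = p"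
      and "(\<lambda>(T, R). \<phi> (T - R) R) ((\<lambda>(S, R). (S \<union> R, R)) p) = (case p of (S, R) \<Rightarrow> \<phi> S R)"
      using p by simp_all
    show "(\<lambda>(S, R). (S \<union> R, R)) p \<in> Sigma (subs A (N + r)) (\<lambda>T. subs T r)"
      using p card[OF p(2,4)] by (auto simp: subs_def)
  next
    fix p assume "p \<in> Sigma (subs A (N + r)) (\<lambda>T. subs T r)"
    then obtain T R where p: "p = (T, R)" "T \<subseteq> A" "card T = N + r" "R \<subseteq> T" "card R = r"
      by (auto simp: subs_def)
    have "T - R \<union> R = T" using p by auto
    then show "(\<lambda>(S, R). (S \<union> R, R)) ((\<lambda>(T, R). (T - R, R)) p) = p"
      using p by simp
    show "(\<lambda>(T, R). (T - R, R)) p \<in> Sigma (subs A N) (\<lambda>S. subs (A - S) r)"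
      using p card'[OF p(2,4)] by (auto simp: subs_def)
  qed
  also have "\<dots> = (\<Sum>T\<in>subs A (N + r). \<Sum>R\<in>subs T r. \<phi> (T - R) R)"
    using assms fin by (intro sum.Sigma[symmetric]) (auto simp: subs_def)
  finally show ?thesis .
qed

text \<open>Two random subsets of fixed sizes are disjoint up to a probability of order \<open>1/n\<close>.\<close>

lemma sum_subs_pairs_bound:
  fixes A :: "'a::linorder set" and \<phi> :: "'a set \<Rightarrow> 'a set \<Rightarrow> real"
  assumes A: "finite A" "A \<noteq> {}" and r: "r \<ge> 1"
    and 0: "(\<Sum>S\<in>subs A N. \<Sum>R\<in>subs (A - S) r. \<phi> S R) = 0"
    and B: "\<And>S R. S \<in> subs A N \<Longrightarrow> R \<in> subs A r \<Longrightarrow> \<bar>\<phi> S R\<bar> \<le> B"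
  shows "\<bar>\<Sum>S\<in>subs A N. \<Sum>R\<in>subs A r. \<phi> S R\<bar> \<le>
    B * (N * r / card A) * (card A choose N) * (card A choose r)"
proof (cases "subs A N = {} \<or> subs A r = {}")
  case True
  have "B * (N * r / card A) * (card A choose N) * (card A choose r) = 0"
    using True card_subs[OF A(1), of N] card_subs[OF A(1), of r] by auto
  moreover have "(\<Sum>S\<in>subs A N. \<Sum>R\<in>subs A r. \<phi> S R) = 0" using True by auto
  ultimately show ?thesis by (simp only: of_nat_mult abs_zero order_refl)
next
  case False
  then have B0: "B \<ge> 0" using B by (metis abs_ge_zero all_not_in_conv order_trans)
  define n where "n = card A"
  have n: "n > 0" using A by (simp add: n_def card_gt_0_iff)
  let ?M = "\<lambda>S. {R \<in> subs A r. R \<inter> S \<noteq> {}}"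
  \<comment> \<open>Union bound over the elements of \<open>S\<close>: a fixed element lies in the
    fraction \<open>r / n\<close> of all \<open>r\<close>-subsets.\<close>
  have meet: "card (?M S) \<le> N * r / n * (n choose r)" if S: "S \<in> subs A N" for S
  proof -
    have SA: "S \<subseteq> A" "finite S" "card S = N" using S A by (auto simp: subs_def intro: finite_subset)
    have "card (?M S) \<le> card (\<Union>s\<in>S. {R \<in> subs A r. s \<in> R})"
      using A SA by (intro card_mono) auto
    also have "\<dots> \<le> (\<Sum>s\<in>S. card {R \<in> subs A r. s \<in> R})"
      using SA by (intro card_UN_le)
    also have "\<dots> = (\<Sum>s\<in>S. (n - 1) choose (r - 1))"
      using SA A r unfolding n_def by (intro sum.cong refl card_subs_containing) auto
    also have "\<dots> = N * ((n - 1) choose (r - 1))" using SA by simp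
    finally have "real (card (?M S)) \<le> N * real ((n - 1) choose (r - 1))"
      by (metis of_nat_le_iff of_nat_mult)
    moreover have "r * (n choose r) = n * ((n - 1) choose (r - 1))"
      using r by (intro times_binomial_minus1_eq) auto
    then have "real ((n - 1) choose (r - 1)) = r / n * (n choose r)"
      using n by (simp add: field_simps flip: of_nat_mult)
    ultimately show ?thesis by simp
  qed
  have split: "(\<Sum>R\<in>subs A r. \<phi> S R) = (\<Sum>R\<in>subs (A - S) r. \<phi> S R) + (\<Sum>R\<in>?M S. \<phi> S R)" for S
  proof -
    have "subs A r = subs (A - S) r \<union> ?M S" "subs (A - S) r \<inter> ?M S = {}" by (auto simp: subs_def)
    then show ?thesis using A by (metis (no_types, lifting) finite_Un finite_subs sum.union_disjoint)
  qed
  have "\<bar>\<Sum>S\<in>subs A N. \<Sum>R\<in>subs A r. \<phi> S R\<bar> = \<bar>\<Sum>S\<in>subs A N. \<Sum>R\<in>?M S. \<phi> S R\<bar>"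
    unfolding split sum.distrib 0 by simp
  also have "\<dots> \<le> (\<Sum>S\<in>subs A N. \<Sum>R\<in>?M S. \<bar>\<phi> S R\<bar>)"
    by (rule order_trans[OF sum_abs sum_mono[OF sum_abs]])
  also have "\<dots> \<le> (\<Sum>S\<in>subs A N. \<Sum>R\<in>?M S. B)"
    by (intro sum_mono B) auto
  also have "\<dots> \<le> (\<Sum>S\<in>subs A N. B * (N * r / n * (n choose r)))"
  proof (rule sum_mono)
    fix S assume "S \<in> subs A N"
    from mult_left_mono[OF meet[OF this] B0]
    show "(\<Sum>R\<in>?M S. B) \<le> B * (N * r / n * (n choose r))" by (simp add: mult.commute)
  qed
  also have "\<dots> = B * (N * r / n) * (n choose N) * (n choose r)"
    using A(1) by (simp add: card_subs n_def)
  finally show ?thesis unfolding n_def of_nat_mult .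
qed

lemma subs_1: "subs A 1 = (\<lambda>x. {x}) ` A"
  by (auto simp: subs_def card_1_singleton_iff)

text \<open>Each \<open>l\<close>-set \<open>T\<close> arises from an \<open>(l - 1)\<close>-set by
  adding some \<open>t \<in> T\<close>, and for the \<open>l - 1\<close> choices other than
  \<open>Min T\<close> the minimum is the same before and after. In normalised form, the law of the
  minimum of \<open>l\<close> elements is at most \<open>l / (l - 1)\<close> times that of the
  minimum of \<open>l - 1\<close>.\<close>

lemma sum_subs_Min_le:
  fixes A :: "'a::linorder set" and g :: "'a \<Rightarrow> real"
  assumes A: "finite A" and l: "l \<ge> 2" and g: "\<And>x. x \<in> A \<Longrightarrow> g x \<ge> 0"
  shows "real (l - 1) * (\<Sum>R\<in>subs A l. g (Min R)) \<le>
    real (card A - (l - 1)) * (\<Sum>R\<in>subs A (l - 1). g (Min R))"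
proof -
  have "real (card A - (l - 1)) * (\<Sum>R\<in>subs A (l - 1). g (Min R)) =
      (\<Sum>S\<in>subs A (l - 1). \<Sum>R\<in>subs (A - S) 1. g (Min S))"
  proof -
    have "card (subs (A - S) 1) = card A - (l - 1)" if "S \<in> subs A (l - 1)" for S
      using that A subsD[OF that A] by (subst card_subs) (auto simp: card_Diff_subset)
    then show ?thesis by (simp add: sum_distrib_left)
  qed
  also have "\<dots> = (\<Sum>T\<in>subs A (l - 1 + 1). \<Sum>R\<in>subs T 1. g (Min (T - R)))"
    by (rule sum_subs_union[OF A])
  also have "\<dots> = (\<Sum>T\<in>subs A l. \<Sum>t\<in>T. g (Min (T - {t})))"
  proof -
    have "(\<Sum>R\<in>subs T 1. g (Min (T - R))) = (\<Sum>t\<in>T. g (Min (T - {t})))" for T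
      unfolding subs_1 by (subst sum.reindex) auto
    then show ?thesis using l by simp
  qed
  also have "\<dots> \<ge> (\<Sum>T\<in>subs A l. real (l - 1) * g (Min T))"
  proof (rule sum_mono)
    fix T assume T: "T \<in> subs A l"
    have T': "T \<subseteq> A" "card T = l" "finite T" "Min T \<in> T" using subsD[OF T A] l by auto
    have ge: "g (Min (T - {t})) \<ge> 0" if "t \<in> T" for t
    proof -
      have "card (T - {t}) = l - 1" using T' that by simp
      then have "card (T - {t}) \<noteq> 0" using l by simp
      then have "T - {t} \<noteq> {}" by (metis card.empty)
      then have "Min (T - {t}) \<in> T - {t}" using T' by (intro Min_in) auto
      then show ?thesis using g T' by auto
    qed
    have "real (l - 1) * g (Min T) = (\<Sum>t\<in>T - {Min T}. g (Min T))"
      using T' by (simp add: card_Diff_singleton)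
    also have "\<dots> = (\<Sum>t\<in>T - {Min T}. g (Min (T - {t})))"
    proof (intro sum.cong refl arg_cong[where f = g])
      fix t assume "t \<in> T - {Min T}"
      then show "Min T = Min (T - {t})" using T' by (intro Min_eqI[symmetric]) auto
    qed
    also have "\<dots> \<le> (\<Sum>t\<in>T. g (Min (T - {t})))"
      using T' ge by (intro sum_mono2) auto
    finally show "real (l - 1) * g (Min T) \<le> (\<Sum>t\<in>T. g (Min (T - {t})))" .
  qed
  finally show ?thesis by (simp add: sum_distrib_left)
qed

section \<open>A maximum principle\<close>

lemma ex_just_below:
  fixes x :: real
  assumes "finite D"
  shows "\<exists>y<x. D \<inter> {y..<x} = {}"
proof (cases "{d \<in> D. d < x} = {}")
  case True
  then show ?thesis by (intro exI[of _ "x - 1"]) auto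
next
  case False
  define m where "m = Max {d \<in> D. d < x}"
  have fin: "finite {d \<in> D. d < x}" using assms by simp
  have m: "m < x" "\<And>d. d \<in> D \<Longrightarrow> d < x \<Longrightarrow> d \<le> m"
    using Max_in[OF fin False] Max_ge[OF fin] by (auto simp: m_def)
  obtain y where "m < y" "y < x" using dense[OF m(1)] by blast
  then show ?thesis using m(2) by (intro exI[of _ y]) force
qed

text \<open>Here \<open>d\<close> is the deviation of a dissolved state from its expected value,
  \<open>F\<close> the visible marks and \<open>N\<close> the number of ones. Each relation is
  imposed at the number of ones for which the states it compares have marks \<open>F\<close> and
  exactly \<open>N\<close> ones. The guard \<open>N \<ge> 1\<close> protects the truncated
  difference \<open>N - 1\<close>.\<close>

locale balanced =
  fixes d :: word_fun and F :: "nat multiset" and N :: nat and B :: real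
  assumes inv: "order_invariant d"
    and F: "F \<noteq> {#}" "\<And>l. l \<in># F \<Longrightarrow> l \<ge> 2"
    and rot: "\<And>a b f D. N \<ge> 1 \<Longrightarrow> state F (N - 1) f D \<Longrightarrow> \<forall>x\<in>D. a < x \<and> x < b \<Longrightarrow>
      rot_defect a b d f D = 0"
    and front: "\<And>a l f D. l \<in># F \<Longrightarrow> state (F - {#l#}) (N + (l - 1)) f D \<Longrightarrow> \<forall>x\<in>D. a < x \<Longrightarrow>
      front_defect a l d f D = 0"
    and gather: "\<And>l f D. l \<in># F \<Longrightarrow> state (F - {#l#}) (N + l) f D \<Longrightarrow> gather l d f D = 0"
    and nonneg: "0 \<le> B"
    and bound: "\<And>f D. state F N f D \<Longrightarrow> \<bar>d f D\<bar> \<le> B"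
begin

text \<open>The mean of \<open>d\<close> over random samples of \<open>N\<close> ones, multiplied by
  the number of samples.\<close>

definition sample :: word_fun where
  "sample f D = (\<Sum>S\<in>subs (ones f D) N. d f (S \<union> (D - ones f D)))"

text \<open>Samples that miss the rotated one are unaffected; for the others the relation
  \<open>rot\<close> applies.\<close>

lemma sample_rotate:
  assumes "state F n f X" "\<forall>x\<in>X. a < x \<and> x < b"
  shows "sample (f(a := 1)) (insert a X) = sample (f(b := 1)) (insert b X)"
proof -
  let ?O = "ones f X"
  have X: "finite X" using assms(1) by (rule stateD)
  have ab: "a \<notin> X" "b \<notin> X" using assms(2) by auto
  have O: "finite ?O" "a \<notin> ?O" "b \<notin> ?O" "?O \<subseteq> X" using X ab ones_subset by auto
  have fO: "ones (f(c := 1)) (insert c X) = insert c ?O" if "c \<notin> X" for c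
    using that by (auto simp: ones_def)
  have mark: "insert c X - insert c ?O = X - ?O" if "c \<notin> X" for c using that by auto
  have same: "d (f(c := 1)) (S \<union> (X - ?O)) = d f (S \<union> (X - ?O))" if "c \<notin> X" "S \<subseteq> ?O" for c S
    using that X O by (intro order_invariant_cong[OF inv]) (auto intro: finite_subset)
  show ?thesis
  proof (cases "N = 0")
    case True
    have "subs A 0 = {{}}" if "finite A" for A :: "real set"
      using that by (auto simp: subs_def dest: finite_subset)
    then show ?thesis
      using O X same[OF ab(1), of "{}"] same[OF ab(2), of "{}"] True
      unfolding sample_def fO[OF ab(1)] fO[OF ab(2)] mark[OF ab(1)] mark[OF ab(2)] by simp
  next
    case False
    have eq: "sample (f(c := 1)) (insert c X) = (\<Sum>S\<in>subs ?O N. d f (S \<union> (X - ?O))) +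
        (\<Sum>S\<in>subs ?O (N - 1). d (f(c := 1)) (insert c (S \<union> (X - ?O))))" if c: "c \<notin> X" for c
    proof -
      have "sample (f(c := 1)) (insert c X) = (\<Sum>S\<in>subs ?O N. d (f(c := 1)) (S \<union> (X - ?O))) +
        (\<Sum>S\<in>subs ?O (N - 1). d (f(c := 1)) (insert c S \<union> (X - ?O)))"
        unfolding sample_def fO[OF c] mark[OF c] using c O False by (intro sum_subs_insert) auto
      moreover have "(\<Sum>S\<in>subs ?O N. d (f(c := 1)) (S \<union> (X - ?O))) = (\<Sum>S\<in>subs ?O N. d f (S \<union> (X - ?O)))"
        using same[OF c] subsD(1)[OF _ O(1)] by (intro sum.cong) auto
      ultimately show ?thesis by simp
    qed
    show ?thesis
      unfolding eq[OF ab(1)] eq[OF ab(2)]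
    proof (intro arg_cong2[where f = "(+)"] sum.cong refl)
      fix S assume S: "S \<in> subs ?O (N - 1)"
      have S': "S \<subseteq> ?O" "card S = N - 1" using subsD[OF S O(1)] by auto
      have "rot_defect a b d f (S \<union> (X - ?O)) = 0"
        using state_restrict(1)[OF assms(1) S'(1)] S' O False assms(2) by (intro rot) auto
      then show "d (f(a := 1)) (insert a (S \<union> (X - ?O))) = d (f(b := 1)) (insert b (S \<union> (X - ?O)))"
        by (simp add: rot_defect_def)
    qed
  qed
qed

text \<open>Rotating the leading one to the back shortens the run of ones before the first mark, and
  the induction is on the length of this run.\<close>

lemma front_mark:
  assumes "state F n f D"
  shows "\<exists>a l f' D'. l \<in># F \<and> state (F - {#l#}) n f' D' \<and> (\<forall>x\<in>D'. a < x) \<and>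
    sample f D = sample (f'(a := l)) (insert a D')"
  using assms
proof (induction "card {u \<in> ones f D. \<forall>m\<in>D - ones f D. u < m}" arbitrary: f D rule: less_induct)
  case less
  let ?lead = "\<lambda>f D. {u \<in> ones f D. \<forall>m\<in>D - ones f D. u < m}"
  have D: "finite D" using less.prems by (rule stateD)
  have mark: "D - ones f D \<noteq> {}" using stateD(3)[OF less.prems] F(1) by (metis image_mset_empty mset_set.empty)
  define a where "a = Min D"
  have a: "a \<in> D" "\<And>x. x \<in> D \<Longrightarrow> a \<le> x"
    using Min_in[OF D] Min_le[OF D] mark unfolding a_def by blast+
  show ?case
  proof (cases "f a = 1")
    case False
    have "sample f D = sample (f(a := f a)) (insert a (D - {a}))" using a by (simp add: insert_absorb)
    moreover have "\<forall>x\<in>D - {a}. a < x" using a by force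
    ultimately show ?thesis
      using state_remove_mark[OF less.prems a(1) False] by blast
  next
    case True
    define X where "X = D - {a}"
    define b where "b = Max D + 1"
    define f' where "f' = f(b := 1)"
    have b: "x < b" if "x \<in> D" for x using D that unfolding b_def by (metis Max_ge add.commute add_strict_increasing zero_less_one)
    have X: "\<forall>x\<in>X. a < x \<and> x < b" using a b unfolding X_def by force
    have D_eq: "D = insert a X" using a(1) by (auto simp: X_def)
    have aO: "{a} \<subseteq> ones f D" using True a(1) by (simp add: ones_def)
    have "n \<noteq> 0" using stateD(2)[OF less.prems] aO D by (metis bot.extremum_uniqueI card_0_eq finite_ones insert_not_empty)
    have sX: "state F (n - 1) f X"
      using state_remove[OF less.prems aO] by (simp add: X_def)
    have sb: "state F n f' (insert b X)"
      using state_add_one[OF sX, of b] X \<open>n \<noteq> 0\<close> by (auto simp: f'_def)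
    have "sample f D = sample (f(a := 1)) (insert a X)"
      unfolding D_eq[symmetric] using True by (metis fun_upd_triv)
    also have "\<dots> = sample f' (insert b X)"
      unfolding f'_def by (rule sample_rotate[OF sX X])
    finally have eq: "sample f D = sample f' (insert b X)" .
    have "?lead f' (insert b X) \<subset> ?lead f D"
    proof
      have bX: "b \<notin> X" using X by auto
      obtain m where m: "m \<in> D" "f m \<noteq> 1" using mark by (auto simp: ones_def)
      have m': "m \<in> X" "m < b" using m True b by (auto simp: X_def)
      show "?lead f' (insert b X) \<subseteq> ?lead f D"
      proof
        fix u' assume u': "u' \<in> ?lead f' (insert b X)"
        have "u' \<noteq> b"
        proof
          assume "u' = b"
          moreover have "m \<in> insert b X - ones f' (insert b X)" using m m' by (auto simp: ones_def f'_def)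
          ultimately have "b < m" using u' by blast
          then show False using m' by simp
        qed
        then have "u' \<in> X" "f u' = 1" using u' by (auto simp: ones_def f'_def)
        moreover have "u' < m" if "m \<in> D - ones f D" for m
        proof -
          have "m \<in> insert b X - ones f' (insert b X)"
            using that True bX b[of m] by (auto simp: ones_def f'_def X_def)
          then show ?thesis using u' by auto
        qed
        ultimately show "u' \<in> ?lead f D" by (auto simp: ones_def X_def)
      qed
      have "a \<in> ?lead f D" using a True by (fastforce simp: ones_def order.strict_iff_order)
      moreover have "a \<notin> ?lead f' (insert b X)" using b[OF a(1)] by (auto simp: X_def ones_def)
      ultimately show "?lead f' (insert b X) \<noteq> ?lead f D" by blast
    qed
    then have "card (?lead f' (insert b X)) < card (?lead f D)"
      using D by (intro psubset_card_mono) auto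
    from less.hyps[OF this sb] show ?thesis using eq by simp
  qed
qed

lemma sample_le:
  assumes "state F n f D"
  shows "\<bar>sample f D\<bar> \<le> (n choose N) * B"
proof -
  have D: "finite D" "card (ones f D) = n" using assms by (auto dest: stateD)
  have "\<bar>sample f D\<bar> \<le> (\<Sum>S\<in>subs (ones f D) N. \<bar>d f (S \<union> (D - ones f D))\<bar>)"
    unfolding sample_def by (rule sum_abs)
  also have "\<dots> \<le> (\<Sum>S\<in>subs (ones f D) N. B)"
  proof (intro sum_mono bound)
    fix S assume "S \<in> subs (ones f D) N"
    then have "S \<subseteq> ones f D" "card S = N" by (auto simp: subs_def)
    then show "state F N f (S \<union> (D - ones f D))" using state_restrict(1)[OF assms] by auto
  qed
  finally show ?thesis using D by (simp add: card_subs)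
qed

text \<open>The state is, up to \<open>O(1/n)\<close>, the mean over \<open>l - 1\<close> random ones of the states where the mark
  sits at their minimum, and the mean over \<open>l\<close> random ones of the same states vanishes.\<close>

lemma sample_front_mark_le:
  assumes l: "l \<in># F" and st: "state (F - {#l#}) n f D" and a: "\<forall>x\<in>D. a < x" and n: "l \<le> n"
    and M: "\<And>f D. state F n f D \<Longrightarrow> sample f D \<le> M"
  shows "2 * sample (f(a := l)) (insert a D) \<le> M + 5 * (B * (real N * real l / n) * (n choose N))"
proof -
  let ?O = "ones f D" and ?K = "D - ones f D"
  let ?q = "sample (f(a := l)) (insert a D)"
  have D: "finite D" and cO: "card ?O = n" using st by (auto dest: stateD)
  have l2: "l \<ge> 2" using F(2)[OF l] .
  have n0: "n > 0" using n l2 by simp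
  have O: "finite ?O" "?O \<subseteq> D" "?O \<noteq> {}" using D cO n0 ones_subset by auto
  have aD: "a \<notin> D" using a by auto
  \<comment> \<open>With the mark at \<open>x u\<close>, just below the one \<open>u\<close>, all
    \<open>n\<close> ones remain. The result is again a state with marks \<open>F\<close> and
    \<open>n\<close> ones, so the bound \<open>M\<close> applies to it.\<close>
  obtain x where x: "\<And>u. x u < u \<and> insert a D \<inter> {x u..<u} = {}"
    using ex_just_below[of "insert a D"] D by (metis finite_insert)
  have xD: "x u \<notin> D" for u using x[of u] by auto
  have Fl: "add_mset l (F - {#l#}) = F" using l by simp
  have stF: "state F n (f(c := l)) (insert c D)" if "c \<notin> D" for c
    using state_add_mark[OF st that, of l] l2 Fl by simp
  have sam: "sample (f(c := l)) (insert c D) =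
      (\<Sum>S\<in>subs ?O N. d (f(c := l)) (insert c (S \<union> ?K)))" if c: "c \<notin> D" for c
  proof -
    have "ones (f(c := l)) (insert c D) = ?O" using c l2 by (auto simp: ones_def)
    moreover have "S \<union> (insert c D - ?O) = insert c (S \<union> ?K)" for S using c O by auto
    ultimately show ?thesis unfolding sample_def by simp
  qed
  have bnd: "\<bar>d (f(c := l)) (insert c (S \<union> ?K))\<bar> \<le> B" if "S \<in> subs ?O N" "c \<notin> D" for c S
  proof -
    have S: "S \<subseteq> ?O" "card S = N" using that by (auto simp: subs_def)
    have "state (F - {#l#}) N f (S \<union> ?K)" using state_restrict(1)[OF st S(1)] S by simp
    then have "state F N (f(c := l)) (insert c (S \<union> ?K))"
      using state_add_mark[of "F - {#l#}" N f "S \<union> ?K" c l] l2 Fl that S O by auto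
    then show ?thesis by (rule bound)
  qed
  define G where "G = (\<lambda>u. sample (f(x u := l)) (insert (x u) D))"
  \<comment> \<open>Once the ones in \<open>R\<close> are discarded, no remaining key separates
    \<open>x (Min R)\<close> from \<open>Min R\<close>, so the mark can be moved onto the minimum,
    where the relations expect it.\<close>
  have at_Min: "d (f(x (Min R) := l)) (insert (x (Min R)) (T - R \<union> ?K)) =
      d (f(Min R := l)) (insert (Min R) (T - R \<union> ?K))"
    if T: "T \<subseteq> ?O" and R: "R \<in> subs T r" "r \<ge> 1" for T R r
  proof -
    let ?u = "Min R" and ?X = "T - R \<union> ?K"
    have u: "?u \<in> R" "?u \<in> ?O" using subsD[OF R(1) finite_subset[OF T O(1)]] R(2) T by auto
    have X: "finite ?X" "?X \<subseteq> D" "?u \<notin> ?X" using u T O D by (auto intro: finite_subset)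
    let ?g = "\<lambda>y. if y = ?u then x ?u else y"
    have lt: "y < x ?u \<longleftrightarrow> y < ?u" "x ?u < y \<longleftrightarrow> ?u < y" if "y \<in> ?X" for y
    proof -
      have "y \<in> D" "y \<noteq> ?u" using that X by auto
      moreover from this x[of ?u] have "x ?u < ?u" "y \<notin> {x ?u..<?u}" by blast+
      ultimately show "y < x ?u \<longleftrightarrow> y < ?u" "x ?u < y \<longleftrightarrow> ?u < y" by auto
    qed
    have mono: "strict_mono_on (insert ?u ?X) ?g"
      using X lt by (intro strict_mono_onI) auto
    have img: "?g ` insert ?u ?X = insert (x ?u) ?X"
      using X by (auto simp: image_iff)
    have "d (f(x ?u := l)) (?g ` insert ?u ?X) = d (f(?u := l)) (insert ?u ?X)"
      using X xD[of ?u] by (intro order_invariantD[OF inv] mono) auto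
    then show ?thesis unfolding img .
  qed
  have D_eq: "ones f (T \<union> ?K) = T" "(T \<union> ?K) - R = T - R \<union> ?K"
    "R \<noteq> {} \<Longrightarrow> (T \<union> ?K) - (R - {Min R}) = insert (Min R) (T - R \<union> ?K)"
    if "T \<subseteq> ?O" "R \<subseteq> T" for T R
  proof -
    have "finite R" using that O by (meson finite_subset)
    then have "R \<noteq> {} \<Longrightarrow> Min R \<in> R" by simp
    then show "ones f (T \<union> ?K) = T" "(T \<union> ?K) - R = T - R \<union> ?K"
      "R \<noteq> {} \<Longrightarrow> (T \<union> ?K) - (R - {Min R}) = insert (Min R) (T - R \<union> ?K)"
      using that by (auto simp: ones_def)
  qed
  let ?E = "B * (real N * real l / n) * (n choose N)"
  have E0: "?E \<ge> 0" using nonneg by simp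
  \<comment> \<open>The disjoint pairs cancel by \<open>front\<close>, and the pairs that meet are a
    fraction of at most \<open>N * l / n\<close>. The factor 2 arises because each term is a
    difference of two values bounded by \<open>B\<close>.\<close>
  have 1: "\<bar>real (n choose (l - 1)) * ?q - (\<Sum>R\<in>subs ?O (l - 1). G (Min R))\<bar> \<le> 2 * ?E * (n choose (l - 1))"
  proof -
    let ?\<phi> = "\<lambda>S R. d (f(a := l)) (insert a (S \<union> ?K)) - d (f(x (Min R) := l)) (insert (x (Min R)) (S \<union> ?K))"
    have "(\<Sum>S\<in>subs ?O N. \<Sum>R\<in>subs (?O - S) (l - 1). ?\<phi> S R) =
        (\<Sum>T\<in>subs ?O (N + (l - 1)). \<Sum>R\<in>subs T (l - 1). ?\<phi> (T - R) R)"
      by (rule sum_subs_union[OF O(1)])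
    also have "\<dots> = (\<Sum>T\<in>subs ?O (N + (l - 1)). front_defect a l d f (T \<union> ?K))"
    proof (intro sum.cong refl)
      fix T assume "T \<in> subs ?O (N + (l - 1))"
      then have T: "T \<subseteq> ?O" "finite T" using O(1) by (auto simp: subs_def intro: finite_subset)
      show "(\<Sum>R\<in>subs T (l - 1). ?\<phi> (T - R) R) = front_defect a l d f (T \<union> ?K)"
        unfolding front_defect_def D_eq(1)[OF T(1) order_refl]
      proof (intro sum.cong refl)
        fix R assume R: "R \<in> subs T (l - 1)"
        have "R \<subseteq> T" "R \<noteq> {}" using subsD[OF R T(2)] l2 by auto
        then show "?\<phi> (T - R) R =
            d (f(a := l)) (insert a (T \<union> ?K - R)) - d (f(Min R := l)) (T \<union> ?K - (R - {Min R}))"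
          using at_Min[OF T(1) R] l2 by (simp add: D_eq[OF T(1)])
      qed
    qed
    also have "\<dots> = 0"
    proof (rule sum.neutral, rule ballI, rule front[OF l])
      fix T assume T: "T \<in> subs ?O (N + (l - 1))"
      show "state (F - {#l#}) (N + (l - 1)) f (T \<union> ?K)"
        using state_restrict(1)[OF st, of T] T by (auto simp: subs_def)
      show "\<forall>x\<in>T \<union> ?K. a < x" using T a O by (auto simp: subs_def)
    qed
    finally have zero: "(\<Sum>S\<in>subs ?O N. \<Sum>R\<in>subs (?O - S) (l - 1). ?\<phi> S R) = 0" .
    have bd: "\<bar>?\<phi> S R\<bar> \<le> 2 * B" if "S \<in> subs ?O N" "R \<in> subs ?O (l - 1)" for S R
      using bnd[OF that(1) aD] bnd[OF that(1) xD[of "Min R"]] unfolding abs_le_iff by linarith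
    have "\<bar>\<Sum>S\<in>subs ?O N. \<Sum>R\<in>subs ?O (l - 1). ?\<phi> S R\<bar> \<le>
        2 * B * (real N * real (l - 1) / card ?O) * (card ?O choose N) * (card ?O choose (l - 1))"
      using l2 by (intro sum_subs_pairs_bound[OF O(1,3) _ zero bd]) auto
    also have "\<dots> \<le> 2 * ?E * (n choose (l - 1))"
    proof -
      have "B * (real N * real (l - 1) / n) \<le> B * (real N * real l / n)"
        using nonneg by (intro mult_left_mono divide_right_mono) auto
      then have "2 * (B * (real N * real (l - 1) / n)) * ((n choose N) * (n choose (l - 1))) \<le>
          2 * (B * (real N * real l / n)) * ((n choose N) * (n choose (l - 1)))"
        by (intro mult_right_mono) auto
      then show ?thesis by (simp add: cO mult_ac)
    qed
    finally have "\<bar>\<Sum>R\<in>subs ?O (l - 1). \<Sum>S\<in>subs ?O N. ?\<phi> S R\<bar> \<le> 2 * ?E * (n choose (l - 1))"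
      by (subst sum.swap)
    then show ?thesis
      unfolding sum_subtractf G_def using sam[OF aD] sam[OF xD] O by (simp add: card_subs cO)
  qed
  \<comment> \<open>Now the disjoint pairs cancel by \<open>gather\<close>: the mean over the minima
    of \<open>l\<close> ones is nearly 0.\<close>
  have 2: "\<bar>\<Sum>R\<in>subs ?O l. G (Min R)\<bar> \<le> ?E * (n choose l)"
  proof -
    let ?\<phi> = "\<lambda>S R. d (f(x (Min R) := l)) (insert (x (Min R)) (S \<union> ?K))"
    have "(\<Sum>S\<in>subs ?O N. \<Sum>R\<in>subs (?O - S) l. ?\<phi> S R) =
        (\<Sum>T\<in>subs ?O (N + l). \<Sum>R\<in>subs T l. ?\<phi> (T - R) R)"
      by (rule sum_subs_union[OF O(1)])
    also have "\<dots> = (\<Sum>T\<in>subs ?O (N + l). gather l d f (T \<union> ?K))"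
    proof (intro sum.cong refl)
      fix T assume "T \<in> subs ?O (N + l)"
      then have T: "T \<subseteq> ?O" "finite T" using O(1) by (auto simp: subs_def intro: finite_subset)
      show "(\<Sum>R\<in>subs T l. ?\<phi> (T - R) R) = gather l d f (T \<union> ?K)"
        unfolding gather_def D_eq(1)[OF T(1) order_refl]
      proof (intro sum.cong refl)
        fix R assume R: "R \<in> subs T l"
        have "R \<subseteq> T" "R \<noteq> {}" using subsD[OF R T(2)] l2 by auto
        then show "?\<phi> (T - R) R = d (f(Min R := l)) (T \<union> ?K - (R - {Min R}))"
          using at_Min[OF T(1) R] l2 by (simp add: D_eq[OF T(1)])
      qed
    qed
    also have "\<dots> = 0"
    proof (intro sum.neutral ballI gather[OF l])
      fix T assume T: "T \<in> subs ?O (N + l)"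
      show "state (F - {#l#}) (N + l) f (T \<union> ?K)"
        using state_restrict(1)[OF st, of T] T by (auto simp: subs_def)
    qed
    finally have zero: "(\<Sum>S\<in>subs ?O N. \<Sum>R\<in>subs (?O - S) l. ?\<phi> S R) = 0" .
    have bd: "\<bar>?\<phi> S R\<bar> \<le> B" if "S \<in> subs ?O N" "R \<in> subs ?O l" for S R
      using bnd[OF that(1) xD[of "Min R"]] .
    have "\<bar>\<Sum>S\<in>subs ?O N. \<Sum>R\<in>subs ?O l. ?\<phi> S R\<bar> \<le>
        B * (real N * real l / card ?O) * (card ?O choose N) * (card ?O choose l)"
      using l2 by (intro sum_subs_pairs_bound[OF O(1,3) _ zero bd]) auto
    then have "\<bar>\<Sum>R\<in>subs ?O l. \<Sum>S\<in>subs ?O N. ?\<phi> S R\<bar> \<le> ?E * (n choose l)"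
      by (subst sum.swap) (simp add: cO)
    then show ?thesis unfolding G_def using sam[OF xD] by simp
  qed
  \<comment> \<open>The comparison of minima requires a nonnegative function, hence
    \<open>M - G\<close> in place of \<open>G\<close>. Its mean over \<open>l\<close>-sets is nearly
    \<open>M\<close>, its mean over \<open>(l - 1)\<close>-sets nearly
    \<open>M - ?q\<close>.\<close>
  have "real (l - 1) * (\<Sum>R\<in>subs ?O l. M - G (Min R)) \<le>
      real (card ?O - (l - 1)) * (\<Sum>R\<in>subs ?O (l - 1). M - G (Min R))"
    using M[OF stF[OF xD]] by (intro sum_subs_Min_le[OF O(1) l2]) (simp add: G_def)
  then have 3: "real (l - 1) * ((n choose l) * M - (\<Sum>R\<in>subs ?O l. G (Min R))) \<le>
      real (n - (l - 1)) * ((n choose (l - 1)) * M - (\<Sum>R\<in>subs ?O (l - 1). G (Min R)))"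
    using O by (simp add: sum_subtractf card_subs cO)
  have "l * (n choose l) = (n - (l - 1)) * (n choose (l - 1))"
    using l2 n binomial_absorb_comp[of n "l - 1"] times_binomial_minus1_eq[of l n] by simp
  then have ch: "real (n - (l - 1)) * (n choose (l - 1)) = real l * (n choose l)"
    by (metis of_nat_mult)
  have "real (l - 1) * ((n choose l) * M - ?E * (n choose l)) \<le>
      real (l - 1) * ((n choose l) * M - (\<Sum>R\<in>subs ?O l. G (Min R)))"
    using 2 by (intro mult_left_mono) auto
  also note 3
  also have "real (n - (l - 1)) * ((n choose (l - 1)) * M - (\<Sum>R\<in>subs ?O (l - 1). G (Min R))) \<le>
      real (n - (l - 1)) * ((n choose (l - 1)) * (M - ?q + 2 * ?E))"
    using 1 by (intro mult_left_mono) (auto simp: algebra_simps abs_le_iff)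
  also have "\<dots> = (n choose l) * (l * (M - ?q + 2 * ?E))"
    using ch by (simp add: mult_ac)
  finally have "(n choose l) * (real (l - 1) * (M - ?E)) \<le> (n choose l) * (l * (M - ?q + 2 * ?E))"
    by (simp add: algebra_simps)
  then have "real (l - 1) * (M - ?E) \<le> l * (M - ?q + 2 * ?E)"
    using n by (subst (asm) mult_le_cancel_left_pos) auto
  \<comment> \<open>The ratio \<open>l / (l - 1)\<close> is at most 2, and the factor multiplied by
    it is nonnegative since \<open>?q \<le> M\<close>. The outcome
    \<open>M - ?E \<le> 2 * (M - ?q + 2 * ?E)\<close> explains the constant 5 as 1 + 2 * 2.\<close>
  also have "\<dots> \<le> real (l - 1) * (2 * (M - ?q + 2 * ?E))"
  proof -
    have "?q \<le> M" using M[OF stF[OF aD]] .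
    moreover have "real l \<le> 2 * real (l - 1)" using l2 by simp
    ultimately have "real l * (M - ?q + 2 * ?E) \<le> 2 * real (l - 1) * (M - ?q + 2 * ?E)"
      using E0 by (intro mult_right_mono) auto
    then show ?thesis by (simp only: mult_ac)
  qed
  finally have "M - ?E \<le> 2 * (M - ?q + 2 * ?E)"
    using l2 by (subst (asm) mult_le_cancel_left_pos) auto
  then show ?thesis by argo
qed

text \<open>With a mark rotated to the front, every sample is at most half the supremum plus an
  error; hence the supremum is at most twice that error.\<close>

lemma sample_upper:
  assumes st: "state F n f D" and L: "\<And>l. l \<in># F \<Longrightarrow> l \<le> L" "L \<le> n"
  shows "sample f D \<le> 5 * (B * (real N * real L / n) * (n choose N))"
proof -
  let ?X = "{sample f D | f D. state F n f D}" and ?E = "B * (real N * real L / n) * (n choose N)"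
  define M where "M = Sup ?X"
  have "bdd_above ?X"
    using sample_le by (intro bdd_aboveI[of _ "(n choose N) * B"]) (auto simp: abs_le_iff)
  then have M: "sample f D \<le> M" if "state F n f D" for f D
    using that unfolding M_def by (intro cSup_upper) auto
  have "M \<le> (M + 5 * ?E) / 2"
    unfolding M_def
  proof (rule cSup_least)
    show "?X \<noteq> {}" using st by auto
    fix y assume "y \<in> ?X"
    then obtain f D where y: "y = sample f D" "state F n f D" by auto
    obtain a l f' D' where *: "l \<in># F" "state (F - {#l#}) n f' D'" "\<forall>x\<in>D'. a < x"
      "sample f D = sample (f'(a := l)) (insert a D')"
      using front_mark[OF y(2)] by blast
    have "l \<le> L" using L(1) * by simp
    have "2 * y \<le> M + 5 * (B * (real N * real l / n) * (n choose N))"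
      unfolding y * using sample_front_mark_le[OF *(1-3) _ M] \<open>l \<le> L\<close> L(2) by simp
    moreover have "B * (real N * real l / n) * (n choose N) \<le> ?E"
      using nonneg \<open>l \<le> L\<close> by (intro mult_right_mono mult_left_mono divide_right_mono) auto
    ultimately show "y \<le> (Sup ?X + 5 * ?E) / 2" unfolding M_def by argo
  qed
  then have "M \<le> 5 * ?E" by argo
  then show ?thesis using M[OF st] by linarith
qed

end

lemma balanced_uminus:
  assumes "balanced d F N B"
  shows "balanced (\<lambda>f D. - d f D) F N B"
proof -
  interpret balanced d F N B by fact
  show ?thesis
  proof
    show "order_invariant (\<lambda>f D. - d f D)" using inv unfolding order_invariant_def by simp
    show "rot_defect a b (\<lambda>f D. - d f D) f D = 0"
      if "N \<ge> 1" "state F (N - 1) f D" "\<forall>x\<in>D. a < x \<and> x < b" for a b f D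
      using rot[OF that] by (simp add: rot_defect_def)
    show "front_defect a l (\<lambda>f D. - d f D) f D = 0"
      if "l \<in># F" "state (F - {#l#}) (N + (l - 1)) f D" "\<forall>x\<in>D. a < x" for a l f D
    proof -
      have "front_defect a l (\<lambda>f D. - d f D) f D = - front_defect a l d f D"
        unfolding front_defect_def by (simp add: sum_negf[symmetric])
      then show ?thesis using front[OF that] by simp
    qed
    show "gather l (\<lambda>f D. - d f D) f D = 0"
      if "l \<in># F" "state (F - {#l#}) (N + l) f D" for l f D
      using gather[OF that] unfolding gather_def by (simp add: sum_negf)
  qed (use F nonneg bound in auto)
qed

lemma balanced_sample_le:
  assumes bal: "balanced d F N B" and st: "state F n f D"
    and L: "\<And>l. l \<in># F \<Longrightarrow> l \<le> L" "L \<le> n"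
  shows "\<bar>\<Sum>S\<in>subs (ones f D) N. d f (S \<union> (D - ones f D))\<bar> \<le>
    5 * (B * (real N * real L / n) * (n choose N))"
  using balanced.sample_upper[OF bal st L] balanced.sample_upper[OF balanced_uminus[OF bal] st L]
  by (simp add: balanced.sample_def[OF bal] balanced.sample_def[OF balanced_uminus[OF bal]] sum_negf)

section \<open>Separating clusters of ones\<close>

text \<open>The division by \<open>n\<close> lowers the growth in \<open>s\<close> from order
  \<open>N\<close> to order \<open>N - 1\<close>. This single power decides the comparison with the
  transversals below.\<close>

lemma choose_div_le:
  assumes "0 < n" "n \<le> k * s" "1 \<le> N"
  shows "real (n choose N) / n \<le> real k ^ (N - 1) * real s ^ (N - 1)"
proof -
  have "n choose N \<le> n ^ N"
    by (cases "N \<le> n") (auto intro: binomial_le_pow simp: binomial_eq_0)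
  then have "real (n choose N) / n \<le> real (n ^ N) / n"
    by (intro divide_right_mono) (auto simp only: of_nat_le_iff)
  also have "\<dots> = real n ^ (N - 1)"
  proof -
    obtain m where "N = Suc m" using assms(3) by (cases N) auto
    then show ?thesis using assms(1) by simp
  qed
  also have "\<dots> \<le> real (k * s) ^ (N - 1)"
    using assms by (intro power_mono) (auto simp only: of_nat_le_iff)
  finally show ?thesis by (simp add: power_mult_distrib)
qed

text \<open>Each integer key is spread over \<open>s\<close> keys in the half-open unit interval
  starting there, so that rounding down recovers it.\<close>

definition cluster :: "nat \<Rightarrow> real set \<Rightarrow> real set" where
  "cluster s A = (\<lambda>(u, j). u + real j / real s) ` (A \<times> {..<s})"

definition flr :: "real \<Rightarrow> real" where
  "flr x = of_int \<lfloor>x\<rfloor>"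

lemma flr_cluster_elem:
  assumes "u \<in> \<int>" "j < s"
  shows "flr (u + real j / real s) = u"
proof -
  obtain k where k: "u = of_int k" using assms(1) by (auto elim: Ints_cases)
  have "0 \<le> real j / real s" "real j / real s < 1" using assms(2) by auto
  then have "\<lfloor>u + real j / real s\<rfloor> = k" unfolding k by (intro floor_unique) auto
  then show ?thesis by (simp add: flr_def k)
qed

lemma flr_Ints: "u \<in> \<int> \<Longrightarrow> flr u = u"
  by (auto simp: flr_def elim: Ints_cases)

lemma flr_cluster: "A \<subseteq> \<int> \<Longrightarrow> y \<in> cluster s A \<Longrightarrow> flr y \<in> A"
  by (auto simp: cluster_def flr_cluster_elem subset_iff)

lemma finite_cluster: "finite A \<Longrightarrow> finite (cluster s A)"
  by (simp add: cluster_def)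

lemma inj_on_cluster:
  assumes "A \<subseteq> \<int>"
  shows "inj_on (\<lambda>(u, j). u + real j / real s) (A \<times> {..<s})"
proof (rule inj_onI)
  fix p q assume p: "p \<in> A \<times> {..<s}" and q: "q \<in> A \<times> {..<s}"
    and eq: "(\<lambda>(u, j). u + real j / real s) p = (\<lambda>(u, j). u + real j / real s) q"
  have "flr ((\<lambda>(u, j). u + real j / real s) r) = fst r" if "r \<in> A \<times> {..<s}" for r
    using that assms by (auto intro!: flr_cluster_elem)
  from this[OF p] this[OF q] have "fst p = fst q" using eq by simp
  then show "p = q" using p q eq by (cases p, cases q) auto
qed

lemma card_cluster: "A \<subseteq> \<int> \<Longrightarrow> card (cluster s A) = card A * s"
  unfolding cluster_def by (simp add: card_image inj_on_cluster card_cartesian_product)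

lemma cluster_mono: "A \<subseteq> B \<Longrightarrow> cluster s A \<subseteq> cluster s B"
  unfolding cluster_def by auto

lemma cluster_flr:
  assumes "A \<subseteq> \<int>" "y \<in> cluster s A" "flr y \<in> B"
  shows "y \<in> cluster s B"
proof -
  obtain u j where y: "y = u + real j / real s" "u \<in> A" "j < s" using assms(2) by (auto simp: cluster_def)
  then have "flr y = u" using flr_cluster_elem[of u j s] assms(1) by auto
  then have "(u, j) \<in> B \<times> {..<s}" using y assms(3) by simp
  then show ?thesis unfolding cluster_def y(1) by (intro image_eqI[of _ _ "(u, j)"]) auto
qed

text \<open>The samples drawn from the clusters over any \<open>A\<close> add up to
  \<open>O(s ^ (N - 1))\<close>. By induction on \<open>A\<close> the same holds for those that meet
  every cluster over \<open>A\<close>. If \<open>A\<close> consists of all \<open>N\<close> ones,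
  these are the transversals: there are at least \<open>s ^ N\<close>, each contributing
  \<open>d f D\<close>, which must therefore be 0.\<close>

lemma balanced_zero_Ints:
  assumes bal: "balanced d F N B" and N: "N \<ge> 1" and DZ: "D \<subseteq> \<int>" and st: "state F N f D"
  shows "d f D = 0"
proof -
  interpret balanced d F N B by fact
  let ?O = "ones f D" and ?K = "D - ones f D"
  have D: "finite D" and cO: "card ?O = N" using st by (auto dest: stateD)
  have O: "finite ?O" "?O \<subseteq> \<int>" and K: "finite ?K" "?K \<subseteq> \<int>"
    using D DZ ones_subset[of f D] by auto
  obtain L where L: "\<And>l. l \<in># F \<Longrightarrow> l \<le> L" using finite_nat_set_iff_bounded_le[of "set_mset F"] by auto
  define f' where "f' = f \<circ> flr"
  define \<sigma> where "\<sigma> = (\<lambda>s A. \<Sum>S\<in>subs (cluster s A) N. d f' (S \<union> ?K))"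
  define Tr where "Tr = (\<lambda>s A. {S \<in> subs (cluster s A) N. flr ` S = A})"
  define \<tau> where "\<tau> = (\<lambda>s A. \<Sum>S\<in>Tr s A. d f' (S \<union> ?K))"
  have AZ: "A \<subseteq> \<int>" and finA: "finite A" if "A \<subseteq> ?O" for A using that O by (auto intro: finite_subset)
  have f'K: "f' x = f x" if "x \<in> ?K" for x using that K flr_Ints by (auto simp: f'_def)
  \<comment> \<open>From \<open>balanced_sample_le\<close> and \<open>choose_div_le\<close> with
    \<open>card A * s\<close> ones in at most \<open>N\<close> clusters. The later condition
    \<open>s > L\<close> makes sure that a nonempty \<open>A\<close> supplies at least
    \<open>L\<close> ones.\<close>
  define c0 where "c0 = 5 * B * real N * real L * real N ^ (N - 1)"
  have c0: "c0 \<ge> 0" using nonneg by (simp add: c0_def)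
  have \<sigma>_le: "\<bar>\<sigma> s A\<bar> \<le> c0 * real s ^ (N - 1)" if A: "A \<subseteq> ?O" and s: "s > L" for s A
  proof (cases "A = {}")
    case True
    then have "subs (cluster s A) N = {}" using N by (auto simp: subs_def cluster_def)
    then show ?thesis using c0 by (simp add: \<sigma>_def)
  next
    case False
    let ?n = "card A * s"
    have fone: "f' y = 1" if "y \<in> cluster s A" for y
      using flr_cluster[OF AZ[OF A] that] A by (auto simp: f'_def ones_def)
    have ne: "f' x \<noteq> 1" if "x \<in> ?K" for x
      using f'K[OF that] that by (simp add: ones_def)
    have disj: "cluster s A \<inter> ?K = {}" using fone ne by blast
    have o: "ones f' (cluster s A \<union> ?K) = cluster s A"
      unfolding ones_def[of f'] using fone ne by blast
    have k: "(cluster s A \<union> ?K) - cluster s A = ?K" using disj by auto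
    have "image_mset f' (mset_set ?K) = F"
      using image_mset_set_cong[of ?K ?K f' f, OF refl f'K] stateD(3)[OF st] by simp
    then have "state F ?n f' (cluster s A \<union> ?K)"
      unfolding state_def o k using K(1) finite_cluster[OF finA[OF A]] card_cluster[OF AZ[OF A]] by blast
    moreover have cA: "card A > 0" "card A \<le> N"
      using False finA[OF A] card_mono[OF O(1) A] cO by (auto simp: card_gt_0_iff)
    then have n: "?n \<ge> s" "?n > 0" using s by auto
    ultimately have "\<bar>\<sigma> s A\<bar> \<le> 5 * (B * (real N * real L / ?n) * (?n choose N))"
      using balanced_sample_le[OF bal _ L, of ?n f' "cluster s A \<union> ?K"] s unfolding o k \<sigma>_def by linarith
    also have "\<dots> = 5 * B * real N * real L * (real (?n choose N) / ?n)"
      by (simp add: divide_inverse mult_ac)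
    also have "\<dots> \<le> 5 * B * real N * real L * (real N ^ (N - 1) * real s ^ (N - 1))"
      using n cA N nonneg by (intro mult_left_mono choose_div_le) auto
    finally show ?thesis by (simp add: c0_def mult_ac)
  qed
  have split: "\<sigma> s A = (\<Sum>C\<in>Pow A. \<tau> s C)" if A: "A \<subseteq> ?O" for s A
  proof -
    have "subs (cluster s A) N = (\<Union>C\<in>Pow A. Tr s C)"
    proof (intro equalityI subsetI)
      fix S assume S: "S \<in> subs (cluster s A) N"
      then have "flr ` S \<subseteq> A" using flr_cluster[OF AZ[OF A]] by (auto simp: subs_def)
      moreover have "S \<subseteq> cluster s (flr ` S)"
        using S cluster_flr[OF AZ[OF A]] by (auto simp: subs_def)
      ultimately show "S \<in> (\<Union>C\<in>Pow A. Tr s C)" using S by (auto simp: Tr_def subs_def)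
    next
      fix S assume "S \<in> (\<Union>C\<in>Pow A. Tr s C)"
      then obtain C where C: "C \<subseteq> A" "S \<subseteq> cluster s C" "card S = N" by (auto simp: Tr_def subs_def)
      then show "S \<in> subs (cluster s A) N" using cluster_mono[OF C(1)] by (auto simp: subs_def)
    qed
    moreover have "finite (Tr s C)" if "C \<in> Pow A" for C
    proof -
      have "finite C" using that finA[OF A] by (auto intro: finite_subset)
      then show ?thesis unfolding Tr_def by (simp add: finite_cluster)
    qed
    ultimately show ?thesis
      unfolding \<sigma>_def \<tau>_def using finA[OF A]
      by (simp only: ) (subst sum.UNION_disjoint, auto simp: Tr_def)
  qed
  have "\<exists>c. \<forall>s>L. \<bar>\<tau> s A\<bar> \<le> c * real s ^ (N - 1)" if "A \<subseteq> ?O" for A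
    using finA[OF that] that
  proof (induction A rule: finite_psubset_induct)
    case (psubset A)
    have "\<exists>c. \<forall>s>L. \<bar>\<tau> s C\<bar> \<le> c * real s ^ (N - 1)" if "C \<subset> A" for C
      using psubset.IH[OF that] that psubset.prems by blast
    then obtain c where c: "\<And>C s. C \<subset> A \<Longrightarrow> s > L \<Longrightarrow> \<bar>\<tau> s C\<bar> \<le> c C * real s ^ (N - 1)" by metis
    let ?P = "Pow A - {A}"
    have "\<bar>\<tau> s A\<bar> \<le> (c0 + (\<Sum>C\<in>?P. c C)) * real s ^ (N - 1)" if s: "s > L" for s
    proof -
      have "\<sigma> s A = \<tau> s A + (\<Sum>C\<in>?P. \<tau> s C)"
        unfolding split[OF psubset.prems] using psubset.hyps by (subst sum.remove[of _ A]) auto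
      then have "\<bar>\<tau> s A\<bar> \<le> \<bar>\<sigma> s A\<bar> + \<bar>\<Sum>C\<in>?P. \<tau> s C\<bar>" by linarith
      also have "\<dots> \<le> c0 * real s ^ (N - 1) + (\<Sum>C\<in>?P. c C * real s ^ (N - 1))"
        using \<sigma>_le[OF psubset.prems s] c[OF _ s]
        by (intro add_mono order_trans[OF sum_abs sum_mono]) auto
      finally show ?thesis by (simp add: sum_distrib_right distrib_right)
    qed
    then show ?case by blast
  qed
  then obtain c where c: "\<And>s. s > L \<Longrightarrow> \<bar>\<tau> s ?O\<bar> \<le> c * real s ^ (N - 1)" by blast
  have \<tau>_O: "\<tau> s ?O = card (Tr s ?O) * d f D" for s
  proof -
    have "d f' (S \<union> ?K) = d f D" if S: "S \<in> Tr s ?O" for S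
    proof -
      have S': "S \<subseteq> cluster s ?O" "card S = N" "flr ` S = ?O" using S by (auto simp: Tr_def subs_def)
      have fS: "finite S" using S'(1) finite_cluster[OF O(1)] by (rule finite_subset)
      have inj: "inj_on flr S" using fS S' cO by (simp add: eq_card_imp_inj_on)
      have fK: "flr x = x" if "x \<in> ?K" for x using that K(2) by (intro flr_Ints) blast
      have "flr ` ?K = id ` ?K" by (rule image_cong) (use fK in auto)
      then have imgK: "flr ` ?K = ?K" by simp
      have "inj_on flr (S \<union> ?K)"
      proof (rule inj_onI)
        fix x y assume xy: "x \<in> S \<union> ?K" "y \<in> S \<union> ?K" "flr x = flr y"
        have *: "flr z \<in> ?O \<longleftrightarrow> z \<in> S" if "z \<in> S \<union> ?K" for z
          using that S'(3) fK by (metis DiffE Un_iff image_eqI)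
        show "x = y"
        proof (cases "x \<in> S")
          case True
          then have "y \<in> S" using * xy by metis
          then show ?thesis using True xy(3) inj by (simp add: inj_on_eq_iff)
        next
          case False
          then have "y \<notin> S" using * xy by metis
          then show ?thesis using False xy fK by (metis UnE)
        qed
      qed
      have "strict_mono_on (S \<union> ?K) flr"
      proof (rule strict_mono_onI)
        fix x y assume xy: "x \<in> S \<union> ?K" "y \<in> S \<union> ?K" "x < y"
        then have "flr x \<noteq> flr y" using \<open>inj_on flr (S \<union> ?K)\<close> by (metis inj_on_eq_iff less_irrefl)
        moreover have "flr x \<le> flr y" using xy(3) by (simp add: flr_def floor_mono)
        ultimately show "flr x < flr y" by simp
      qed
      moreover have "flr ` (S \<union> ?K) = D" using S'(3) imgK ones_subset[of f D] by (simp add: image_Un Un_absorb1)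
      ultimately show ?thesis
        using order_invariantD[OF inv, of "S \<union> ?K" flr f f'] fS K by (simp add: f'_def)
    qed
    then show ?thesis by (simp add: \<tau>_def)
  qed
  have Tr_ge: "s ^ N \<le> card (Tr s ?O)" for s
  proof -
    let ?\<Phi> = "\<lambda>\<phi>. (\<lambda>u. u + real (\<phi> u) / real s) ` ?O"
    have lt: "\<phi> u < s" if "\<phi> \<in> ?O \<rightarrow>\<^sub>E {..<s}" "u \<in> ?O" for \<phi> u using that by auto
    have fl: "flr (u + real (\<phi> u) / real s) = u" if "\<phi> \<in> ?O \<rightarrow>\<^sub>E {..<s}" "u \<in> ?O" for \<phi> u
      using that O lt[OF that] by (intro flr_cluster_elem) auto
    have "inj_on ?\<Phi> (?O \<rightarrow>\<^sub>E {..<s})"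
    proof (rule inj_onI)
      fix \<phi> \<psi> assume *: "\<phi> \<in> ?O \<rightarrow>\<^sub>E {..<s}" "\<psi> \<in> ?O \<rightarrow>\<^sub>E {..<s}" "?\<Phi> \<phi> = ?\<Phi> \<psi>"
      show "\<phi> = \<psi>"
      proof (rule PiE_ext[OF *(1,2)])
        fix u assume u: "u \<in> ?O"
        then have "u + real (\<phi> u) / real s \<in> ?\<Phi> \<psi>" using *(3) by blast
        then obtain v where v: "v \<in> ?O" "u + real (\<phi> u) / real s = v + real (\<psi> v) / real s" by auto
        then have "u = v" using fl[OF *(1) u] fl[OF *(2) v(1)] by simp
        then show "\<phi> u = \<psi> u" using v lt[OF *(1) u] by simp
      qed
    qed
    moreover have "?\<Phi> ` (?O \<rightarrow>\<^sub>E {..<s}) \<subseteq> Tr s ?O"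
    proof
      fix S assume "S \<in> ?\<Phi> ` (?O \<rightarrow>\<^sub>E {..<s})"
      then obtain \<phi> where \<phi>: "\<phi> \<in> ?O \<rightarrow>\<^sub>E {..<s}" "S = ?\<Phi> \<phi>" by auto
      have "flr ` S = ?O" unfolding \<phi>(2) image_image using fl[OF \<phi>(1)] by simp
      moreover have "inj_on (\<lambda>u. u + real (\<phi> u) / real s) ?O"
      proof (rule inj_onI)
        fix u v assume uv: "u \<in> ?O" "v \<in> ?O" "u + real (\<phi> u) / real s = v + real (\<phi> v) / real s"
        show "u = v" using fl[OF \<phi>(1) uv(1)] fl[OF \<phi>(1) uv(2)] unfolding uv(3) by simp
      qed
      then have "card S = N" unfolding \<phi>(2) using cO by (simp add: card_image)
      moreover have "S \<subseteq> cluster s ?O"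
        unfolding \<phi>(2) cluster_def using lt[OF \<phi>(1)] by (auto simp: image_iff)
      ultimately show "S \<in> Tr s ?O" by (simp add: Tr_def subs_def)
    qed
    moreover have "finite (Tr s ?O)" unfolding Tr_def by (simp add: finite_cluster O)
    ultimately have "card (?O \<rightarrow>\<^sub>E {..<s}) \<le> card (Tr s ?O)" by (rule card_inj_on_le)
    then show ?thesis using O cO by (simp add: card_funcsetE)
  qed
  have "real s * \<bar>d f D\<bar> \<le> c" if s: "s > L" for s
  proof -
    have "real s ^ N * \<bar>d f D\<bar> \<le> real (card (Tr s ?O)) * \<bar>d f D\<bar>"
      using Tr_ge[of s] by (intro mult_right_mono) (simp_all flip: of_nat_power)
    also have "\<dots> = \<bar>\<tau> s ?O\<bar>" unfolding \<tau>_O by (simp add: abs_mult)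
    also have "\<dots> \<le> c * real s ^ (N - 1)" by (rule c[OF s])
    finally have "real s ^ N * \<bar>d f D\<bar> \<le> c * real s ^ (N - 1)" .
    then have "real s ^ (N - 1) * (real s * \<bar>d f D\<bar>) \<le> real s ^ (N - 1) * c"
    proof -
      obtain m where "N = Suc m" using N by (cases N) auto
      with \<open>real s ^ N * \<bar>d f D\<bar> \<le> c * real s ^ (N - 1)\<close> show ?thesis by (simp add: mult_ac)
    qed
    then show ?thesis using s by (subst (asm) mult_le_cancel_left_pos) auto
  qed
  note bd = this
  show "d f D = 0"
  proof (rule ccontr)
    assume "d f D \<noteq> 0"
    then obtain s where s: "c < real s * \<bar>d f D\<bar>" using reals_Archimedean3[of "\<bar>d f D\<bar>"] by auto
    have "real s * \<bar>d f D\<bar> \<le> real (s + L + 1) * \<bar>d f D\<bar>" by (intro mult_right_mono) auto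
    then show False using bd[of "s + L + 1"] s by simp
  qed
qed

lemma state_image:
  assumes "inj_on g D" "\<And>x. x \<in> D \<Longrightarrow> f' (g x) = f x" "state A k f D"
  shows "state A k f' (g ` D)"
proof -
  have o: "ones f' (g ` D) = g ` ones f D" using assms(2) by (auto simp: ones_def)
  have "inj_on g (ones f D)" "inj_on g (D - ones f D)"
    using assms(1) ones_subset by (auto intro: inj_on_subset)
  moreover have "g ` D - g ` ones f D = g ` (D - ones f D)"
    using inj_on_image_set_diff[OF assms(1), of D "ones f D"] ones_subset[of f D] by auto
  moreover have "image_mset f' (image_mset g (mset_set (D - ones f D))) = image_mset f (mset_set (D - ones f D))"
    unfolding image_mset.compositionality using assms(2) by (intro image_mset_set_cong) auto
  ultimately show ?thesis
    using assms(3) unfolding state_def o by (simp add: card_image image_mset_mset_set[symmetric])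
qed

text \<open>Ranks serve as integer keys. For \<open>N = 0\<close> the only sample is empty and the
  error bound contains the factor \<open>N\<close>, so it is exactly 0; the \<open>L\<close>
  additional ones satisfy the size condition of that bound.\<close>

lemma balanced_zero:
  assumes bal: "balanced d F N B" and st: "state F N f D"
  shows "d f D = 0"
proof (cases "N = 0")
  case True
  interpret balanced d F N B by fact
  have D: "finite D" using st by (rule stateD)
  obtain L where L: "\<And>l. l \<in># F \<Longrightarrow> l \<le> L" using finite_nat_set_iff_bounded_le[of "set_mset F"] by auto
  have "infinite (UNIV - D)" using D by (simp add: infinite_UNIV_char_0)
  then obtain E where E: "E \<subseteq> UNIV - D" "card E = L" "finite E" by (metis infinite_arbitrarily_large)
  define f' where "f' = (\<lambda>x. if x \<in> D then f x else 1)"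
  have oD: "ones f D = {}" using st D True by (auto simp: state_def)
  have o: "ones f' (D \<union> E) = E" using oD E by (auto simp: ones_def f'_def)
  have k: "D \<union> E - E = D" using E by auto
  have "image_mset f' (mset_set D) = image_mset f (mset_set D)"
    by (intro image_mset_set_cong) (auto simp: f'_def)
  then have "state F L f' (D \<union> E)"
    unfolding state_def o k using D E stateD(3)[OF st] oD by simp
  from balanced_sample_le[OF bal this L order_refl] have "(\<Sum>S\<in>subs E N. d f' (S \<union> D)) = 0"
    unfolding o k using True by simp
  moreover have "subs E N = {{}}" using True E by (auto simp: subs_def dest: finite_subset)
  ultimately have "d f' D = 0" by simp
  then show ?thesis using order_invariant_cong[OF inv D, of f' f] by (simp add: f'_def)
next
  case False
  interpret balanced d F N B by fact
  have D: "finite D" using st by (rule stateD)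
  define g where "g = (\<lambda>x. real (card {y \<in> D. y < x}))"
  have mono: "strict_mono_on D g"
  proof (rule strict_mono_onI)
    fix x y assume xy: "x \<in> D" "y \<in> D" "x < y"
    then have "{z \<in> D. z < x} \<subset> {z \<in> D. z < y}" by auto
    then show "g x < g y" unfolding g_def using D by (auto intro!: psubset_card_mono)
  qed
  have inj: "inj_on g D" using mono by (rule strict_mono_on_imp_inj_on)
  define f' where "f' = f \<circ> inv_into D g"
  have f': "f' (g x) = f x" if "x \<in> D" for x using that inj by (simp add: f'_def)
  have "d f' (g ` D) = 0"
    using False state_image[OF inj f' st]
    by (intro balanced_zero_Ints[OF bal]) (auto simp: g_def)
  moreover have "d f' (g ` D) = d f D" by (rule order_invariantD[OF inv D mono]) (rule f')
  ultimately show ?thesis by simp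
qed

section \<open>Uniqueness for words\<close>

lemma sorted_list_of_set_set:
  fixes xs :: "'a::linorder list"
  assumes "sorted_wrt (<) xs" "set xs = X"
  shows "sorted_list_of_set X = xs"
  using assms by (metis sorted_list_of_set.idem_if_sorted_distinct strict_sorted_iff)

lemma word_front:
  assumes "finite D" "\<forall>x\<in>D. a < x"
  shows "word (f(a := l)) (insert a D) = l # word f D"
proof -
  have "sorted_list_of_set (insert a D) = a # sorted_list_of_set D"
    using assms by (intro sorted_list_of_set_set) auto
  moreover have "map (f(a := l)) (sorted_list_of_set D) = map f (sorted_list_of_set D)"
    using assms by auto
  ultimately show ?thesis by (simp add: word_def)
qed

lemma word_back:
  assumes "finite D" "\<forall>x\<in>D. x < b"
  shows "word (f(b := l)) (insert b D) = word f D @ [l]"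
proof -
  have "sorted_list_of_set (insert b D) = sorted_list_of_set D @ [b]"
    using assms by (intro sorted_list_of_set_set) (auto simp: sorted_wrt_append)
  moreover have "map (f(b := l)) (sorted_list_of_set D) = map f (sorted_list_of_set D)"
    using assms by auto
  ultimately show ?thesis by (simp add: word_def)
qed

lemma nth_strict_sorted_iff:
  fixes xs :: "'a::linorder list"
  assumes "sorted_wrt (<) xs" "i < length xs" "j < length xs"
  shows "xs ! i < xs ! j \<longleftrightarrow> i < j"
proof
  assume *: "xs ! i < xs ! j"
  show "i < j"
  proof (rule ccontr)
    assume "\<not> i < j"
    then have "j = i \<or> j < i" by auto
    then show False using * sorted_wrt_nth_less[OF assms(1), of j i] assms by auto
  qed
qed (use assms sorted_wrt_nth_less in blast)

lemma order_invariant_map_eq: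
  assumes h: "order_invariant h" and xs: "sorted_wrt (<) xs" and ys: "sorted_wrt (<) ys"
    and eq: "map f xs = map f' ys"
  shows "h f (set xs) = h f' (set ys)"
proof -
  have len: "length xs = length ys" using eq by (metis length_map)
  have inj: "x = y" if "xs ! x = xs ! y" "x < length xs" "y < length xs" for x y
    using that nth_strict_sorted_iff[OF xs] by (metis linorder_neqE_nat less_irrefl)
  define g where "g = (\<lambda>x. ys ! (THE i. i < length xs \<and> xs ! i = x))"
  have g: "g (xs ! i) = ys ! i" if "i < length xs" for i
  proof -
    have "(THE j. j < length xs \<and> xs ! j = xs ! i) = i"
      by (rule the_equality) (use that inj in blast)+
    then show ?thesis by (simp add: g_def)
  qed
  have mono: "strict_mono_on (set xs) g"
  proof (rule strict_mono_onI)
    fix x y assume "x \<in> set xs" "y \<in> set xs" and xy: "x < y"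
    then obtain i j where ij: "i < length xs" "x = xs ! i" "j < length xs" "y = xs ! j"
      by (metis in_set_conv_nth)
    then have "i < j" using nth_strict_sorted_iff[OF xs ij(1,3)] xy by simp
    then show "g x < g y" using g ij len nth_strict_sorted_iff[OF ys, of i j] by simp
  qed
  have "map g xs = ys" using len g by (intro nth_equalityI) auto
  then have img: "g ` set xs = set ys" by (metis list.set_map)
  have "f' (g x) = f x" if x: "x \<in> set xs" for x
  proof -
    obtain i where i: "i < length xs" "x = xs ! i" using x by (metis in_set_conv_nth)
    have "map f xs ! i = map f' ys ! i" using eq by simp
    then show ?thesis using i g[OF i(1)] len by simp
  qed
  from order_invariantD[where f = f and f' = f', OF h finite_set mono this] show ?thesis unfolding img by simp
qed

lemma order_invariant_word_eq:
  assumes "order_invariant h" "finite D" "finite D'" "word f D = word f' D'"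
  shows "h f D = h f' D'"
  using order_invariant_map_eq[OF assms(1), of "sorted_list_of_set D" "sorted_list_of_set D'" f f'] assms(2-)
  by (simp add: word_def)

lemma mset_word: "mset (word f D) = image_mset f (mset_set D)"
  unfolding word_def mset_map
  by (cases "finite D") (metis mset_set_set distinct_sorted_list_of_set set_sorted_list_of_set, simp)

lemma state_word:
  assumes "finite D"
  shows "state {#x \<in># mset (word f D). x \<noteq> 1#} (count (mset (word f D)) 1) f D"
proof -
  have "{#x \<in># mset (word f D). x \<noteq> 1#} = image_mset f {#x \<in># mset_set D. f x \<noteq> 1#}"
    by (simp only: mset_word filter_mset_image_mset comp_def)
  also have "{#x \<in># mset_set D. f x \<noteq> 1#} = mset_set {x \<in> D. f x \<noteq> 1}"
    using assms by (rule filter_mset_mset_set)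
  also have "{x \<in> D. f x \<noteq> 1} = D - ones f D" by (auto simp: ones_def)
  finally have marks: "image_mset f (mset_set (D - ones f D)) = {#x \<in># mset (word f D). x \<noteq> 1#}" ..
  have "count (mset (word f D)) 1 = (\<Sum>x | x \<in> D \<and> 1 = f x. count (mset_set D) x)"
    using assms by (simp only: mset_word count_image_mset' finite_set_mset_mset_set)
  also have "\<dots> = (\<Sum>x\<in>ones f D. 1)"
    using assms by (intro sum.cong) (auto simp: ones_def)
  finally show ?thesis using assms marks by (simp add: state_def)
qed

lemma fixed_defect_word:
  assumes E: "\<And>c. (\<Sum>i | i < length c \<and> c ! i = l - 1. P (l # take i c @ drop (Suc i) c) - P (c[i := l])) = 0"
    and D: "finite D" "\<forall>x\<in>D. a < x"
  shows "fixed_defect a l (\<lambda>f D. P (word f D)) f D = 0"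
proof -
  let ?xs = "sorted_list_of_set D" and ?c = "word f D"
  have xs: "distinct ?xs" "set ?xs = D" "sorted_wrt (<) ?xs" using D by auto
  have len: "length ?c = length ?xs" by (simp add: word_def)
  have nth: "?c ! i = f (?xs ! i)" if "i < length ?c" for i using that len by (simp add: word_def)
  have "bij_betw ((!) ?xs) {i. i < length ?c \<and> ?c ! i = l - 1} {x. x \<in> D \<and> f x = l - 1}"
  proof (rule bij_betw_imageI)
    show "inj_on ((!) ?xs) {i. i < length ?c \<and> ?c ! i = l - 1}"
      unfolding len using xs(1) by (intro inj_on_nth) auto
    show "(!) ?xs ` {i. i < length ?c \<and> ?c ! i = l - 1} = {x. x \<in> D \<and> f x = l - 1}"
    proof (intro equalityI subsetI)
      fix x assume "x \<in> (!) ?xs ` {i. i < length ?c \<and> ?c ! i = l - 1}"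
      then obtain i where i: "i < length ?c" "?c ! i = l - 1" "x = ?xs ! i" by blast
      have "?xs ! i \<in> set ?xs" by (rule nth_mem) (use i len in simp)
      then show "x \<in> {x. x \<in> D \<and> f x = l - 1}" using i nth xs(2) by auto
    next
      fix x assume x: "x \<in> {x. x \<in> D \<and> f x = l - 1}"
      then obtain i where i: "i < length ?xs" "?xs ! i = x" using xs(2) by (metis (mono_tags) in_set_conv_nth mem_Collect_eq)
      then have "i < length ?c" "?c ! i = l - 1" using x nth[of i] len by auto
      then show "x \<in> (!) ?xs ` {i. i < length ?c \<and> ?c ! i = l - 1}" using i(2) by blast
    qed
  qed
  then have "fixed_defect a l (\<lambda>f D. P (word f D)) f D = (\<Sum>i | i < length ?c \<and> ?c ! i = l - 1.
      P (word (f(a := l)) (insert a (D - {?xs ! i}))) - P (word (f(?xs ! i := l)) D))"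
    unfolding fixed_defect_def by (rule sum.reindex_bij_betw[symmetric])
  also have "\<dots> = (\<Sum>i | i < length ?c \<and> ?c ! i = l - 1. P (l # take i ?c @ drop (Suc i) ?c) - P (?c[i := l]))"
  proof (intro sum.cong refl)
    fix i assume "i \<in> {i. i < length ?c \<and> ?c ! i = l - 1}"
    then have i: "i < length ?xs" using len by simp
    define x where "x = ?xs ! i"
    have split: "?xs = take i ?xs @ x # drop (Suc i) ?xs" unfolding x_def using i by (rule id_take_nth_drop)
    have s: "sorted_wrt (<) (take i ?xs @ x # drop (Suc i) ?xs)" using xs(3) split by simp
    have d: "distinct (take i ?xs @ x # drop (Suc i) ?xs)" using xs(1) split by simp
    have nx: "x \<notin> set (take i ?xs)" "x \<notin> set (drop (Suc i) ?xs)" using d by auto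
    have "D = insert x (set (take i ?xs) \<union> set (drop (Suc i) ?xs))"
      using arg_cong[OF split, of set] xs(2) by auto
    then have "D - {x} = set (take i ?xs @ drop (Suc i) ?xs)" using nx by auto
    moreover have "sorted_wrt (<) (take i ?xs @ drop (Suc i) ?xs)" using s by (auto simp: sorted_wrt_append)
    ultimately have "sorted_list_of_set (D - {x}) = take i ?xs @ drop (Suc i) ?xs"
      by (intro sorted_list_of_set_set) auto
    then have 1: "word f (D - {x}) = take i ?c @ drop (Suc i) ?c"
      by (simp add: word_def take_map drop_map)
    have "map (f(x := l)) ?xs = (map f ?xs)[i := l]"
      using i xs(1) by (intro nth_equalityI) (auto simp: nth_list_update x_def nth_eq_iff_index_eq)
    then have 2: "word (f(x := l)) D = ?c[i := l]" by (simp add: word_def)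
    have "word (f(a := l)) (insert a (D - {x})) = l # take i ?c @ drop (Suc i) ?c"
      unfolding 1[symmetric] using D by (intro word_front) auto
    then show "P (word (f(a := l)) (insert a (D - {?xs ! i}))) - P (word (f(?xs ! i := l)) D) =
        P (l # take i ?c @ drop (Suc i) ?c) - P (?c[i := l])"
      using 2 by (simp add: x_def)
  qed
  also have "\<dots> = 0" by (rule E)
  finally show ?thesis .
qed

text \<open>A block of size \<open>l - 1 = 1\<close> is a one in any case. Hence for
  \<open>l = 2\<close> the front relation is one of the given relations and needs no smaller
  case.\<close>

lemma front_defect_2: "front_defect a 2 h f D = fixed_defect a 2 h f D"
proof -
  have "subs (ones f D) (2 - 1) = (\<lambda>x. {x}) ` {x. x \<in> D \<and> f x = 2 - 1}"
    using subs_1[of "ones f D"] by (simp add: ones_def)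
  then show ?thesis
    unfolding front_defect_def fixed_defect_def by (simp add: sum.reindex)
qed

text \<open>Supplies the bound \<open>B\<close> of \<open>balanced\<close>: the number of summands
  is determined by \<open>G\<close> and the number of ones.\<close>

lemma blur_bounded:
  assumes "\<And>w. \<bar>P w\<bar> \<le> 1" "\<And>x. x \<in> set G \<Longrightarrow> x \<ge> 2"
  shows "\<exists>B\<ge>0. \<forall>f D. finite D \<longrightarrow> card (ones f D) = k \<longrightarrow> \<bar>blur (\<lambda>f D. P (word f D)) G f D\<bar> \<le> B"
  using assms(2)
proof (induction G arbitrary: k)
  case Nil
  then show ?case using assms(1) by (intro exI[of _ 1]) simp
next
  case (Cons l G)
  let ?h = "blur (\<lambda>f D. P (word f D)) G"
  from Cons obtain B where B: "B \<ge> 0" "\<And>f D. finite D \<Longrightarrow> card (ones f D) = k - l \<Longrightarrow> \<bar>?h f D\<bar> \<le> B"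
    by (metis list.set_intros(2))
  have "\<bar>gather l ?h f D\<bar> \<le> (k choose l) * B" if D: "finite D" "card (ones f D) = k" for f D
  proof -
    have "\<bar>gather l ?h f D\<bar> \<le> (\<Sum>R\<in>subs (ones f D) l. B)"
      unfolding gather_def
    proof (rule order_trans[OF sum_abs sum_mono], rule B(2))
      fix R assume R: "R \<in> subs (ones f D) l"
      show "finite (D - (R - {Min R}))" using D by simp
      have "ones (f(Min R := l)) (D - (R - {Min R})) = ones f D - R"
        using D R Cons.prems[of l] by (intro ones_gathered) auto
      then show "card (ones (f(Min R := l)) (D - (R - {Min R}))) = k - l"
        using D subsD[OF R] by (simp add: card_Diff_subset)
    qed
    then show ?thesis using D by (simp add: card_subs)
  qed
  then show ?case using B(1) by (intro exI[of _ "(k choose l) * B"]) auto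
qed

lemma state_replace_mark:
  assumes "state A k f D" "i \<in> D" "f i \<noteq> 1" "l \<noteq> 1"
  shows "state (add_mset l (A - {#f i#})) k (f(i := l)) D"
proof -
  have "state (add_mset l (A - {#f i#})) k (f(i := l)) (insert i (D - {i}))"
    using state_remove_mark[OF assms(1-3)] assms(4) by (intro state_add_mark) auto
  then show ?thesis using assms(2) by (simp add: insert_absorb)
qed

text \<open>With one more block of size \<open>l - 1\<close> hidden, the relation for
  \<open>l\<close> consists of a visible part and a positive multiple of the wanted front defect. In
  the visible part every state has a mark \<open>l - 1\<close> replaced by \<open>l\<close>; by
  \<open>C\<close> they all share one value and cancel. Without a visible mark of size
  \<open>l - 1\<close> that part is empty.\<close>

lemma front_defect_blur_zero:
  assumes h: "order_invariant h" and base: "\<And>l f D. l \<ge> 2 \<Longrightarrow> finite D \<Longrightarrow> \<forall>x\<in>D. a < x \<Longrightarrow> fixed_defect a l h f D = 0"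
    and G: "\<And>x. x \<in> set G \<Longrightarrow> x \<ge> 2" and l: "l \<ge> 2" and st: "state A k f D" and a: "\<forall>x\<in>D. a < x"
    and C: "\<And>f D. l - 1 \<in># A \<Longrightarrow> l \<ge> 3 \<Longrightarrow> state (add_mset l (A - {#l - 1#})) k f D \<Longrightarrow> blur h ((l - 1) # G) f D = C"
  shows "front_defect a l (blur h G) f D = 0"
proof -
  have D: "finite D" using st by (rule stateD)
  show ?thesis
  proof (cases "l = 2")
    case True
    show ?thesis unfolding True
      by (rule front_defect_blur) (use base G D a in \<open>auto simp: front_defect_2\<close>)
  next
    case False
    then have l3: "l \<ge> 3" using l by simp
    have "fixed_defect a l (blur h ((l - 1) # G)) f D = 0"
      unfolding fixed_defect_def
    proof (rule sum.neutral, rule ballI)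
      fix i assume i: "i \<in> {i. i \<in> D \<and> f i = l - 1}"
      then have i': "i \<in> D" "f i \<noteq> 1" "f i = l - 1" using l3 by auto
      have A: "l - 1 \<in># A" using state_remove_mark(2)[OF st i'(1,2)] i'(3) by simp
      have "state (A - {#l - 1#}) k f (D - {i})" using state_remove_mark(1)[OF st i'(1,2)] i'(3) by simp
      then have "state (add_mset l (A - {#l - 1#})) k (f(a := l)) (insert a (D - {i}))"
        using a l by (intro state_add_mark) auto
      moreover have "state (add_mset l (A - {#l - 1#})) k (f(i := l)) D"
        using state_replace_mark[OF st i'(1,2), of l] i'(3) l by simp
      ultimately show "blur h ((l - 1) # G) (f(a := l)) (insert a (D - {i})) - blur h ((l - 1) # G) (f(i := l)) D = 0"
        using C[OF A l3] by simp
    qed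
    moreover have "fixed_defect a l (blur h ((l - 1) # G)) f D +
        count (mset ((l - 1) # G)) (l - 1) * front_defect a l (blur h (remove1 (l - 1) ((l - 1) # G))) f D = 0"
      using l3 G D a by (intro fixed_defect_blur[OF h]) (auto intro: base)
    moreover have "real (count (mset ((l - 1) # G)) (l - 1)) \<noteq> 0" by simp
    ultimately show ?thesis by simp
  qed
qed

lemma words_uniform:
  fixes P :: "nat list \<Rightarrow> real" and lam :: "nat multiset"
  assumes P1: "\<And>w. \<bar>P w\<bar> \<le> 1" and lam0: "0 \<notin># lam"
    and R: "\<And>c. P (1 # c) = P (c @ [1])"
    and E: "\<And>l c. l \<ge> 2 \<Longrightarrow>
      (\<Sum>i | i < length c \<and> c ! i = l - 1. P (l # take i c @ drop (Suc i) c) - P (c[i := l])) = 0"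
  shows "\<exists>C. \<forall>w. mset w = lam \<longrightarrow> P w = C"
proof -
  define h where "h = (\<lambda>f D. P (word f D))"
  have h: "order_invariant h" unfolding h_def by (rule order_invariant_word)
  have fixed: "fixed_defect a l h f D = 0" if "l \<ge> 2" "finite D" "\<forall>x\<in>D. a < x" for a l f D
    unfolding h_def using that E by (intro fixed_defect_word)
  have rot: "rot_defect a b h f D = 0" if "finite D" "\<forall>x\<in>D. a < x \<and> x < b" for a b f D
    unfolding rot_defect_def h_def using that word_front[of D a f 1] word_back[of D b f 1] R by simp
  define \<Lambda> where "\<Lambda> = {#x \<in># lam. x \<noteq> 1#}"
  define a0 where "a0 = count lam 1"
  have \<Lambda>2: "l \<ge> 2" if "l \<in># \<Lambda>" for l
  proof -
    have "l \<noteq> 0" "l \<noteq> 1" using that lam0 unfolding \<Lambda>_def by (auto intro!: gr0I)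
    then show ?thesis by simp
  qed
  obtain K where K: "\<And>l. l \<in># \<Lambda> \<Longrightarrow> l < K" using finite_nat_set_iff_bounded[of "set_mset \<Lambda>"] by auto
  define N where "N = (\<lambda>A. a0 + sum_mset A)"
  \<comment> \<open>Up to the constant factor \<open>a0!\<close>, the number of ways to form
    distinguishable blocks of the sizes in \<open>A\<close> out of \<open>N A\<close> ones, that is,
    the number of values of \<open>P\<close> that a dissolved state adds up. The recursion
    \<open>\<kappa>_add\<close> mirrors \<open>gather\<close>.\<close>
  define \<kappa> where "\<kappa> = (\<lambda>A. fact (N A) / real (prod_mset (image_mset fact A)))"
  define G0 where "G0 = (SOME G. mset G = \<Lambda>)"
  have G0: "mset G0 = \<Lambda>" unfolding G0_def using ex_mset[of \<Lambda>] by (rule someI_ex)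
  \<comment> \<open>Normalised by the case in which all blocks of size at least 2 are hidden and
    only a word of ones is left.\<close>
  define c where "c = blur h G0 (\<lambda>_. 1) (real ` {..<N \<Lambda>}) / \<kappa> \<Lambda>"
  have \<kappa>: "\<kappa> A \<noteq> 0" for A
    by (induction A) (auto simp: \<kappa>_def)
  have \<kappa>_add: "\<kappa> (add_mset l A) = \<kappa> A * (N A + l choose l)" for l A
  proof -
    have "fact (N A + l) = (fact l * fact (N A) * (N A + l choose l) :: real)"
      using binomial_fact_lemma[of l "N A + l"] by (metis add_diff_cancel_right' le_add2 of_nat_fact of_nat_mult)
    moreover have "N (add_mset l A) = N A + l" by (simp add: N_def)
    ultimately show ?thesis by (simp add: \<kappa>_def mult_ac)
  qed
  \<comment> \<open>Every visible mark \<open>l\<close> has the positive weight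
    \<open>K - l\<close>, so dissolving it and enlarging it by 1 both lower the total.\<close>
  let ?W = "\<lambda>A. sum_mset (image_mset (\<lambda>l. K - l) (\<Lambda> - A))"
  have claim: "blur h G f D = c * \<kappa> (mset G)"
    if "mset G \<subseteq># \<Lambda>" "state (\<Lambda> - mset G) (N (mset G)) f D" for G f D
    using that
  proof (induction "?W (mset G)" arbitrary: G f D rule: less_induct)
    case less
    define F where "F = \<Lambda> - mset G"
    have \<Lambda>: "\<Lambda> = mset G + F" using less.prems(1) by (simp add: F_def)
    have G2: "x \<ge> 2" if "x \<in> set G" for x using \<Lambda>2 that \<Lambda> by simp
    have F2: "x \<ge> 2" "x < K" if "x \<in># F" for x using \<Lambda>2 K that \<Lambda> by auto
    have IH: "blur h G' f D = c * \<kappa> (mset G')"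
      if "mset G' + F' = \<Lambda>" "sum_mset (image_mset (\<lambda>l. K - l) F') < sum_mset (image_mset (\<lambda>l. K - l) F)"
        "state F' (N (mset G')) f D" for G' F' f D
    proof -
      have "F' = \<Lambda> - mset G'" "mset G' \<subseteq># \<Lambda>" using that(1) by auto
      then show ?thesis using that(2,3) by (intro less.hyps) (auto simp: F_def)
    qed
    have inv: "order_invariant (blur h G)" using order_invariant_blur[OF h] G2 by simp
    show ?case
    proof (cases "F = {#}")
      case True
      have \<Lambda>G: "\<Lambda> = mset G" using \<Lambda> True by simp
      have st: "state {#} (N \<Lambda>) f D"
        using less.prems(2) unfolding \<Lambda>G[symmetric] by simp
      have D: "finite D" "card (ones f D) = N \<Lambda>" "mset_set (D - ones f D) = {#}" using stateD[OF st] by auto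
      then have "D - ones f D = {}" by (metis finite_Diff mset_set_empty_iff)
      then have DO: "D = ones f D" using ones_subset[of f D] by blast
      have "word f D = replicate (N \<Lambda>) 1"
      proof -
        have "f x = 1" if "x \<in> D" for x using that DO unfolding ones_def by blast
        then have "\<forall>x\<in>set (sorted_list_of_set D). f x = 1" using D(1) by simp
        moreover have "length (sorted_list_of_set D) = N \<Lambda>" using D(1,2) DO by simp
        ultimately show ?thesis unfolding word_def by (intro replicate_eqI) auto
      qed
      moreover have "word (\<lambda>_. 1) (real ` {..<N \<Lambda>}) = replicate (N \<Lambda>) 1"
        unfolding word_def map_replicate_const by (simp add: card_image)
      ultimately have "blur h G f D = blur h G (\<lambda>_. 1) (real ` {..<N \<Lambda>})"
        using D(1) by (intro order_invariant_word_eq[OF inv]) auto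
      also have "\<dots> = blur h G0 (\<lambda>_. 1) (real ` {..<N \<Lambda>})"
        using G0 \<Lambda>G G2 by (intro blur_perm) auto
      finally show ?thesis using \<kappa>[of \<Lambda>] unfolding c_def \<Lambda>G[symmetric] by simp
    next
      case False
      let ?C = "c * \<kappa> (mset G)" and ?N = "N (mset G)"
      let ?d = "\<lambda>f D. blur h G f D - ?C"
      obtain B where B: "B \<ge> 0" "\<And>f D. finite D \<Longrightarrow> card (ones f D) = ?N \<Longrightarrow> \<bar>blur h G f D\<bar> \<le> B"
        using blur_bounded[of P G ?N] P1 G2 unfolding h_def by metis
      have "balanced ?d F ?N (B + \<bar>?C\<bar>)"
      proof
        show "order_invariant ?d" using inv unfolding order_invariant_def by simp
        show "F \<noteq> {#}" by fact
        show "l \<ge> 2" if "l \<in># F" for l using F2(1)[OF that] .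
        show "0 \<le> B + \<bar>?C\<bar>" using B by simp
        show "\<bar>blur h G f D - ?C\<bar> \<le> B + \<bar>?C\<bar>" if "state F ?N f D" for f D
          using B(2)[OF stateD(1,2)[OF that]] by linarith
        fix a b f D
        assume st: "state F (?N - 1) f D" and N1: "?N \<ge> 1" and ab: "\<forall>x\<in>D. a < x \<and> x < b"
        have D: "finite D" using st by (rule stateD)
        have "rot_defect a b (blur h G) f D = (\<Sum>l\<leftarrow>G. front_defect a l (blur h (remove1 l G)) f D)"
          using D ab G2 rot by (intro rot_defect_blur[OF h]) auto
        also have "\<dots> = (\<Sum>l\<leftarrow>G. 0)"
        proof (intro arg_cong[where f = sum_list] map_cong refl)
          fix l assume l: "l \<in> set G"
          have l2: "l \<ge> 2" using G2[OF l] .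
          obtain A where A: "mset G = add_mset l A" using l by (metis mset_add set_mset_mset)
          then have mr: "mset (remove1 l G) = A" by simp
          show "front_defect a l (blur h (remove1 l G)) f D = 0"
          proof (rule front_defect_blur_zero[OF h fixed _ l2 st, where C = "c * \<kappa> (mset ((l - 1) # remove1 l G))"])
            show "x \<ge> 2" if "x \<in> set (remove1 l G)" for x using that G2 notin_set_remove1 by fastforce
            show "\<forall>x\<in>D. a < x" using ab by simp
            fix f D assume m: "l - 1 \<in># F" and l3: "l \<ge> 3"
              and st': "state (add_mset l (F - {#l - 1#})) (?N - 1) f D"
            obtain F0 where F0: "F = add_mset (l - 1) F0" using m by (metis mset_add)
            \<comment> \<open>The hidden \<open>l\<close> and a visible \<open>l - 1\<close>
              exchange sizes, which preserves the whole multiset. The hidden elements become one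
              fewer, in agreement with \<open>?N - 1\<close>, and the weight drops by 1.\<close>
            show "blur h ((l - 1) # remove1 l G) f D = c * \<kappa> (mset ((l - 1) # remove1 l G))"
            proof (rule IH)
              show "mset ((l - 1) # remove1 l G) + add_mset l F0 = \<Lambda>"
                unfolding \<Lambda> A F0 mset.simps mr by simp
              have "K - l < K - (l - 1)" using F2(2)[OF m] l3 by simp
              then show "sum_mset (image_mset (\<lambda>l. K - l) (add_mset l F0)) <
                  sum_mset (image_mset (\<lambda>l. K - l) F)"
                unfolding F0 by simp
              have "?N - 1 = N (mset ((l - 1) # remove1 l G))"
                unfolding N_def A mset.simps mr using l3 by simp
              then show "state (add_mset l F0) (N (mset ((l - 1) # remove1 l G))) f D"
                using st' F0 by simp
            qed
          qed auto
        qed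
        finally show "rot_defect a b ?d f D = 0" by (simp add: rot_defect_def)
      next
        fix a l f D
        assume l: "l \<in># F" and st: "state (F - {#l#}) (?N + (l - 1)) f D" and a: "\<forall>x\<in>D. a < x"
        have l2: "l \<ge> 2" using F2(1)[OF l] .
        have "front_defect a l (blur h G) f D = 0"
        proof (rule front_defect_blur_zero[OF h fixed G2 l2 st a, where C = "c * \<kappa> (mset ((l - 1) # G))"])
          fix f D assume m: "l - 1 \<in># F - {#l#}" and l3: "l \<ge> 3"
            and st': "state (add_mset l (F - {#l#} - {#l - 1#})) (?N + (l - 1)) f D"
          have m': "l - 1 \<in># F" using m by (rule in_diffD)
          obtain F0 where F0: "F - {#l#} = add_mset (l - 1) F0" using m by (metis mset_add)
          have F1: "F = add_mset l (add_mset (l - 1) F0)" using l F0 by (metis insert_DiffM)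
          \<comment> \<open>Both \<open>l\<close> and \<open>l - 1\<close> are visible in
            \<open>F\<close>. In the states concerned a single mark \<open>l\<close> remains of the
            two and the \<open>l - 1\<close> is hidden, which saves the weight
            \<open>K - (l - 1)\<close>.\<close>
          show "blur h ((l - 1) # G) f D = c * \<kappa> (mset ((l - 1) # G))"
          proof (rule IH)
            show "mset ((l - 1) # G) + add_mset l F0 = \<Lambda>"
              unfolding \<Lambda> F1 by simp
            have "0 < K - (l - 1)" using F2(2)[OF m'] by simp
            then show "sum_mset (image_mset (\<lambda>l. K - l) (add_mset l F0)) < sum_mset (image_mset (\<lambda>l. K - l) F)"
              unfolding F1 by simp
            have "?N + (l - 1) = N (mset ((l - 1) # G))" unfolding N_def by simp
            then show "state (add_mset l F0) (N (mset ((l - 1) # G))) f D"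
              using st' F0 by simp
          qed
        qed
        then show "front_defect a l ?d f D = 0" by (simp add: front_defect_def)
      next
        fix l f D
        assume l: "l \<in># F" and st: "state (F - {#l#}) (?N + l) f D"
        obtain F0 where F0: "F = add_mset l F0" using l by (metis mset_add)
        have D: "finite (ones f D)" "card (ones f D) = ?N + l" using stateD[OF st] by auto
        \<comment> \<open>Hiding \<open>l\<close> lowers the weight, so this value is known. By
          \<open>\<kappa>_add\<close> it is \<open>?C\<close> times the number of
          \<open>l\<close>-subsets, and hence the deviations add up to 0.\<close>
        have "blur h (l # G) f D = c * \<kappa> (mset (l # G))"
        proof (rule IH)
          show "mset (l # G) + F0 = \<Lambda>" unfolding \<Lambda> F0 by simp
          have "0 < K - l" using F2(2)[OF l] by simp
          then show "sum_mset (image_mset (\<lambda>l. K - l) F0) < sum_mset (image_mset (\<lambda>l. K - l) F)"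
            unfolding F0 by simp
          have "?N + l = N (mset (l # G))" unfolding N_def by simp
          then show "state F0 (N (mset (l # G))) f D" using st F0 by simp
        qed
        moreover have "gather l ?d f D = gather l (blur h G) f D - (?N + l choose l) * ?C"
          unfolding gather_def sum_subtractf using D by (simp add: card_subs)
        ultimately show "gather l ?d f D = 0" by (simp add: \<kappa>_add)
      qed
      from balanced_zero[OF this, of f D] show ?thesis using less.prems(2) by (simp add: F_def)
    qed
  qed
  have "P w = c * \<kappa> {#}" if w: "mset w = lam" for w
  proof -
    define f where "f = (\<lambda>x::real. w ! nat \<lfloor>x\<rfloor>)"
    let ?D = "real ` {..<length w}"
    have "sorted_list_of_set ?D = map real [0..<length w]"
      by (intro sorted_list_of_set_set) (auto simp: sorted_wrt_map atLeast_upt)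
    then have word: "word f ?D = w" unfolding word_def f_def by (simp add: comp_def map_nth)
    have "state \<Lambda> a0 f ?D" using state_word[of ?D f] unfolding word w \<Lambda>_def a0_def by simp
    then show ?thesis using claim[of "[]" f ?D] word by (simp add: h_def N_def)
  qed
  then show ?thesis by blast
qed

section \<open>Deleting the first and the last element\<close>

text \<open>The choice \<open>B = {}\<close> stands for \<open>j\<close> as a singleton block, so
  one formula covers both kinds of insertion.\<close>

lemma partition_on_remove_point:
  assumes \<sigma>: "partition_on A \<sigma>" and j: "j \<notin> A"
  shows "{\<pi>. partition_on (insert j A) \<pi> \<and> (\<lambda>B. B - {j}) ` \<pi> - {{}} = \<sigma>} =
    (\<lambda>B. insert (insert j B) (\<sigma> - {B})) ` insert {} \<sigma>"
    and "inj_on (\<lambda>B. insert (insert j B) (\<sigma> - {B})) (insert {} \<sigma>)"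
proof -
  have nj: "j \<notin> B" if "B \<in> insert {} \<sigma>" for B using that \<sigma> j unfolding partition_on_def by auto
  have ne: "{} \<notin> \<sigma>" and un: "\<Union>\<sigma> = A" and dj: "\<And>B C. B \<in> \<sigma> \<Longrightarrow> C \<in> \<sigma> \<Longrightarrow> B \<noteq> C \<Longrightarrow> B \<inter> C = {}"
    using \<sigma> unfolding partition_on_def disjoint_def by auto
  show "inj_on (\<lambda>B. insert (insert j B) (\<sigma> - {B})) (insert {} \<sigma>)"
  proof (rule inj_onI)
    fix B C assume BC: "B \<in> insert {} \<sigma>" "C \<in> insert {} \<sigma>"
      and eq: "insert (insert j B) (\<sigma> - {B}) = insert (insert j C) (\<sigma> - {C})"
    have "insert j B \<notin> \<sigma>" using nj by auto
    then have "insert j B = insert j C" using eq by auto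
    then show "B = C" using nj[OF BC(1)] nj[OF BC(2)] by (metis insert_ident)
  qed
  show "{\<pi>. partition_on (insert j A) \<pi> \<and> (\<lambda>B. B - {j}) ` \<pi> - {{}} = \<sigma>} =
    (\<lambda>B. insert (insert j B) (\<sigma> - {B})) ` insert {} \<sigma>"
  proof (intro equalityI subsetI)
    fix \<pi> assume "\<pi> \<in> {\<pi>. partition_on (insert j A) \<pi> \<and> (\<lambda>B. B - {j}) ` \<pi> - {{}} = \<sigma>}"
    then have p: "partition_on (insert j A) \<pi>" and eq: "(\<lambda>B. B - {j}) ` \<pi> - {{}} = \<sigma>" by auto
    have pne: "{} \<notin> \<pi>" and pdj: "\<And>B C. B \<in> \<pi> \<Longrightarrow> C \<in> \<pi> \<Longrightarrow> B \<noteq> C \<Longrightarrow> B \<inter> C = {}"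
      using p unfolding partition_on_def disjoint_def by auto
    have "j \<in> \<Union>\<pi>" using p unfolding partition_on_def by auto
    then obtain C where C: "C \<in> \<pi>" "j \<in> C" by auto
    define B where "B = C - {j}"
    have jn: "j \<notin> E" if "E \<in> \<pi> - {C}" for E using pdj[of E C] that C by auto
    have "(\<lambda>E. E - {j}) ` \<pi> = insert B ((\<lambda>E. E - {j}) ` (\<pi> - {C}))"
      unfolding B_def using C(1) by auto
    also have "(\<lambda>E. E - {j}) ` (\<pi> - {C}) = (\<lambda>E. E) ` (\<pi> - {C})"
      using jn by (intro image_cong) auto
    finally have \<sigma>_eq: "\<sigma> = insert B (\<pi> - {C}) - {{}}" using eq by simp
    have BC: "insert j B = C" using C by (auto simp: B_def)
    have "B \<notin> \<pi> - {C}"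
    proof
      assume B: "B \<in> \<pi> - {C}"
      then have "B \<inter> C = {}" using pdj C by auto
      then have "B = {}" by (auto simp: B_def)
      then show False using B pne by simp
    qed
    then have "\<sigma> - {B} = \<pi> - {C}" using \<sigma>_eq pne by auto
    then have "\<pi> = insert (insert j B) (\<sigma> - {B})" using C BC by auto
    moreover have "B \<in> insert {} \<sigma>" using \<sigma>_eq by auto
    ultimately show "\<pi> \<in> (\<lambda>B. insert (insert j B) (\<sigma> - {B})) ` insert {} \<sigma>" by blast
  next
    fix \<pi> assume "\<pi> \<in> (\<lambda>B. insert (insert j B) (\<sigma> - {B})) ` insert {} \<sigma>"
    then obtain B where B: "B \<in> insert {} \<sigma>" "\<pi> = insert (insert j B) (\<sigma> - {B})" by auto
    have "\<Union>\<pi> = insert j A" using B un by auto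
    moreover have "disjoint \<pi>"
    proof (rule disjointI)
      fix C D assume CD: "C \<in> \<pi>" "D \<in> \<pi>" "C \<noteq> D"
      have "insert j B \<inter> E = {}" if "E \<in> \<sigma> - {B}" for E
        using that B(1) nj[of E] dj[of B E] by auto
      then show "C \<inter> D = {}" using CD B(2) dj by blast
    qed
    moreover have "{} \<notin> \<pi>" using B ne by auto
    ultimately have "partition_on (insert j A) \<pi>" unfolding partition_on_def by auto
    moreover have "(\<lambda>E. E - {j}) ` \<pi> = insert B ((\<lambda>E. E) ` (\<sigma> - {B}))"
    proof -
      have "insert j B - {j} = B" using nj[OF B(1)] by auto
      moreover have "(\<lambda>E. E - {j}) ` (\<sigma> - {B}) = (\<lambda>E. E) ` (\<sigma> - {B})"
        using nj by (intro image_cong) auto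
      ultimately show ?thesis unfolding B(2) by simp
    qed
    moreover have "insert B (\<sigma> - {B}) - {{}} = \<sigma>" using B(1) ne by auto
    ultimately show "\<pi> \<in> {\<pi>. partition_on (insert j A) \<pi> \<and> (\<lambda>B. B - {j}) ` \<pi> - {{}} = \<sigma>}" by simp
  qed
qed

lemma delete_last_eq:
  assumes "\<pi> \<in> set_partitions n"
  shows "delete_element n \<pi> = (\<lambda>B. B - {n}) ` \<pi> - {{}}"
proof -
  have "(\<lambda>i. if i < n then i else i - 1) ` (B - {n}) = B - {n}" if "B \<in> \<pi>" for B
  proof -
    have "B \<subseteq> {1..n}" using assms that unfolding set_partitions_def partition_on_def by auto
    then have "(\<lambda>i. if i < n then i else i - 1) ` (B - {n}) = (\<lambda>i. i) ` (B - {n})"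
      by (intro image_cong) auto
    then show ?thesis by simp
  qed
  then show ?thesis unfolding delete_element_def by (intro arg_cong2[where f = "(-)"] image_cong refl)
qed

text \<open>Shifting the target upwards replaces the relabelling, so that
  \<open>partition_on_remove_point\<close> applies as it does at the other end.\<close>

lemma delete_first_eq_iff:
  assumes "\<pi> \<in> set_partitions n"
  shows "delete_element 1 \<pi> = \<rho> \<longleftrightarrow> (\<lambda>B. B - {1}) ` \<pi> - {{}} = (`) Suc ` \<rho>"
proof -
  have inj: "inj ((`) Suc)" by (auto intro!: injI simp: inj_image_eq_iff)
  have *: "Suc ` ((\<lambda>i. if i < 1 then i else i - 1) ` (B - {1})) = B - {1}" if "B \<in> \<pi>" for B
  proof -
    have "B \<subseteq> {1..n}" using assms that unfolding set_partitions_def partition_on_def by auto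
    then have "(\<lambda>i. Suc (if i < 1 then i else i - 1)) ` (B - {1}) = (\<lambda>i. i) ` (B - {1})"
      by (intro image_cong) auto
    then show ?thesis by (simp only: image_image image_ident)
  qed
  have "(`) Suc ` delete_element 1 \<pi> =
      (\<lambda>B. Suc ` ((\<lambda>i. if i < 1 then i else i - 1) ` (B - {1}))) ` \<pi> - {{}}"
    unfolding delete_element_def by (subst image_set_diff[OF inj]) (simp add: image_image)
  also have "\<dots> = (\<lambda>B. B - {1}) ` \<pi> - {{}}"
    using * by (intro arg_cong2[where f = "(-)"] image_cong refl)
  finally show ?thesis using inj by (metis inj_image_eq_iff)
qed

text \<open>Consecutive intervals of the prescribed lengths form such a partition.\<close>

lemma composition_realised:
  assumes "0 \<notin> set c"
  shows "\<exists>Bs. set Bs \<in> set_partitions (sum_list c) \<and> sorted (map Min Bs) \<and> distinct Bs \<and> map card Bs = c"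
  using assms
proof (induction c rule: rev_induct)
  case Nil
  then show ?case by (intro exI[of _ "[]"]) (simp add: set_partitions_def partition_on_def)
next
  case (snoc k c)
  let ?s = "sum_list c" and ?C = "{Suc (sum_list c)..sum_list c + k}"
  obtain Bs where Bs: "partition_on {1..?s} (set Bs)" "sorted (map Min Bs)" "distinct Bs" "map card Bs = c"
    using snoc by (auto simp: set_partitions_def)
  have k: "k > 0" using snoc.prems by simp
  have C: "?C \<noteq> {}" "Min ?C = Suc ?s" using k by (auto intro!: Min_eqI)
  have sub: "B \<subseteq> {1..?s}" "B \<noteq> {}" if "B \<in> set Bs" for B
    using that Bs(1) unfolding partition_on_def by auto
  have nC: "?C \<notin> set Bs" using sub k by fastforce
  have "{1..?s + k} - ?C = {1..?s}" "?C \<subseteq> {1..?s + k}" by auto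
  moreover have "disjnt ?C (\<Union> (set Bs))" using Bs(1) unfolding partition_on_def disjnt_def by auto
  ultimately have "partition_on {1..?s + k} (insert ?C (set Bs))"
    using C(1) Bs(1) by (subst partition_on_insert) auto
  moreover have "Min B \<le> Suc ?s" if "B \<in> set Bs" for B
  proof -
    have "Min B \<in> B" using sub[OF that] finite_subset by (intro Min_in) auto
    then show ?thesis using sub[OF that] by auto
  qed
  ultimately show ?case
    using Bs C nC by (intro exI[of _ "Bs @ [?C]"])
      (auto simp: set_partitions_def sorted_append simp del: Min.insert)
qed

text \<open>The element \<open>n\<close> is larger than all others, so joining a block changes
  neither its minimum nor the order of the blocks.\<close>

lemma sum_shapes_delete_last:
  assumes n: "n \<ge> 1" and Bs: "set Bs \<in> set_partitions (n - 1)" "sorted (map Min Bs)" "distinct Bs"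
    and c: "map card Bs = c"
  shows "(\<Sum>\<pi> | \<pi> \<in> set_partitions n \<and> delete_element n \<pi> = set Bs. P (shape \<pi>)) =
    P (c @ [1]) + (\<Sum>i<length c. P (c[i := Suc (c ! i)]))"
proof -
  have p: "partition_on {1..n - 1} (set Bs)" using Bs(1) by (simp add: set_partitions_def)
  have sub: "B \<subseteq> {1..n - 1}" "B \<noteq> {}" "finite B" if "B \<in> set Bs" for B
    using that p finite_subset[of B "{1..n - 1}"] unfolding partition_on_def by auto
  have n1: "insert n {1..n - 1} = {1..n}" "n \<notin> {1..n - 1}" using n by auto
  let ?\<phi> = "\<lambda>B. insert (insert n B) (set Bs - {B})"
  note rp = partition_on_remove_point[OF p n1(2), unfolded n1(1)]
  have T: "{\<pi>. \<pi> \<in> set_partitions n \<and> delete_element n \<pi> = set Bs} = ?\<phi> ` insert {} (set Bs)"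
  proof -
    have "delete_element n \<pi> = (\<lambda>B. B - {n}) ` \<pi> - {{}}" if "partition_on {1..n} \<pi>" for \<pi>
      using that by (intro delete_last_eq) (simp add: set_partitions_def)
    then show ?thesis
      unfolding rp(1)[symmetric] set_partitions_def mem_Collect_eq by (intro Collect_cong conj_cong refl) simp
  qed
  then have img: "?\<phi> B \<in> set_partitions n" if "B \<in> insert {} (set Bs)" for B using that by blast
  have ne: "{} \<notin> set Bs" using sub by auto
  have Min_less: "Min B \<le> n" if "B \<in> set Bs" for B
    using sub[OF that] Min_in[of B] by fastforce
  have "shape (?\<phi> {}) = c @ [1]"
  proof -
    have "?\<phi> {} = set (Bs @ [{n}])" using ne by auto
    moreover have "{n} \<notin> set Bs" using sub n by fastforce
    ultimately show ?thesis
      using shape_eqI[of "Bs @ [{n}]" n] img[of "{}"] Bs Min_less c by (auto simp: sorted_append)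
  qed
  moreover have "shape (?\<phi> (Bs ! i)) = c[i := Suc (c ! i)]" if i: "i < length Bs" for i
  proof -
    let ?B = "Bs ! i"
    have B: "?B \<in> set Bs" using i by simp
    have nB: "n \<notin> C" if "C \<in> set Bs" for C using sub[OF that] n by auto
    have "?\<phi> ?B = set (Bs[i := insert n ?B])" using set_update_distinct[OF Bs(3) i] by simp
    moreover have "Min (insert n ?B) = Min ?B"
      using sub[OF B] Min_less[OF B] by (simp add: min_absorb2)
    then have "map Min (Bs[i := insert n ?B]) = map Min Bs"
      using i by (simp add: map_update list_update_same_conv)
    moreover have "distinct (Bs[i := insert n ?B])"
      using Bs(3) nB by (intro distinct_list_update) auto
    ultimately have "shape (?\<phi> ?B) = map card (Bs[i := insert n ?B])"
      using shape_eqI[of "Bs[i := insert n ?B]" n] img[of ?B] Bs(2) B by simp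
    also have "\<dots> = c[i := Suc (c ! i)]"
      using i nB[OF B] sub[OF B] c by (auto simp: map_update)
    finally show ?thesis .
  qed
  moreover have "(\<Sum>\<pi> | \<pi> \<in> set_partitions n \<and> delete_element n \<pi> = set Bs. P (shape \<pi>)) =
      P (shape (?\<phi> {})) + (\<Sum>B\<in>set Bs. P (shape (?\<phi> B)))"
    unfolding T using ne by (subst sum.reindex[OF rp(2)]) simp
  moreover have "(\<Sum>B\<in>set Bs. P (shape (?\<phi> B))) = (\<Sum>i<length Bs. P (shape (?\<phi> (Bs ! i))))"
    by (rule sum.reindex_bij_betw[OF bij_betw_nth[OF Bs(3) refl refl], symmetric])
  ultimately show ?thesis using c by auto
qed

text \<open>The element 1 becomes the minimum of the block that it joins, which therefore moves to
  the front of the shape.\<close>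

lemma sum_shapes_delete_first:
  assumes n: "n \<ge> 1" and Bs: "set Bs \<in> set_partitions (n - 1)" "sorted (map Min Bs)" "distinct Bs"
    and c: "map card Bs = c"
  shows "(\<Sum>\<pi> | \<pi> \<in> set_partitions n \<and> delete_element 1 \<pi> = set Bs. P (shape \<pi>)) =
    P (1 # c) + (\<Sum>i<length c. P (Suc (c ! i) # take i c @ drop (Suc i) c))"
proof -
  have p0: "partition_on {1..n - 1} (set Bs)" using Bs(1) by (simp add: set_partitions_def)
  define Cs where "Cs = map ((`) Suc) Bs"
  have set_Cs: "set Cs = (`) Suc ` set Bs" by (simp add: Cs_def)
  have p: "partition_on (Suc ` {1..n - 1}) (set Cs)"
  proof -
    have "(`) Suc ` set Bs - {{}} = (`) Suc ` set Bs" using p0 unfolding partition_on_def by auto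
    then show ?thesis using partition_on_inj_image[OF p0, of Suc] by (simp add: set_Cs)
  qed
  have n1: "insert 1 (Suc ` {1..n - 1}) = {1..n}" "1 \<notin> Suc ` {1..n - 1}"
    using n by (auto simp: image_Suc_atLeastAtMost)
  have sub0: "B \<subseteq> {1..n - 1}" "B \<noteq> {}" "finite B" if "B \<in> set Bs" for B
    using that p0 finite_subset[of B "{1..n - 1}"] unfolding partition_on_def by auto
  have dCs: "distinct Cs" unfolding Cs_def using Bs(3) by (auto simp: distinct_map inj_on_def inj_image_eq_iff)
  have MinS: "Min (Suc ` B) = Suc (Min B)" if "B \<in> set Bs" for B
    using sub0[OF that] by (intro mono_Min_commute[symmetric]) (auto simp: mono_def)
  then have mCs: "map Min Cs = map Suc (map Min Bs)" by (simp add: Cs_def)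
  have sCs: "sorted (map Min Cs)" unfolding mCs using Bs(2) by (simp add: sorted_map mono_def sorted_wrt_map)
  have cCs: "map card Cs = c" using c by (auto simp: Cs_def card_image)
  have sub: "C \<noteq> {}" "finite C" "1 \<notin> C" "Min C \<ge> 1" if C: "C \<in> set Cs" for C
  proof -
    obtain B where B: "B \<in> set Bs" "C = Suc ` B" using C unfolding set_Cs by auto
    have "0 \<notin> B" using sub0(1)[OF B(1)] by auto
    then show "C \<noteq> {}" "finite C" "1 \<notin> C" "Min C \<ge> 1"
      using sub0[OF B(1)] MinS[OF B(1)] B(2) by auto
  qed
  have ne: "{} \<notin> set Cs" using sub by auto
  let ?\<phi> = "\<lambda>B. insert (insert 1 B) (set Cs - {B})"
  note rp = partition_on_remove_point[OF p n1(2), unfolded n1(1)]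
  have T: "{\<pi>. \<pi> \<in> set_partitions n \<and> delete_element 1 \<pi> = set Bs} = ?\<phi> ` insert {} (set Cs)"
  proof -
    have "delete_element 1 \<pi> = set Bs \<longleftrightarrow> (\<lambda>B. B - {1}) ` \<pi> - {{}} = set Cs" if "partition_on {1..n} \<pi>" for \<pi>
      unfolding set_Cs using that by (intro delete_first_eq_iff) (simp add: set_partitions_def)
    then show ?thesis
      unfolding rp(1)[symmetric] set_partitions_def mem_Collect_eq by (intro Collect_cong conj_cong refl) simp
  qed
  then have img: "?\<phi> B \<in> set_partitions n" if "B \<in> insert {} (set Cs)" for B using that by blast
  have "shape (?\<phi> {}) = 1 # c"
  proof -
    have "?\<phi> {} = set ({1} # Cs)" using ne by auto
    moreover have "{1} \<notin> set Cs" using sub by auto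
    ultimately show ?thesis
      using shape_eqI[of "{1} # Cs" n] img[of "{}"] sCs dCs cCs sub(4) by auto
  qed
  moreover have "shape (?\<phi> (Cs ! i)) = Suc (c ! i) # take i c @ drop (Suc i) c" if i: "i < length Cs" for i
  proof -
    let ?C = "Cs ! i" and ?R = "take i Cs @ drop (Suc i) Cs"
    have C: "?C \<in> set Cs" using i by simp
    have split: "Cs = take i Cs @ ?C # drop (Suc i) Cs" using i by (rule id_take_nth_drop)
    have d: "distinct (take i Cs @ ?C # drop (Suc i) Cs)" using dCs split by simp
    have "set Cs = insert ?C (set ?R)" using arg_cong[OF split, of set] by auto
    then have R: "set ?R = set Cs - {?C}" using d by auto
    have dR: "distinct ?R" using d by auto
    have "sorted (map Min (take i Cs @ ?C # drop (Suc i) Cs))" using sCs split by simp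
    then have sR: "sorted (map Min ?R)" by (auto simp: sorted_append)
    have M1: "Min (insert 1 ?C) = 1" using sub[OF C] by (simp add: min_absorb1)
    have notin: "insert 1 ?C \<notin> set ?R" unfolding R using sub by auto
    have "?\<phi> ?C = set (insert 1 ?C # ?R)" unfolding R[symmetric] by simp
    moreover have "sorted (map Min (insert 1 ?C # ?R))"
      using sR M1 sub(4) R by auto
    ultimately have "shape (?\<phi> ?C) = map card (insert 1 ?C # ?R)"
      using shape_eqI[of "insert 1 ?C # ?R" n] img[of ?C] C dR notin by simp
    also have "\<dots> = Suc (c ! i) # take i c @ drop (Suc i) c"
      using sub[OF C] i cCs by (auto simp: take_map drop_map)
    finally show ?thesis .
  qed
  moreover have "(\<Sum>\<pi> | \<pi> \<in> set_partitions n \<and> delete_element 1 \<pi> = set Bs. P (shape \<pi>)) =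
      P (shape (?\<phi> {})) + (\<Sum>B\<in>set Cs. P (shape (?\<phi> B)))"
    unfolding T using ne by (subst sum.reindex[OF rp(2)]) simp
  moreover have "(\<Sum>B\<in>set Cs. P (shape (?\<phi> B))) = (\<Sum>i<length Cs. P (shape (?\<phi> (Cs ! i))))"
    by (rule sum.reindex_bij_betw[OF bij_betw_nth[OF dCs refl refl], symmetric])
  ultimately show ?thesis using cCs by auto
qed

section \<open>Stationarity as relations between shape probabilities\<close>

lemma prob_delete_element:
  assumes X: "random_partition n M X" and j: "1 \<le> j" "j \<le> n" and \<rho>: "\<rho> \<in> set_partitions (n - 1)"
  shows "measure (distr M (count_space (set_partitions (n - 1))) (\<lambda>\<omega>. delete_element j (X \<omega>))) {\<rho>} =
    (\<Sum>\<pi> | \<pi> \<in> set_partitions n \<and> delete_element j \<pi> = \<rho>. \<P>(\<omega> in M. X \<omega> = \<pi>))"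
proof -
  interpret prob_space M using X by (simp add: random_partition_def)
  have mX: "X \<in> measurable M (count_space (set_partitions n))" using X by (simp add: random_partition_def)
  have in_SP: "X \<omega> \<in> set_partitions n" if "\<omega> \<in> space M" for \<omega>
    using measurable_space[OF mX that] by simp
  have "(\<lambda>\<omega>. delete_element j (X \<omega>)) \<in> measurable M (count_space (set_partitions (n - 1)))"
    by (rule measurable_compose[OF mX]) (use delete_element_in_set_partitions[OF _ j] in auto)
  then have "measure (distr M (count_space (set_partitions (n - 1))) (\<lambda>\<omega>. delete_element j (X \<omega>))) {\<rho>} =
      prob ((\<lambda>\<omega>. delete_element j (X \<omega>)) -` {\<rho>} \<inter> space M)"
    using \<rho> by (intro measure_distr) auto
  also have "(\<lambda>\<omega>. delete_element j (X \<omega>)) -` {\<rho>} \<inter> space M =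
      (\<Union>\<pi>\<in>{\<pi>. \<pi> \<in> set_partitions n \<and> delete_element j \<pi> = \<rho>}. {\<omega> \<in> space M. X \<omega> = \<pi>})"
    using in_SP by auto
  also have "prob \<dots> = (\<Sum>\<pi> | \<pi> \<in> set_partitions n \<and> delete_element j \<pi> = \<rho>. \<P>(\<omega> in M. X \<omega> = \<pi>))"
  proof (rule finite_measure_finite_Union)
    show "(\<lambda>\<pi>. {\<omega> \<in> space M. X \<omega> = \<pi>}) ` {\<pi>. \<pi> \<in> set_partitions n \<and> delete_element j \<pi> = \<rho>} \<subseteq> events"
    proof
      fix A assume "A \<in> (\<lambda>\<pi>. {\<omega> \<in> space M. X \<omega> = \<pi>}) ` {\<pi>. \<pi> \<in> set_partitions n \<and> delete_element j \<pi> = \<rho>}"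
      then obtain \<pi> where \<pi>: "\<pi> \<in> set_partitions n" "A = {\<omega> \<in> space M. X \<omega> = \<pi>}" by auto
      have "X -` {\<pi>} \<inter> space M \<in> events" using \<pi>(1) by (intro measurable_sets[OF mX]) auto
      moreover have "X -` {\<pi>} \<inter> space M = A" using \<pi>(2) by auto
      ultimately show "A \<in> events" by simp
    qed
    show "disjoint_family_on (\<lambda>\<pi>. {\<omega> \<in> space M. X \<omega> = \<pi>}) {\<pi>. \<pi> \<in> set_partitions n \<and> delete_element j \<pi> = \<rho>}"
      by (auto simp: disjoint_family_on_def)
  qed simp
  finally show ?thesis .
qed

text \<open>Separates the relations for different \<open>l\<close>: from a given composition of
  \<open>n - 1\<close>, the prescribed multiset is reached by enlarging blocks of one size only. The
  count of \<open>x\<close> would tell two such sizes apart.\<close>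

lemma add_mset_Suc_inj:
  assumes "x \<in># A" "add_mset (Suc x) (A - {#x#}) = add_mset (Suc y) (A - {#y#})"
  shows "x = y"
proof (rule ccontr)
  assume "x \<noteq> y"
  have "count (add_mset (Suc x) (A - {#x#})) x < count (add_mset (Suc y) (A - {#y#})) x"
    using assms(1) \<open>x \<noteq> y\<close> count_greater_zero_iff[of A x] by auto
  then show False using assms(2) by simp
qed

lemma mset_move_front:
  assumes "i < length c"
  shows "mset (l # take i c @ drop (Suc i) c) = add_mset l (mset c - {#c ! i#})"
    and "mset (c[i := l]) = add_mset l (mset c - {#c ! i#})"
proof -
  have "mset c = mset (take i c @ c ! i # drop (Suc i) c)" using id_take_nth_drop[OF assms] by simp
  then show "mset (l # take i c @ drop (Suc i) c) = add_mset l (mset c - {#c ! i#})" by simp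
  show "mset (c[i := l]) = add_mset l (mset c - {#c ! i#})" using assms by (simp add: mset_update)
qed

lemma ranked_shape_eq_iff:
  assumes "integer_partition n lam"
  shows "ranked_shape \<pi> = lam \<longleftrightarrow> mset (shape \<pi>) = mset lam"
proof
  show "mset (shape \<pi>) = mset lam" if "ranked_shape \<pi> = lam"
    using that by (auto simp: ranked_shape_def)
  assume "mset (shape \<pi>) = mset lam"
  moreover have "sorted (rev lam)" using assms by (simp add: integer_partition_def sorted_wrt_rev)
  ultimately have "sort (shape \<pi>) = rev lam" by (intro properties_for_sort) simp_all
  then show "ranked_shape \<pi> = lam" by (simp add: ranked_shape_def)
qed

lemma random_partition_total:
  assumes "random_partition n M X"
  shows "(\<Sum>\<pi>\<in>set_partitions n. \<P>(\<omega> in M. X \<omega> = \<pi>)) = 1"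
    and "\<pi> \<in> set_partitions n \<Longrightarrow> {\<omega> \<in> space M. X \<omega> = \<pi>} \<in> sets M"
    and "\<omega> \<in> space M \<Longrightarrow> X \<omega> \<in> set_partitions n"
proof -
  interpret prob_space M using assms by (simp add: random_partition_def)
  have mX: "X \<in> measurable M (count_space (set_partitions n))" using assms by (simp add: random_partition_def)
  show in_SP: "X \<omega> \<in> set_partitions n" if "\<omega> \<in> space M" for \<omega>
    using measurable_space[OF mX that] by simp
  show ev: "{\<omega> \<in> space M. X \<omega> = \<pi>} \<in> events" if "\<pi> \<in> set_partitions n" for \<pi>
  proof -
    have "X -` {\<pi>} \<inter> space M \<in> events" using that by (intro measurable_sets[OF mX]) auto
    moreover have "X -` {\<pi>} \<inter> space M = {\<omega> \<in> space M. X \<omega> = \<pi>}" by auto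
    ultimately show ?thesis by simp
  qed
  have "(\<Sum>\<pi>\<in>set_partitions n. \<P>(\<omega> in M. X \<omega> = \<pi>)) = prob (\<Union>\<pi>\<in>set_partitions n. {\<omega> \<in> space M. X \<omega> = \<pi>})"
    using ev by (intro finite_measure_finite_Union[symmetric]) (auto simp: disjoint_family_on_def)
  also have "(\<Union>\<pi>\<in>set_partitions n. {\<omega> \<in> space M. X \<omega> = \<pi>}) = space M" using in_SP by auto
  finally show "(\<Sum>\<pi>\<in>set_partitions n. \<P>(\<omega> in M. X \<omega> = \<pi>)) = 1" by (simp add: prob_space)
qed

lemma PES_shape_probabilities:
  assumes n: "n \<ge> 1" and lam: "integer_partition n lam" and PES: "PES n M X"
    and AE: "AE \<omega> in M. ranked_shape (X \<omega>) = lam"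
  shows "\<exists>C. \<forall>\<pi>\<in>set_partitions n. \<P>(\<omega> in M. X \<omega> = \<pi>) = (if mset (shape \<pi>) = mset lam then C else 0)"
proof -
  have rp: "random_partition n M X" and pe: "partially_exchangeable n M X" and st: "stationary n M X"
    using PES by (auto simp: PES_def)
  interpret prob_space M using rp by (simp add: random_partition_def)
  have lam': "0 \<notin> set lam" "sum_list lam = n" using lam by (auto simp: integer_partition_def)
  \<comment> \<open>By partial exchangeability the chosen representative does not matter. The
    default 0 extends \<open>P\<close> to words that are not shapes, so that the relations can be
    stated for all words.\<close>
  define P where "P = (\<lambda>w. if \<exists>\<pi>\<in>set_partitions n. shape \<pi> = w
    then \<P>(\<omega> in M. X \<omega> = (SOME \<pi>. \<pi> \<in> set_partitions n \<and> shape \<pi> = w)) else 0)"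
  have pe': "\<P>(\<omega> in M. X \<omega> = \<pi>) = \<P>(\<omega> in M. X \<omega> = \<rho>)"
    if "\<pi> \<in> set_partitions n" "\<rho> \<in> set_partitions n" "shape \<pi> = shape \<rho>" for \<pi> \<rho>
    using pe that unfolding partially_exchangeable_def by blast
  have P_shape: "\<P>(\<omega> in M. X \<omega> = \<pi>) = P (shape \<pi>)" if \<pi>: "\<pi> \<in> set_partitions n" for \<pi>
  proof -
    let ?\<rho> = "SOME \<rho>. \<rho> \<in> set_partitions n \<and> shape \<rho> = shape \<pi>"
    have "?\<rho> \<in> set_partitions n \<and> shape ?\<rho> = shape \<pi>" by (rule someI_ex) (use \<pi> in blast)
    then have "\<P>(\<omega> in M. X \<omega> = \<pi>) = \<P>(\<omega> in M. X \<omega> = ?\<rho>)"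
      using \<pi> by (intro pe') auto
    moreover have "P (shape \<pi>) = \<P>(\<omega> in M. X \<omega> = ?\<rho>)"
      unfolding P_def by (rule if_P) (use \<pi> in blast)
    ultimately show ?thesis by simp
  qed
  have P0: "P w = 0" if w: "mset w \<noteq> mset lam" for w
  proof (cases "\<exists>\<pi>\<in>set_partitions n. shape \<pi> = w")
    case True
    then obtain \<pi> where \<pi>: "\<pi> \<in> set_partitions n" "shape \<pi> = w" by auto
    then have r: "ranked_shape \<pi> \<noteq> lam" using ranked_shape_eq_iff[OF lam] w by simp
    have "AE \<omega> in M. X \<omega> \<noteq> \<pi>" using AE by eventually_elim (use r in auto)
    then have "prob {\<omega> \<in> space M. X \<omega> = \<pi>} = 0"
      using prob_eq_0[of "{\<omega> \<in> space M. X \<omega> = \<pi>}"] random_partition_total(2)[OF rp \<pi>(1)] by simp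
    then show ?thesis using P_shape[OF \<pi>(1)] \<pi>(2) by simp
  next
    case False
    then show ?thesis by (simp add: P_def)
  qed
  have tot: "P (1 # c) + (\<Sum>i<length c. P (Suc (c ! i) # take i c @ drop (Suc i) c)) =
      P (c @ [1]) + (\<Sum>i<length c. P (c[i := Suc (c ! i)]))"
    if c: "0 \<notin> set c" "sum_list c = n - 1" for c
  proof -
    obtain Bs where Bs: "set Bs \<in> set_partitions (n - 1)" "sorted (map Min Bs)" "distinct Bs" "map card Bs = c"
      using composition_realised[OF c(1)] c(2) by auto
    have "(\<Sum>\<pi> | \<pi> \<in> set_partitions n \<and> delete_element j \<pi> = set Bs. \<P>(\<omega> in M. X \<omega> = \<pi>)) =
        (\<Sum>\<pi> | \<pi> \<in> set_partitions n \<and> delete_element j \<pi> = set Bs. P (shape \<pi>))" for j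
      by (intro sum.cong refl) (auto simp: P_shape)
    then show ?thesis
      using prob_delete_element[OF rp order_refl n Bs(1)] prob_delete_element[OF rp n order_refl Bs(1)]
        sum_shapes_delete_first[OF n Bs, of P] sum_shapes_delete_last[OF n Bs, of P] st
      unfolding stationary_def by simp
  qed
  \<comment> \<open>In \<open>tot\<close> the words with an additional 1 are longer by one than
    those with an enlarged block. For each \<open>c\<close> at most one kind has the length of
    \<open>lam\<close>, and so the identity splits.\<close>
  have size: "P w = 0" if "length w \<noteq> length lam" for w
    using that P0 by (metis size_mset)
  have "\<exists>C. \<forall>w. mset w = mset lam \<longrightarrow> P w = C"
  proof (rule words_uniform)
    show "\<bar>P w\<bar> \<le> 1" for w unfolding P_def by auto
    show "0 \<notin># mset lam" using lam' by simp
    show "P (1 # c) = P (c @ [1])" for c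
    proof (cases "mset (1 # c) = mset lam")
      case False
      then have "P (1 # c) = 0" "P (c @ [1]) = 0" by (intro P0; simp)+
      then show ?thesis by simp
    next
      case True
      have "set lam = set (1 # c)" using True by (metis mset_eq_setD)
      then have "0 \<notin> set c" using lam' by auto
      moreover have "sum_list c = n - 1"
        using arg_cong[OF True, of sum_mset] lam' by (simp add: sum_mset_sum_list)
      moreover have "length lam = Suc (length c)" using arg_cong[OF True, of size] by simp
      then have "P (Suc (c ! i) # take i c @ drop (Suc i) c) = 0" "P (c[i := Suc (c ! i)]) = 0"
        if "i < length c" for i using that by (intro size; simp)+
      ultimately show ?thesis using tot[of c] by simp
    qed
    fix l :: nat and c :: "nat list"
    assume l: "l \<ge> 2"
    let ?I = "{i. i < length c \<and> c ! i = l - 1}"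
    let ?f = "\<lambda>i. P (Suc (c ! i) # take i c @ drop (Suc i) c) - P (c[i := Suc (c ! i)])"
    have eq: "(\<Sum>i\<in>?I. P (l # take i c @ drop (Suc i) c) - P (c[i := l])) = sum ?f ?I"
      using l by (intro sum.cong) auto
    show "(\<Sum>i | i < length c \<and> c ! i = l - 1. P (l # take i c @ drop (Suc i) c) - P (c[i := l])) = 0"
    proof (cases "?I \<noteq> {} \<and> add_mset l (mset c - {#l - 1#}) = mset lam")
      case False
      have "P (l # take i c @ drop (Suc i) c) - P (c[i := l]) = 0" if i: "i \<in> ?I" for i
      proof -
        have "add_mset l (mset c - {#l - 1#}) \<noteq> mset lam" using False i by blast
        then have "mset (l # take i c @ drop (Suc i) c) \<noteq> mset lam" "mset (c[i := l]) \<noteq> mset lam"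
          using mset_move_front[of i c l] i by auto
        then show ?thesis using P0 by simp
      qed
      then show ?thesis by simp
    next
      case True
      then have m: "add_mset l (mset c - {#l - 1#}) = mset lam" and mem: "l - 1 \<in># mset c"
        by (auto simp: in_set_conv_nth)
      then obtain A where A: "mset c = add_mset (l - 1) A" by (metis mset_add)
      have mA: "mset lam = add_mset l A" using m A by simp
      have "set lam = insert l (set_mset A)" using arg_cong[OF mA, of set_mset] by simp
      moreover have "set c = insert (l - 1) (set_mset A)" using arg_cong[OF A, of set_mset] by simp
      ultimately have "0 \<notin> set c" using lam' l by auto
      moreover have "sum_list c = n - 1"
        using arg_cong[OF mA, of sum_mset] arg_cong[OF A, of sum_mset] lam' l by (simp add: sum_mset_sum_list)
      moreover have "P (1 # c) = 0" "P (c @ [1]) = 0"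
        using arg_cong[OF mA, of size] arg_cong[OF A, of size] by (intro size; simp)+
      ultimately have "(\<Sum>i<length c. ?f i) = 0" using tot[of c] by (simp add: sum_subtractf)
      moreover have "(\<Sum>i<length c. ?f i) = sum ?f ?I"
      proof (rule sum.mono_neutral_right)
        show "\<forall>i\<in>{..<length c} - ?I. ?f i = 0"
        proof
          fix i assume i: "i \<in> {..<length c} - ?I"
          have "add_mset (Suc (c ! i)) (mset c - {#c ! i#}) \<noteq> mset lam"
          proof
            assume "add_mset (Suc (c ! i)) (mset c - {#c ! i#}) = mset lam"
            then have "add_mset (Suc (c ! i)) (mset c - {#c ! i#}) = add_mset (Suc (l - 1)) (mset c - {#l - 1#})"
              using m l by simp
            moreover have "c ! i \<in># mset c" using i by simp
            ultimately have "c ! i = l - 1" by (intro add_mset_Suc_inj)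
            then show False using i by simp
          qed
          then show "?f i = 0" using mset_move_front[of i c "Suc (c ! i)"] i P0 by simp
        qed
      qed auto
      ultimately show ?thesis unfolding eq by simp
    qed
  qed
  then obtain C where "\<And>w. mset w = mset lam \<Longrightarrow> P w = C" by auto
  then show ?thesis using P_shape P0 by (intro exI[of _ C]) auto
qed

section \<open>Uniqueness of the law and extremality\<close>

lemma PES_distribution_uniform:
  assumes "n \<ge> 1" "integer_partition n lam" "PES n M X" "AE \<omega> in M. ranked_shape (X \<omega>) = lam"
  shows "Poly_Mapping.lookup (distribution n M X) \<pi> =
    (if \<pi> \<in> set_partitions n \<and> mset (shape \<pi>) = mset lam
     then 1 / card {\<pi> \<in> set_partitions n. mset (shape \<pi>) = mset lam} else 0)"
proof -
  let ?L = "{\<pi> \<in> set_partitions n. mset (shape \<pi>) = mset lam}"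
  obtain C where C: "\<And>\<pi>. \<pi> \<in> set_partitions n \<Longrightarrow>
      \<P>(\<omega> in M. X \<omega> = \<pi>) = (if mset (shape \<pi>) = mset lam then C else 0)"
    using PES_shape_probabilities[OF assms] by blast
  have "(\<Sum>\<pi>\<in>set_partitions n. \<P>(\<omega> in M. X \<omega> = \<pi>)) = 1"
    using assms(3) by (intro random_partition_total) (simp add: PES_def)
  then have "(\<Sum>\<pi>\<in>set_partitions n. if mset (shape \<pi>) = mset lam then C else 0) = 1"
    by (simp add: C)
  then have "real (card ?L) * C = 1" by (simp add: sum.inter_filter[symmetric])
  then have "real (card ?L) \<noteq> 0" by (metis mult_zero_left zero_neq_one)
  moreover have "C * real (card ?L) = 1"
    using \<open>real (card ?L) * C = 1\<close> by (simp only: mult.commute)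
  ultimately have "C = 1 / card ?L" by (rule eq_divide_imp)
  then show ?thesis by (simp add: lookup_distribution C)
qed

text \<open>Serves the components of a convex combination, of which at first only the vanishing of
  their mass off the prescribed shapes is known.\<close>

lemma PES_distribution_dominated:
  assumes n: "n \<ge> 1" and lam: "integer_partition n lam" and PES: "PES n M X"
    and dom: "\<And>\<pi>. \<pi> \<in> set_partitions n \<Longrightarrow> mset (shape \<pi>) \<noteq> mset lam \<Longrightarrow>
      Poly_Mapping.lookup (distribution n M X) \<pi> = 0"
  shows "AE \<omega> in M. ranked_shape (X \<omega>) = lam"
proof -
  have rp: "random_partition n M X" using PES by (simp add: PES_def)
  interpret prob_space M using rp by (simp add: random_partition_def)
  let ?B = "{\<pi> \<in> set_partitions n. mset (shape \<pi>) \<noteq> mset lam}"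
  have "AE \<omega> in M. X \<omega> \<noteq> \<pi>" if \<pi>: "\<pi> \<in> ?B" for \<pi>
  proof -
    have "prob {\<omega> \<in> space M. X \<omega> = \<pi>} = 0" using dom[of \<pi>] \<pi> by (simp add: lookup_distribution)
    then show ?thesis
      using prob_eq_0[of "{\<omega> \<in> space M. X \<omega> = \<pi>}"] random_partition_total(2)[OF rp] \<pi> by auto
  qed
  then have "AE \<omega> in M. \<forall>\<pi>\<in>?B. X \<omega> \<noteq> \<pi>" by (intro AE_finite_allI) auto
  then show ?thesis
  proof (rule AE_mp)
    show "AE \<omega> in M. (\<forall>\<pi>\<in>?B. X \<omega> \<noteq> \<pi>) \<longrightarrow> ranked_shape (X \<omega>) = lam"
      using random_partition_total(3)[OF rp] by (intro AE_I2) (auto simp: ranked_shape_eq_iff[OF lam])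
  qed
qed

lemma lookup_scaleR: "Poly_Mapping.lookup (r *\<^sub>R x) i = r * Poly_Mapping.lookup x i"
  for x :: "'a \<Rightarrow>\<^sub>0 real"
proof -
  have "finite {i. r *\<^sub>R Poly_Mapping.lookup x i \<noteq> 0}"
    by (rule finite_subset[OF _ finite_lookup[of x]]) auto
  then show ?thesis by (simp add: scaleR_poly_mapping_def Abs_poly_mapping_inverse)
qed

theorem proposition10:
  fixes n :: nat and lam :: "nat list" and M :: "'w measure" and X :: "'w \<Rightarrow> nat set set"
  assumes "n \<ge> 1"
    and "integer_partition n lam"
    and "PES n M X"
    and "AE \<omega> in M. ranked_shape (X \<omega>) = lam"
  shows "exchangeable n M X \<and> distribution n M X extreme_point_of PES_distributions n"
proof
  let ?d = "distribution n M X"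
  note unif = PES_distribution_uniform[OF assms(1,2)]
  show "exchangeable n M X"
    unfolding exchangeable_def
  proof (intro ballI impI)
    fix \<pi> \<rho> assume *: "\<pi> \<in> set_partitions n" "\<rho> \<in> set_partitions n" "ranked_shape \<pi> = ranked_shape \<rho>"
    have "mset (shape \<pi>) = mset (shape \<rho>)" using arg_cong[OF *(3), of mset] by (simp add: ranked_shape_def)
    then have "Poly_Mapping.lookup ?d \<pi> = Poly_Mapping.lookup ?d \<rho>"
      unfolding unif[OF assms(3,4)] using *(1,2) by simp
    then show "\<P>(\<omega> in M. X \<omega> = \<pi>) = \<P>(\<omega> in M. X \<omega> = \<rho>)" using *(1,2) by (simp add: lookup_distribution)
  qed
  show "?d extreme_point_of PES_distributions n"
    unfolding extreme_point_of_def
  proof (intro conjI ballI)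
    show "?d \<in> PES_distributions n" using distribution_in_PES_distributions[OF assms(3,1)] .
    fix a b assume a: "a \<in> PES_distributions n" and b: "b \<in> PES_distributions n"
    show "?d \<notin> open_segment a b"
    proof
      assume "?d \<in> open_segment a b"
      then obtain u where "a \<noteq> b" and u: "0 < u" "u < 1" and d: "?d = (1 - u) *\<^sub>R a + u *\<^sub>R b"
        by (auto simp: in_segment)
      have lookup: "Poly_Mapping.lookup ?d \<pi> = (1 - u) * Poly_Mapping.lookup a \<pi> + u * Poly_Mapping.lookup b \<pi>" for \<pi>
        unfolding d by (simp add: lookup_add lookup_scaleR)
      have nonneg: "Poly_Mapping.lookup e \<pi> \<ge> 0" if "e \<in> PES_distributions n" for e \<pi>
        using that by (auto simp: PES_distributions_def lookup_distribution)
      have "e = ?d" if e: "e \<in> PES_distributions n" and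
        e0: "\<And>\<pi>. Poly_Mapping.lookup ?d \<pi> = 0 \<Longrightarrow> Poly_Mapping.lookup e \<pi> = 0" for e
      proof -
        obtain M' :: "nat set set measure" and X' where e': "e = distribution n M' X'" "PES n M' X'"
          using e by (auto simp: PES_distributions_def)
        have "AE \<omega> in M'. ranked_shape (X' \<omega>) = lam"
          using e0 unfolding e'(1) unif[OF assms(3,4)]
          by (intro PES_distribution_dominated[OF assms(1,2) e'(2)]) auto
        then show ?thesis
          unfolding e'(1) by (intro poly_mapping_eqI) (simp add: unif[OF assms(3,4)] unif[OF e'(2)])
      qed
      \<comment> \<open>Both weights are positive and both laws nonnegative, so a zero of the
        mixture is a zero of each component.\<close>
      moreover have "Poly_Mapping.lookup a \<pi> = 0 \<and> Poly_Mapping.lookup b \<pi> = 0" if "Poly_Mapping.lookup ?d \<pi> = 0" for \<pi>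
      proof -
        have "(1 - u) * Poly_Mapping.lookup a \<pi> \<ge> 0" "u * Poly_Mapping.lookup b \<pi> \<ge> 0"
          using nonneg[OF a] nonneg[OF b] u by simp_all
        then have "(1 - u) * Poly_Mapping.lookup a \<pi> = 0" "u * Poly_Mapping.lookup b \<pi> = 0"
          using lookup[of \<pi>] that by linarith+
        then show ?thesis using u by simp
      qed
      ultimately have "a = ?d" "b = ?d" using a b by blast+
      then show False using \<open>a \<noteq> b\<close> by simp
    qed
  qed
qed

end
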